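(* Let $X=\{Y(E_t),t\ge0\}$, where $Y=\{Y(x),x\ge0\}$ is a stable Lévy motion of index $\alpha\in(0,2]$ with values in $\mathbb{R}^d$ and $E_t=\inf\{x\ge0:D(x)>t\}$ is the inverse of a stable subordinator $D$ of index $0<\beta<1$, independent of $Y$. Then $$\dim_{\rm H}X([0,1])=\dim_{\rm P}X([0,1])=\min\{d,\alpha\}\quad\text{a.s.}$$ and $$\dim_{\rm H}{\rm Gr}X([0,1])=\dim_{\rm P}{\rm Gr}X([0,1])=\begin{cases}\max\{1,\alpha\}&\text{if }\alpha\le d,\\ 1+\beta\left(1-\frac1\alpha\right)&\text{if }\alpha>d=1,\end{cases}\quad\text{a.s.}$$
   Context: $\dim_{\rm H}$ and $\dim_{\rm P}$ denote Hausdorff dimension and packing dimension of subsets of Euclidean space. $X([0,1])=\{X(t):t\in[0,1]\}$ is the range and ${\rm Gr}X([0,1])=\{(t,X(t)):t\in[0,1]\}$ is the graph, where $X(t)=Y(E_t)$. A stable Lévy motion of index $\alpha$ is here understood in the strict sense: a Lévy process $Y$ with $Y(0)=0$ such that $\{Y(cx),x\ge0\}$ and $\{c^{1/\alpha}Y(x),x\ge0\}$ have the same law for every $c>0$. A stable subordinator of index $\beta\in(0,1)$ is a nondecreasing strictly $\beta$-stable real Lévy process started at $0$ that is not identically zero.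
   Formalization: Added assumption: every linear subspace containing Y(1) a.s. has dimension at least min{d,α}. Without it the claim fails, e.g. for Y=0 or a linear Brownian motion embedded in the plane, whose range has too small a dimension. *)

theory Defs
  imports "HOL-Probability.Probability"
begin

text \<open>
  In both dimensions the infimum ranges over exponents \<open>s > 0\<close> only. Admitting \<open>s = 0\<close>
  would not change it, but \<open>0 powr 0 = 0\<close> in HOL, so the formulas below do not give the
  usual \<open>0\<close>-dimensional measures.
\<close>

definition hausdorff_premeasure :: "real \<Rightarrow> real \<Rightarrow> 'a::metric_space set \<Rightarrow> ennreal" where
  "hausdorff_premeasure s \<delta> A =
     (INF U \<in> {U :: nat \<Rightarrow> 'a set. A \<subseteq> (\<Union>i. U i) \<and> (\<forall>i. bounded (U i) \<and> diameter (U i) \<le> \<delta>)}.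
        \<Sum>i. ennreal (diameter (U i) powr s))"

definition hausdorff_measure :: "real \<Rightarrow> 'a::metric_space set \<Rightarrow> ennreal" where
  "hausdorff_measure s A = (SUP \<delta> \<in> {0<..}. hausdorff_premeasure s \<delta> A)"

definition hausdorff_dim :: "'a::metric_space set \<Rightarrow> ereal" where
  "hausdorff_dim A = Inf (ereal ` {s. 0 < s \<and> hausdorff_measure s A = 0})"

text \<open>A packing is a set of pairs (centre, radius) whose closed balls are disjoint.\<close>

definition packings :: "real \<Rightarrow> 'a::metric_space set \<Rightarrow> ('a \<times> real) set set" where
  "packings \<delta> A = {P. countable P \<and> P \<subseteq> A \<times> {0<..\<delta>} \<and>
     pairwise (\<lambda>(x, r) (y, q). disjnt (cball x r) (cball y q)) P}"

definition packing_premeasure :: "real \<Rightarrow> 'a::metric_space set \<Rightarrow> ennreal" where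
  "packing_premeasure s A =
     (INF \<delta> \<in> {0<..}. SUP P \<in> packings \<delta> A. \<Sum>\<^sub>\<infinity>(x, r)\<in>P. ennreal ((2 * r) powr s))"

definition packing_measure :: "real \<Rightarrow> 'a::metric_space set \<Rightarrow> ennreal" where
  "packing_measure s A =
     (INF B \<in> {B :: nat \<Rightarrow> 'a set. A \<subseteq> (\<Union>i. B i)}. \<Sum>i. packing_premeasure s (B i))"

definition packing_dim :: "'a::metric_space set \<Rightarrow> ereal" where
  "packing_dim A = Inf (ereal ` {s. 0 < s \<and> packing_measure s A = 0})"

text \<open>
  A process is a function \<open>Z :: real \<Rightarrow> 'w \<Rightarrow> 'a\<close>, of which only the times \<open>t \<ge> 0\<close> matter.
  Laws of processes are taken on the product sigma-algebra.
\<close>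

definition path_space :: "(real \<Rightarrow> 'a::euclidean_space) measure" where
  "path_space = (\<Pi>\<^sub>M t\<in>{0..}. borel)"

definition process_path :: "(real \<Rightarrow> 'w \<Rightarrow> 'a) \<Rightarrow> 'w \<Rightarrow> real \<Rightarrow> 'a" where
  "process_path Z \<omega> = (\<lambda>t\<in>{0..}. Z t \<omega>)"

definition process_law :: "'w measure \<Rightarrow> (real \<Rightarrow> 'w \<Rightarrow> 'a::euclidean_space) \<Rightarrow> (real \<Rightarrow> 'a) measure" where
  "process_law M Z = distr M path_space (process_path Z)"

text \<open>Not \<open>indep_var\<close>, which requires both variables to have the same type of values.\<close>

definition indep_processes ::
    "'w measure \<Rightarrow> (real \<Rightarrow> 'w \<Rightarrow> 'a::euclidean_space) \<Rightarrow> (real \<Rightarrow> 'w \<Rightarrow> 'b::euclidean_space) \<Rightarrow> bool" where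
  "indep_processes M Y Z \<longleftrightarrow> prob_space.indep_set M
     {process_path Y -` A \<inter> space M | A. A \<in> sets path_space}
     {process_path Z -` A \<inter> space M | A. A \<in> sets path_space}"

definition cadlag :: "(real \<Rightarrow> 'a::euclidean_space) \<Rightarrow> bool" where
  "cadlag f \<longleftrightarrow> (\<forall>t\<ge>0. continuous (at_right t) f) \<and> (\<forall>t>0. \<exists>l. (f \<longlongrightarrow> l) (at_left t))"

definition levy_process :: "'w measure \<Rightarrow> (real \<Rightarrow> 'w \<Rightarrow> 'a::euclidean_space) \<Rightarrow> bool" where
  "levy_process M Z \<longleftrightarrow>
     (\<forall>t\<ge>0. Z t \<in> borel_measurable M) \<and>
     (AE \<omega> in M. Z 0 \<omega> = 0) \<and>
     (\<forall>n (t :: nat \<Rightarrow> real). 0 \<le> t 0 \<and> strict_mono_on {..n} t \<longrightarrow>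
        prob_space.indep_vars M (\<lambda>_. borel) (\<lambda>i \<omega>. Z (t (Suc i)) \<omega> - Z (t i) \<omega>) {..<n}) \<and>
     (\<forall>s\<ge>0. \<forall>h\<ge>0. distr M borel (\<lambda>\<omega>. Z (s + h) \<omega> - Z s \<omega>) = distr M borel (\<lambda>\<omega>. Z h \<omega> - Z 0 \<omega>)) \<and>
     (\<forall>t\<ge>0. \<forall>\<epsilon>>0. ((\<lambda>s. measure M {\<omega> \<in> space M. norm (Z s \<omega> - Z t \<omega>) > \<epsilon>}) \<longlongrightarrow> 0) (at t within {0..})) \<and>
     (AE \<omega> in M. cadlag (\<lambda>t. Z t \<omega>))"

definition stable_levy_motion :: "'w measure \<Rightarrow> real \<Rightarrow> (real \<Rightarrow> 'w \<Rightarrow> 'a::euclidean_space) \<Rightarrow> bool" where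
  "stable_levy_motion M \<alpha> Y \<longleftrightarrow> levy_process M Y \<and>
     (\<forall>c>0. process_law M (\<lambda>x. Y (c * x)) = process_law M (\<lambda>x \<omega>. c powr (1 / \<alpha>) *\<^sub>R Y x \<omega>))"

definition stable_subordinator :: "'w measure \<Rightarrow> real \<Rightarrow> (real \<Rightarrow> 'w \<Rightarrow> real) \<Rightarrow> bool" where
  "stable_subordinator M \<beta> D \<longleftrightarrow> stable_levy_motion M \<beta> D \<and>
     (AE \<omega> in M. mono_on {0..} (\<lambda>x. D x \<omega>)) \<and>
     \<not> (AE \<omega> in M. \<forall>x\<ge>0. D x \<omega> = 0)"

definition inverse_process :: "(real \<Rightarrow> 'w \<Rightarrow> real) \<Rightarrow> real \<Rightarrow> 'w \<Rightarrow> real" where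
  "inverse_process D t \<omega> = Inf {x. 0 \<le> x \<and> D x \<omega> > t}"

text \<open>
  The definition of \<open>stable_levy_motion\<close> admits processes living in a proper subspace, such as
  \<open>Y = 0\<close> or a linear Brownian motion embedded in the plane, whose range has a smaller dimension
  than \<open>min d \<alpha>\<close>. The condition below is implied by the usual nondegeneracy (\<open>Y\<close> not confined to
  a proper subspace), and only rules out subspaces too small to contain a set of dimension
  \<open>min d \<alpha>\<close>. If \<open>d = 1\<close> or \<open>\<alpha> \<le> 1\<close>, it says that \<open>Y\<close> is not the zero process.
\<close>

definition not_confined :: "'w measure \<Rightarrow> real \<Rightarrow> (real \<Rightarrow> 'w \<Rightarrow> 'a::euclidean_space) \<Rightarrow> bool" where
  "not_confined M \<alpha> Y \<longleftrightarrow>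
     (\<forall>V. subspace V \<and> (AE \<omega> in M. Y 1 \<omega> \<in> V) \<longrightarrow> min (real DIM('a)) \<alpha> \<le> real (dim V))"

end

theory Submission
  imports Defs
begin

text \<open>
  Upper bounds. Count greedily the successive displacements of size \<open>\<epsilon>\<close> of a stable motion of index
  \<open>\<alpha>\<close> on a fine grid. During each time span of length of order \<open>\<epsilon> powr \<alpha>\<close>, the expected number of
  them is bounded, so almost surely \<open>[0, T]\<close> splits, for every dyadic \<open>\<epsilon>\<close>, into about
  \<open>\<epsilon> powr - \<alpha>\<close> pieces of oscillation at most \<open>2 * \<epsilon>\<close>. Applied to the paths of \<open>Y\<close> and \<open>D\<close>, this bounds the
  box counting dimension of range and graph path by path, without using independence.

  Lower bounds. As \<open>D\<close> is strictly increasing, the graph of \<open>X\<close> contains \<open>(D x, Y x)\<close> and its range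
  contains \<open>Y x\<close> for all small \<open>x\<close>. The occupation measures of these processes have finite energy,
  because small balls have small probability: \<open>P (norm (Y 1) \<le> \<rho>) \<le> C * \<rho> powr \<gamma>\<close> for
  \<open>\<gamma> \<le> min d \<alpha>\<close>. This follows from the decay \<open>q powr (norm u powr \<alpha>)\<close> of the characteristic
  function on the subspace that carries \<open>Y 1\<close>. Only for the graph with \<open>\<alpha> > d = 1\<close> is independence
  needed, to multiply the bounds for \<open>Y\<close> and \<open>D\<close>.
\<close>

section \<open>Hausdorff and packing dimension\<close>

text \<open>Resets are counted on dyadic grids because there independence of finitely many
  increments is enough: a hit at step \<open>j\<close> followed by a calm stretch takes the place of
  a passage time and the strong Markov property. The counts are not monotone under refinement, so
  only their lower limits are controlled, by Fatou's lemma, and the partition of a path is read off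
  from infinitely many grids.

  The law of \<open>Y 1\<close> is accessible only through self-similarity and independent
  increments, without density or isotropy. Scaling turns the length of a frequency \<open>u\<close>
  into the time \<open>norm u powr \<alpha>\<close>, and multiplicativity in time turns this time
  into a power of the modulus on the unit sphere of the carrying subspace, where compactness keeps
  it below 1.

  The constant \<open>1 + \<beta> * (1 - 1 / \<alpha>)\<close> arises from below as follows: a joint
  increment of \<open>D\<close> and \<open>Y\<close> over time \<open>h\<close> has size at most
  \<open>r\<close> with probability of order at most
  \<open>r powr (1 + b) * h powr - (b / \<beta> + 1 / \<alpha>)\<close>, and the singularity at
  \<open>h = 0\<close> is integrable exactly for
  \<open>b < \<beta> * (1 - 1 / \<alpha>)\<close>.\<close>

lemma bounded_diameter_le:
  fixes S :: "'a::metric_space set"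
  assumes "0 \<le> \<delta>" "\<And>x y. x \<in> S \<Longrightarrow> y \<in> S \<Longrightarrow> dist x y \<le> \<delta>"
  shows "bounded S" "diameter S \<le> \<delta>"
proof -
  show "bounded S"
    using assms(2) unfolding bounded_def by blast
  show "diameter S \<le> \<delta>"
    using assms by (auto simp: diameter_def intro!: cSUP_least)
qed

lemma diameter_nonneg [simp]: "0 \<le> diameter (S :: 'a::metric_space set)" if "bounded S"
  using that diameter_ge_0 by blast

lemma hausdorff_measure_eq_0_iff:
  "hausdorff_measure s A = 0 \<longleftrightarrow> (\<forall>\<delta>>0. hausdorff_premeasure s \<delta> A = 0)"
proof -
  have "hausdorff_measure s A = bot \<longleftrightarrow> (\<forall>\<delta>\<in>{0<..}. hausdorff_premeasure s \<delta> A = bot)"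
    unfolding hausdorff_measure_def by (rule SUP_bot_conv)
  then show ?thesis by (simp add: bot_ennreal Ball_def)
qed

lemma hausdorff_premeasure_le:
  assumes "A \<subseteq> (\<Union>i. U i)" "\<And>i. bounded (U i)" "\<And>i. diameter (U i) \<le> \<delta>"
  shows "hausdorff_premeasure s \<delta> A \<le> (\<Sum>i. ennreal (diameter (U i) powr s))"
  unfolding hausdorff_premeasure_def using assms by (intro INF_lower) auto

lemma hausdorff_premeasure_lessE:
  fixes A :: "'a::metric_space set"
  assumes "hausdorff_premeasure s \<delta> A < e"
  obtains U :: "nat \<Rightarrow> 'a::metric_space set"
  where "A \<subseteq> (\<Union>i. U i)" "\<And>i. bounded (U i)" "\<And>i. diameter (U i) \<le> \<delta>"
    "(\<Sum>i. ennreal (diameter (U i) powr s)) < e"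
  using assms unfolding hausdorff_premeasure_def INF_less_iff by blast

lemma hausdorff_premeasure_mono_exponent:
  fixes A :: "'a::metric_space set"
  assumes "s \<le> t" "0 < \<delta>" "\<delta> \<le> 1"
  shows "hausdorff_premeasure t \<delta> A \<le> hausdorff_premeasure s \<delta> A"
  unfolding hausdorff_premeasure_def
proof (rule INF_superset_mono, rule order_refl)
  fix U :: "nat \<Rightarrow> 'a set" assume "U \<in> {U. A \<subseteq> \<Union> (range U) \<and> (\<forall>i. bounded (U i) \<and> diameter (U i) \<le> \<delta>)}"
  then have U: "\<And>i. 0 \<le> diameter (U i)" "\<And>i. diameter (U i) \<le> 1"
    using assms(3) by (auto intro: order_trans)
  show "(\<Sum>i. ennreal (diameter (U i) powr t)) \<le> (\<Sum>i. ennreal (diameter (U i) powr s))"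
  proof (intro suminf_le ennreal_leI)
    show "diameter (U i) powr t \<le> diameter (U i) powr s" for i
      using powr_mono'[OF assms(1) U[of i]] by (cases "diameter (U i) = 0") auto
  qed auto
qed

lemma hausdorff_measure_eq_0_mono_exponent:
  fixes A :: "'a::metric_space set"
  assumes "s \<le> t" "hausdorff_measure s A = 0"
  shows "hausdorff_measure t A = 0"
  unfolding hausdorff_measure_eq_0_iff
proof (intro allI impI)
  fix \<delta> :: real assume "0 < \<delta>"
  \<comment> \<open>Only for diameters at most 1 does a larger exponent give smaller terms, so the
    scale is lowered first; this can only raise the premeasure of exponent \<open>t\<close>.\<close>
  define \<delta>' where "\<delta>' = min 1 \<delta>"
  have d: "0 < \<delta>'" "\<delta>' \<le> 1" "\<delta>' \<le> \<delta>" using \<open>0 < \<delta>\<close> by (auto simp: \<delta>'_def)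
  have "hausdorff_premeasure t \<delta> A \<le> hausdorff_premeasure t \<delta>' A"
    unfolding hausdorff_premeasure_def using d(3)
    by (intro INF_superset_mono) (auto intro: order_trans)
  also have "\<dots> \<le> hausdorff_premeasure s \<delta>' A"
    using hausdorff_premeasure_mono_exponent[OF assms(1) d(1,2)] .
  also have "\<dots> = 0" using assms(2) d(1) unfolding hausdorff_measure_eq_0_iff by blast
  finally show "hausdorff_premeasure t \<delta> A = 0" by simp
qed

lemma hausdorff_dim_geI:
  assumes "\<And>s. 0 < s \<Longrightarrow> s < \<gamma> \<Longrightarrow> hausdorff_measure s A \<noteq> 0"
  shows "ereal \<gamma> \<le> hausdorff_dim A"
  unfolding hausdorff_dim_def
proof (rule Inf_greatest, clarsimp)
  fix s assume s: "0 < s" "hausdorff_measure s A = 0"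
  show "\<gamma> \<le> s"
    using assms[OF s(1)] s(2) by (cases "s < \<gamma>") auto
qed

lemma hausdorff_measure_mono: "A \<subseteq> B \<Longrightarrow> hausdorff_measure s A \<le> hausdorff_measure s B"
  unfolding hausdorff_measure_def hausdorff_premeasure_def
  by (intro SUP_mono' INF_superset_mono) auto

lemma hausdorff_dim_mono: "A \<subseteq> B \<Longrightarrow> hausdorff_dim A \<le> hausdorff_dim B"
  unfolding hausdorff_dim_def using hausdorff_measure_mono[of A B]
  by (intro Inf_superset_mono image_mono) (auto, metis le_zero_eq)

lemma hausdorff_measure_image_eq_0:
  fixes A :: "'a::metric_space set" and p :: "'a \<Rightarrow> 'b::metric_space"
  assumes lip: "\<And>x y. dist (p x) (p y) \<le> dist x y" and "0 < s" "hausdorff_measure s A = 0"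
  shows "hausdorff_measure s (p ` A) = 0"
  unfolding hausdorff_measure_eq_0_iff
proof (intro allI impI)
  fix \<delta> :: real assume "0 < \<delta>"
  have "hausdorff_premeasure s \<delta> (p ` A) \<le> hausdorff_premeasure s \<delta> A"
    unfolding hausdorff_premeasure_def[of s \<delta> A]
  proof (rule INF_greatest)
    fix U :: "nat \<Rightarrow> 'a set" assume "U \<in> {U. A \<subseteq> \<Union> (range U) \<and> (\<forall>i. bounded (U i) \<and> diameter (U i) \<le> \<delta>)}"
    then have U: "A \<subseteq> (\<Union>i. U i)" "\<And>i. bounded (U i)" "\<And>i. diameter (U i) \<le> \<delta>" by auto
    have D: "dist x y \<le> diameter (U i)" if xy: "x \<in> p ` U i" "y \<in> p ` U i" for x y i
    proof -
      obtain x' y' where "x = p x'" "x' \<in> U i" "y = p y'" "y' \<in> U i" using xy by auto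
      then show ?thesis using lip[of x' y'] diameter_bounded_bound[OF U(2)] order_trans by metis
    qed
    have b: "bounded (p ` U i)" "diameter (p ` U i) \<le> diameter (U i)" for i
      using bounded_diameter_le[OF _ D] U(2) by auto
    have "hausdorff_premeasure s \<delta> (p ` A) \<le> (\<Sum>i. ennreal (diameter (p ` U i) powr s))"
      using U(1) by (intro hausdorff_premeasure_le) (blast, auto intro: b order_trans[OF b(2) U(3)])
    also have "\<dots> \<le> (\<Sum>i. ennreal (diameter (U i) powr s))"
      using b assms(2) by (intro suminf_le ennreal_leI powr_mono2) auto
    finally show "hausdorff_premeasure s \<delta> (p ` A) \<le> (\<Sum>i. ennreal (diameter (U i) powr s))" .
  qed
  also have "\<dots> = 0" using assms(3) \<open>0 < \<delta>\<close> unfolding hausdorff_measure_eq_0_iff by blast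
  finally show "hausdorff_premeasure s \<delta> (p ` A) = 0" by simp
qed

text \<open>Serves for the projections of the graph: \<open>fst\<close> has image
  \<open>{0..1}\<close> and \<open>snd\<close> has the range of \<open>X\<close> as image, so the
  graph inherits both lower bounds.\<close>

lemma hausdorff_dim_image_le:
  assumes "\<And>x y. dist (p x) (p y) \<le> dist x y"
  shows "hausdorff_dim (p ` A) \<le> hausdorff_dim A"
  unfolding hausdorff_dim_def using hausdorff_measure_image_eq_0[of p, OF assms]
  by (intro Inf_superset_mono image_mono) auto

lemma suminf_ennreal_prod_decode:
  fixes f :: "nat \<Rightarrow> nat \<Rightarrow> ennreal"
  shows "(\<Sum>i. \<Sum>j. f i j) = (\<Sum>n. case prod_decode n of (i, j) \<Rightarrow> f i j)"
  using suminf_ennreal_2dimen[of "\<lambda>i. \<Sum>j. f i j" "\<lambda>(i, j). f i j"] by simp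

text \<open>Near-optimal covers of the pieces, with errors \<open>e * (1/2)^Suc i\<close>, are
  merged along \<open>prod_decode\<close>. Needed because \<open>packing_measure\<close> is an
  infimum over countable decompositions.\<close>

lemma hausdorff_premeasure_UN_le:
  assumes "0 < \<delta>"
  shows "hausdorff_premeasure s \<delta> (\<Union>i::nat. B i) \<le> (\<Sum>i. hausdorff_premeasure s \<delta> (B i))"
proof (rule ennreal_le_epsilon)
  fix e :: real assume fin: "(\<Sum>i. hausdorff_premeasure s \<delta> (B i)) < top" and e: "0 < e"
  have fin': "hausdorff_premeasure s \<delta> (B i) < top" for i
    using fin by (meson ennreal_suminf_lessD)
  have "\<exists>U. B i \<subseteq> (\<Union>j. U j) \<and> (\<forall>j. bounded (U j)) \<and> (\<forall>j. diameter (U j) \<le> \<delta>) \<and>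
    (\<Sum>j. ennreal (diameter (U j) powr s)) < hausdorff_premeasure s \<delta> (B i) + e * (1/2)^Suc i" for i
  proof -
    have "hausdorff_premeasure s \<delta> (B i) < hausdorff_premeasure s \<delta> (B i) + ennreal (e * (1/2)^Suc i)"
      using fin'[of i] e by simp
    from hausdorff_premeasure_lessE[OF this] show ?thesis by metis
  qed
  then obtain U where U: "\<And>i. B i \<subseteq> (\<Union>j. U i j)" "\<And>i j. bounded (U i j)" "\<And>i j. diameter (U i j) \<le> \<delta>"
    "\<And>i. (\<Sum>j. ennreal (diameter (U i j) powr s)) < hausdorff_premeasure s \<delta> (B i) + e * (1/2)^Suc i"
    by metis
  define V where "V n = (case prod_decode n of (i, j) \<Rightarrow> U i j)" for n
  have "(\<Union>i. B i) \<subseteq> (\<Union>n. V n)"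
  proof
    fix x assume "x \<in> (\<Union>i. B i)"
    then obtain i j where "x \<in> U i j" using U(1) by blast
    then have "x \<in> V (prod_encode (i, j))" by (simp add: V_def)
    then show "x \<in> (\<Union>n. V n)" by blast
  qed
  then have "hausdorff_premeasure s \<delta> (\<Union>i. B i) \<le> (\<Sum>n. ennreal (diameter (V n) powr s))"
    using U(2,3) by (intro hausdorff_premeasure_le) (auto simp: V_def split: prod.split)
  also have "\<dots> = (\<Sum>i. \<Sum>j. ennreal (diameter (U i j) powr s))"
    unfolding suminf_ennreal_prod_decode V_def by (auto intro!: suminf_cong split: prod.split)
  also have "\<dots> \<le> (\<Sum>i. hausdorff_premeasure s \<delta> (B i) + ennreal (e * (1/2)^Suc i))"
    using U(4) by (intro suminf_le) (auto intro: less_imp_le)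
  also have "\<dots> = (\<Sum>i. hausdorff_premeasure s \<delta> (B i)) + (\<Sum>i. ennreal (e * (1/2)^Suc i))"
    by (intro suminf_add[symmetric]) auto
  also have "(\<Sum>i. ennreal (e * (1/2)^Suc i)) = ennreal e"
  proof -
    have "(\<lambda>i. e * (1/2)^Suc i) sums (e * 1)"
      by (intro sums_mult power_half_series)
    then show ?thesis using e by (intro suminf_ennreal_eq) auto
  qed
  finally show "hausdorff_premeasure s \<delta> (\<Union>i. B i) \<le> (\<Sum>i. hausdorff_premeasure s \<delta> (B i)) + ennreal e" .
qed

text \<open>
  The balls of twice the radius around the centres of a maximal packing cover the set.
\<close>

lemma hausdorff_premeasure_le_packing_premeasure:
  fixes A :: "'a::metric_space set"
  assumes "0 < s" "0 < \<delta>"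
  shows "hausdorff_premeasure s \<delta> A \<le> ennreal (2 powr s) * packing_premeasure s A"
proof -
  have main: "hausdorff_premeasure s \<delta> A \<le> ennreal (2 powr s) * v"
    if d: "0 < d" and v: "v = (SUP P \<in> packings d A. \<Sum>\<^sub>\<infinity>(x, r)\<in>P. ennreal ((2 * r) powr s))" for d v
  proof (cases "v = top")
    case True
    then show ?thesis by (simp add: ennreal_mult_top)
  next
    case False
    \<comment> \<open>\<open>r \<le> d\<close> makes \<open>F \<times> {r}\<close> an admissible
      packing; \<open>4 * r \<le> \<delta>\<close> makes the balls of radius \<open>2 * r\<close> an
      admissible cover.\<close>
    define r where "r = min (\<delta>/4) d"
    have r: "0 < r" "4 * r \<le> \<delta>" "r \<le> d" using assms d by (auto simp: r_def min_def)
    define S where "S = {F. F \<subseteq> A \<and> finite F \<and> pairwise (\<lambda>x y. disjnt (cball x r) (cball y r)) F}"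
    have card_le: "ennreal (real (card F) * (2*r) powr s) \<le> v" if F: "F \<in> S" for F
    proof -
      have "F \<times> {r} \<in> packings d A"
        using F r unfolding packings_def S_def
        by (auto intro: countable_finite simp: pairwise_def)
      then have "(\<Sum>\<^sub>\<infinity>(x, r)\<in>F \<times> {r}. ennreal ((2 * r) powr s)) \<le> v"
        unfolding v by (rule SUP_upper)
      moreover have "(\<Sum>\<^sub>\<infinity>(x, r)\<in>F \<times> {r}. ennreal ((2 * r) powr s)) = (\<Sum>(x, r)\<in>F \<times> {r}. ennreal ((2 * r) powr s))"
        using F by (intro infsum_finite) (auto simp: S_def)
      moreover have "\<dots> = (\<Sum>x\<in>F. ennreal ((2 * r) powr s))"
        using sum.cartesian_product[of "\<lambda>x q. ennreal ((2 * q) powr s)" "{r}" F] by simp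
      moreover have "\<dots> = ennreal (real (card F) * (2*r) powr s)"
        by (simp add: ennreal_mult ennreal_of_nat_eq_real_of_nat)
      ultimately show ?thesis by simp
    qed
    \<comment> \<open>Finiteness of \<open>v\<close> bounds the number of disjoint balls of radius
      \<open>r\<close>, so a packing with the largest number of balls exists.\<close>
    obtain w where w: "v = ennreal w" "0 \<le> w" using False by (cases v) auto
    define N where "N = nat \<lceil>w / (2*r) powr s\<rceil>"
    have "card F \<le> N" if "F \<in> S" for F
    proof -
      have "real (card F) * (2*r) powr s \<le> w" using card_le[OF that] w by simp
      then have "real (card F) \<le> w / (2*r) powr s" using r by (simp add: field_simps)
      then show ?thesis unfolding N_def by linarith
    qed
    moreover have "{} \<in> S" by (auto simp: S_def)
    ultimately obtain F where F: "F \<in> S" and Fmax: "\<And>F'. F' \<in> S \<Longrightarrow> card F' \<le> card F"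
      using ex_has_greatest_nat[of "\<lambda>F. F \<in> S" "{}" card "Suc N"] by (metis le_imp_less_Suc)
    have fin: "finite F" using F by (auto simp: S_def)
    have cov: "\<exists>y\<in>F. dist y x \<le> 2 * r" if x: "x \<in> A" for x
    proof (rule ccontr)
      assume "\<not> (\<exists>y\<in>F. dist y x \<le> 2 * r)"
      then have far: "\<And>y. y \<in> F \<Longrightarrow> dist y x > 2 * r" by force
      have "x \<notin> F" using far[of x] r by auto
      have dis: "disjnt (cball x r) (cball y r)" if "y \<in> F" for y
      proof -
        have "False" if "z \<in> cball x r" "z \<in> cball y r" for z
          using that far[OF \<open>y \<in> F\<close>] dist_triangle[of y x z] by (auto simp: dist_commute)
        then show ?thesis unfolding disjnt_def by blast
      qed
      have "insert x F \<in> S"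
        using F x dis \<open>x \<notin> F\<close> unfolding S_def by (auto simp: pairwise_insert intro: disjnt_sym)
      from Fmax[OF this] show False using \<open>x \<notin> F\<close> fin by simp
    qed
    obtain h where h: "bij_betw h {0..<card F} F" using ex_bij_betw_nat_finite[OF fin] by blast
    define U where "U i = (if i < card F then cball (h i) (2*r) else {})" for i
    have U: "bounded (U i)" "diameter (U i) \<le> 4 * r" for i
    proof -
      have "dist x y \<le> 4 * r" if "x \<in> U i" "y \<in> U i" for x y
        using that dist_triangle[of x y "h i"] by (auto simp: U_def dist_commute split: if_splits)
      from bounded_diameter_le[OF _ this] r show "bounded (U i)" "diameter (U i) \<le> 4 * r" by auto
    qed
    have "A \<subseteq> (\<Union>i. U i)"
    proof
      fix x assume "x \<in> A"
      then obtain y where y: "y \<in> F" "dist y x \<le> 2 * r" using cov by auto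
      then obtain i where "i < card F" "h i = y" using h by (metis atLeastLessThan_iff bij_betw_iff_bijections)
      then have "x \<in> U i" using y by (auto simp: U_def)
      then show "x \<in> (\<Union>i. U i)" by blast
    qed
    then have "hausdorff_premeasure s \<delta> A \<le> (\<Sum>i. ennreal (diameter (U i) powr s))"
      by (intro hausdorff_premeasure_le) (auto intro: U order_trans[OF U(2) r(2)])
    also have "\<dots> = (\<Sum>i<card F. ennreal (diameter (U i) powr s))"
      by (intro suminf_finite) (auto simp: U_def)
    also have "\<dots> \<le> (\<Sum>i<card F. ennreal ((4*r) powr s))"
      using U assms(1) by (intro sum_mono ennreal_leI powr_mono2) auto
    also have "\<dots> = ennreal (2 powr s * (real (card F) * (2*r) powr s))"
    proof -
      have "(4*r) powr s = 2 powr s * (2*r) powr s" using r by (simp flip: powr_mult)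
      then show ?thesis by (simp add: ennreal_mult ennreal_of_nat_eq_real_of_nat mult_ac)
    qed
    also have "\<dots> \<le> ennreal (2 powr s) * v"
      using card_le[OF F] by (simp add: ennreal_mult mult_left_mono)
    finally show ?thesis .
  qed
  \<comment> \<open>The constant is divided out so that the bound applies to each \<open>d\<close>
    in the infimum that defines \<open>packing_premeasure\<close>.\<close>
  have "hausdorff_premeasure s \<delta> A / ennreal (2 powr s) \<le> packing_premeasure s A"
    unfolding packing_premeasure_def
  proof (rule INF_greatest)
    fix d :: real assume "d \<in> {0<..}"
    then have "hausdorff_premeasure s \<delta> A \<le> ennreal (2 powr s) * (SUP P \<in> packings d A. \<Sum>\<^sub>\<infinity>(x, r)\<in>P. ennreal ((2 * r) powr s))"
      using main by auto
    then show "hausdorff_premeasure s \<delta> A / ennreal (2 powr s) \<le> (SUP P \<in> packings d A. \<Sum>\<^sub>\<infinity>(x, r)\<in>P. ennreal ((2 * r) powr s))"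
      by (intro divide_le_posI_ennreal) (auto simp: mult.commute)
  qed
  then have "ennreal (2 powr s) * (hausdorff_premeasure s \<delta> A / ennreal (2 powr s)) \<le> ennreal (2 powr s) * packing_premeasure s A"
    by (rule mult_left_mono) auto
  then show ?thesis
    by (simp add: ennreal_times_divide mult_divide_eq_ennreal mult.commute)
qed

lemma packing_measure_eq_0_imp_hausdorff_measure_eq_0:
  assumes "0 < s" "packing_measure s A = 0"
  shows "hausdorff_measure s A = 0"
  unfolding hausdorff_measure_eq_0_iff
proof (intro allI impI)
  fix \<delta> :: real assume d: "0 < \<delta>"
  have eps: "hausdorff_premeasure s \<delta> A \<le> 0 + ennreal e" if e: "0 < e" for e :: real
  proof -
    have "packing_measure s A < ennreal (e / 2 powr s)" using assms(2) e by simp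
    then obtain B :: "nat \<Rightarrow> 'a set" where B: "A \<subseteq> (\<Union>i. B i)" "(\<Sum>i. packing_premeasure s (B i)) < ennreal (e / 2 powr s)"
      unfolding packing_measure_def INF_less_iff by blast
    have "hausdorff_premeasure s \<delta> A \<le> hausdorff_premeasure s \<delta> (\<Union>i. B i)"
      unfolding hausdorff_premeasure_def using B(1) by (intro INF_superset_mono) auto
    also have "\<dots> \<le> (\<Sum>i. hausdorff_premeasure s \<delta> (B i))"
      by (rule hausdorff_premeasure_UN_le[OF d])
    also have "\<dots> \<le> (\<Sum>i. ennreal (2 powr s) * packing_premeasure s (B i))"
      by (intro suminf_le hausdorff_premeasure_le_packing_premeasure assms d) auto
    also have "\<dots> = ennreal (2 powr s) * (\<Sum>i. packing_premeasure s (B i))"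
      by simp
    also have "\<dots> \<le> ennreal (2 powr s) * ennreal (e / 2 powr s)"
      using B(2) by (intro mult_left_mono) auto
    also have "\<dots> = ennreal e" using e by (simp flip: ennreal_mult)
    finally show ?thesis by simp
  qed
  have "hausdorff_premeasure s \<delta> A \<le> 0"
    by (rule ennreal_le_epsilon) (rule eps)
  then show "hausdorff_premeasure s \<delta> A = 0" by simp
qed

text \<open>Squeezes both dimensions: afterwards only lower bounds of the Hausdorff dimension and
  upper bounds of the packing dimension remain to be proved.\<close>

lemma hausdorff_dim_le_packing_dim: "hausdorff_dim A \<le> packing_dim A"
  unfolding hausdorff_dim_def packing_dim_def
  using packing_measure_eq_0_imp_hausdorff_measure_eq_0
  by (intro Inf_superset_mono image_mono) auto


subsection \<open>Box counting bounds the packing dimension\<close>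

text \<open>A bound on a covering number, encoded by a labelling: the fibres of \<open>g\<close> are
  the pieces of the cover. Labels can be paired or added, which is how the covers of the graph are
  built.\<close>

definition covered :: "'a::metric_space set \<Rightarrow> real \<Rightarrow> nat \<Rightarrow> bool" where
  "covered A \<epsilon> n \<longleftrightarrow> (\<exists>g :: 'a \<Rightarrow> nat. g ` A \<subseteq> {..<n} \<and> (\<forall>x\<in>A. \<forall>y\<in>A. g x = g y \<longrightarrow> dist x y \<le> \<epsilon>))"

text \<open>Labels may live on a parameter set and take values of any type. The finitely many labels
  are renumbered by \<open>h\<close>, and a point with several parameters gets the label of the one
  chosen by \<open>inv_into\<close>.\<close>

lemma covered_imageI:
  assumes fin: "finite (g ` S)" and card: "card (g ` S) \<le> n"
    and close: "\<And>s t. s \<in> S \<Longrightarrow> t \<in> S \<Longrightarrow> g s = g t \<Longrightarrow> dist (f s) (f t) \<le> \<epsilon>"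
  shows "covered (f ` S) \<epsilon> n"
proof -
  obtain h :: "_ \<Rightarrow> nat" where h: "h ` (g ` S) = {0..<card (g ` S)}" "inj_on h (g ` S)"
    using ex_bij_betw_finite_nat[OF fin] unfolding bij_betw_def by auto
  define k where "k x = h (g (inv_into S f x))" for x
  have "k ` f ` S \<subseteq> {..<n}"
  proof (clarsimp simp: k_def)
    fix s assume "s \<in> S"
    then have "inv_into S f (f s) \<in> S" by (simp add: inv_into_into)
    then have "h (g (inv_into S f (f s))) \<in> {0..<card (g ` S)}" using h(1) by blast
    then show "h (g (inv_into S f (f s))) < n" using card by simp
  qed
  moreover have "dist x y \<le> \<epsilon>" if "x \<in> f ` S" "y \<in> f ` S" "k x = k y" for x y
  proof -
    have i: "inv_into S f x \<in> S" "inv_into S f y \<in> S" using that by (simp_all add: inv_into_into)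
    then have "g (inv_into S f x) = g (inv_into S f y)"
      using that(3) h(2) unfolding k_def by (meson image_eqI inj_onD)
    from close[OF i this] show ?thesis using that by (simp add: f_inv_into_f)
  qed
  ultimately show ?thesis unfolding covered_def by blast
qed

lemma sum_power_le_tail:
  fixes q :: real
  assumes "0 \<le> q" "q < 1" "finite J" "\<And>j. j \<in> J \<Longrightarrow> K \<le> j"
  shows "(\<Sum>j\<in>J. q ^ j) \<le> q ^ K / (1 - q)"
proof -
  have "(\<Sum>j\<in>J. q ^ j) = (\<Sum>j\<in>J. q ^ K * q ^ (j - K))"
    using assms(4) by (intro sum.cong) (auto simp flip: power_add)
  also have "\<dots> = q ^ K * (\<Sum>i\<in>(\<lambda>j. j - K) ` J. q ^ i)"
    using assms(4) by (subst sum.reindex) (auto simp: inj_on_def sum_distrib_left eq_diff_iff)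
  also have "(\<Sum>i\<in>(\<lambda>j. j - K) ` J. q ^ i) \<le> (\<Sum>i. q ^ i)"
    using assms by (intro sum_le_suminf summable_geometric) auto
  also have "(\<Sum>i. q ^ i) = 1 / (1 - q)"
    using assms by (intro suminf_geometric) auto
  finally show ?thesis using assms by (simp add: mult_left_mono)
qed

lemma exists_dyadic_scale:
  fixes r :: real
  assumes "0 < r" "r \<le> 2 powr - real K"
  obtains j where "K \<le> j" "2 powr - real (Suc j) < r" "r \<le> 2 powr - real j"
proof -
  define m where "m = \<lfloor>- log 2 r\<rfloor>"
  have "log 2 r \<le> - real K" using assms by (simp add: log_le_iff)
  then have m: "int K \<le> m" unfolding m_def by linarith
  have l: "- log 2 r < real_of_int m + 1" "real_of_int m \<le> - log 2 r"
    unfolding m_def by linarith+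
  have mn: "real_of_int m = real (nat m)" using m by simp
  show ?thesis
  proof (rule that[of "nat m"])
    show "K \<le> nat m" using m by simp
    have "2 powr - real (Suc (nat m)) < 2 powr (log 2 r)"
      using l mn unfolding of_nat_Suc by (intro powr_less_mono) linarith+
    then show "2 powr - real (Suc (nat m)) < r" using assms(1) by simp
    have "2 powr (log 2 r) \<le> 2 powr - real (nat m)"
      using l mn by (intro powr_mono) linarith+
    then show "r \<le> 2 powr - real (nat m)" using assms(1) by simp
  qed
qed

text \<open>
  In a packing, the centres of the balls of radius at least \<open>\<epsilon>\<close> lie in different sets of a
  cover by sets of diameter \<open>\<epsilon>\<close>.
\<close>

lemma card_packing_le:
  assumes "covered A \<epsilon> n" "F \<subseteq> A \<times> {\<epsilon>..}"
    "pairwise (\<lambda>(x, r) (y, q). disjnt (cball x r) (cball y q)) F" "0 \<le> \<epsilon>"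
  shows "finite F" "card F \<le> n"
proof -
  obtain g :: "_ \<Rightarrow> nat" where g: "g ` A \<subseteq> {..<n}" "\<And>x y. x \<in> A \<Longrightarrow> y \<in> A \<Longrightarrow> g x = g y \<Longrightarrow> dist x y \<le> \<epsilon>"
    using assms(1) unfolding covered_def by blast
  have inj: "inj_on (g \<circ> fst) F"
  proof (rule inj_onI)
    fix p q assume pq: "p \<in> F" "q \<in> F" "(g \<circ> fst) p = (g \<circ> fst) q"
    have pA: "fst p \<in> A" "\<epsilon> \<le> snd p" and qA: "fst q \<in> A" "\<epsilon> \<le> snd q" using pq assms(2) by auto
    have "dist (fst p) (fst q) \<le> \<epsilon>" using g(2) pA qA pq(3) by simp
    then have "fst q \<in> cball (fst p) (snd p)" "fst q \<in> cball (fst q) (snd q)"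
      using pA qA assms(4) by auto
    then have "\<not> disjnt (cball (fst p) (snd p)) (cball (fst q) (snd q))"
      unfolding disjnt_def by blast
    then show "p = q" using assms(3) pq(1,2) by (cases p, cases q) (fastforce simp: pairwise_def)
  qed
  have sub: "(g \<circ> fst) ` F \<subseteq> {..<n}" using g(1) assms(2) by fastforce
  show "finite F" using inj sub by (meson finite_imageD finite_lessThan finite_subset)
  show "card F \<le> n" using card_inj_on_le[OF inj sub] by simp
qed

text \<open>Sort the balls of a packing by dyadic radius. Up to constants there are at most
  \<open>2 powr (i * (t - \<eta>))\<close> balls of radius about \<open>2 powr - i\<close>, each
  contributing \<open>2 powr (- i * t)\<close>. What remains is a geometric series in
  \<open>2 powr - \<eta>\<close> that starts at the level \<open>K\<close> of the largest admissible
  radius, and \<open>K\<close> is arbitrary.\<close>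

lemma packing_premeasure_eq_0:
  assumes "0 < t" "0 < \<eta>" "0 < c"
    and cov: "\<And>k. \<exists>n. covered A (c * 2 powr - real k) n \<and> real n \<le> C * 2 powr (real k * (t - \<eta>))"
  shows "packing_premeasure t A = 0"
proof -
  \<comment> \<open>Going \<open>k0\<close> scales deeper absorbs the factor \<open>c\<close>: the
    pieces used at level \<open>i\<close> have diameter at most
    \<open>2 powr - real (Suc i)\<close>, below every radius of that level.\<close>
  obtain k0 :: nat where k0: "c \<le> 2 ^ k0" using real_arch_pow[of 2 c] by (auto intro: less_imp_le)
  define q where "q = 2 powr - \<eta>"
  have q: "0 < q" "q < 1" using assms(2) using powr_less_mono[of "- \<eta>" 0 2] by (auto simp: q_def)
  have C0: "0 \<le> C" using cov[of 0] by (auto intro: order_trans[OF of_nat_0_le_iff])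
  \<comment> \<open>The second factor pays for the shift of scale by \<open>Suc k0\<close>, the
    third for the factor 2 in \<open>2 * r\<close>.\<close>
  define C' where "C' = C * 2 powr (real (Suc k0) * (t - \<eta>)) * 2 powr t"
  have C': "0 \<le> C'" using C0 by (simp add: C'_def)
  have main: "packing_premeasure t A \<le> ennreal (C' / (1 - q) * q ^ K)" for K
  proof -
    have "packing_premeasure t A \<le> (SUP P \<in> packings (2 powr - real K) A. \<Sum>\<^sub>\<infinity>(x, r)\<in>P. ennreal ((2 * r) powr t))"
      unfolding packing_premeasure_def by (intro INF_lower) auto
    also have "\<dots> \<le> ennreal (C' / (1 - q) * q ^ K)"
    proof (rule SUP_least)
      fix P assume P: "P \<in> packings (2 powr - real K) A"
      have fin_le: "(\<Sum>(x, r)\<in>F. ennreal ((2 * r) powr t)) \<le> ennreal (C' / (1 - q) * q ^ K)" 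
        if F: "finite F" "F \<subseteq> P" for F
      proof -
        have FA: "F \<subseteq> A \<times> {0<..2 powr - real K}"
          and Fd: "pairwise (\<lambda>(x, r) (y, q). disjnt (cball x r) (cball y q)) F"
          using P F(2) unfolding packings_def by (auto intro: pairwise_subset)
        have "\<exists>j. K \<le> j \<and> 2 powr - real (Suc j) < snd p \<and> snd p \<le> 2 powr - real j" if "p \<in> F" for p
        proof -
          have "0 < snd p" "snd p \<le> 2 powr - real K" using that FA by fastforce+
          from exists_dyadic_scale[OF this] show ?thesis by metis
        qed
        then obtain j where j: "\<And>p. p \<in> F \<Longrightarrow> K \<le> j p" "\<And>p. p \<in> F \<Longrightarrow> 2 powr - real (Suc (j p)) < snd p"
          "\<And>p. p \<in> F \<Longrightarrow> snd p \<le> 2 powr - real (j p)" by metis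
        have level: "(\<Sum>p\<in>{p\<in>F. j p = i}. (2 * snd p) powr t) \<le> C' * q ^ i" for i
        proof -
          let ?k = "Suc i + k0"
          obtain n where n: "covered A (c * 2 powr - real ?k) n" "real n \<le> C * 2 powr (real ?k * (t - \<eta>))"
            using cov by blast
          have "c * 2 powr - real ?k \<le> 2 ^ k0 * 2 powr - real ?k" using k0 by (intro mult_right_mono) auto
          also have "\<dots> = 2 powr - real (Suc i)" by (simp add: powr_realpow[symmetric] powr_add[symmetric] algebra_simps)
          finally have "{p\<in>F. j p = i} \<subseteq> A \<times> {c * 2 powr - real ?k..}"
            using FA j(2) by fastforce
          then have "card {p\<in>F. j p = i} \<le> n"
            using n(1) Fd assms(3) by (intro card_packing_le(2)) (auto intro: pairwise_subset)
          then have cle: "real (card {p\<in>F. j p = i}) \<le> C * 2 powr (real ?k * (t - \<eta>))" using n(2) by linarith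
          have "(\<Sum>p\<in>{p\<in>F. j p = i}. (2 * snd p) powr t) \<le> (\<Sum>p\<in>{p\<in>F. j p = i}. (2 * 2 powr - real i) powr t)"
            using j(3) FA assms(1) by (intro sum_mono powr_mono2) fastforce+
          also have "\<dots> = real (card {p\<in>F. j p = i}) * (2 * 2 powr - real i) powr t" by simp
          also have "\<dots> \<le> (C * 2 powr (real ?k * (t - \<eta>))) * (2 * 2 powr - real i) powr t"
            using cle by (intro mult_right_mono) auto
          also have "\<dots> = C' * q ^ i"
          proof -
            have "(2 * 2 powr - real i) powr t = 2 powr (t - real i * t)"
            proof -
              have "2 * 2 powr - real i = 2 powr (1 - real i)"
                by (simp add: powr_diff powr_minus divide_simps)
              then show ?thesis by (simp add: powr_powr algebra_simps)
            qed
            then have "2 powr (real ?k * (t - \<eta>)) * (2 * 2 powr - real i) powr t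
               = 2 powr (real ?k * (t - \<eta>) + (t - real i * t))" by (simp only: powr_add)
            also have "real ?k * (t - \<eta>) + (t - real i * t) = real (Suc k0) * (t - \<eta>) + t - real i * \<eta>"
              by (simp add: algebra_simps)
            also have "2 powr (real (Suc k0) * (t - \<eta>) + t - real i * \<eta>)
                = 2 powr (real (Suc k0) * (t - \<eta>)) * 2 powr t * q ^ i"
              by (simp add: q_def powr_power powr_add powr_diff powr_minus divide_simps mult_ac)
            finally show ?thesis by (simp add: C'_def mult_ac)
          qed
          finally show ?thesis .
        qed
        have "(\<Sum>p\<in>F. (2 * snd p) powr t) = (\<Sum>i\<in>j ` F. \<Sum>p\<in>{p\<in>F. j p = i}. (2 * snd p) powr t)"
          by (rule sum.image_gen[OF F(1)])
        also have "\<dots> \<le> (\<Sum>i\<in>j ` F. C' * q ^ i)" by (intro sum_mono level)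
        also have "\<dots> = C' * (\<Sum>i\<in>j ` F. q ^ i)" by (simp add: sum_distrib_left)
        also have "\<dots> \<le> C' * (q ^ K / (1 - q))"
          using q F(1) j(1) C' by (intro mult_left_mono sum_power_le_tail) auto
        finally show ?thesis by (simp add: case_prod_beta sum_ennreal ennreal_leI)
      qed
      show "(\<Sum>\<^sub>\<infinity>(x, r)\<in>P. ennreal ((2 * r) powr t)) \<le> ennreal (C' / (1 - q) * q ^ K)"
        by (subst nonneg_infsum_complete) (simp, rule SUP_least, rule fin_le, auto)
    qed
    finally show ?thesis .
  qed
  have "(\<lambda>K. ennreal (C' / (1 - q) * q ^ K)) \<longlonglongrightarrow> ennreal (C' / (1 - q) * 0)"
    using q by (intro tendsto_ennrealI tendsto_mult tendsto_const LIMSEQ_power_zero) auto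
  then have "packing_premeasure t A \<le> ennreal (C' / (1 - q) * 0)"
    by (rule LIMSEQ_le_const) (use main in auto)
  then show ?thesis by simp
qed

lemma packing_dim_le:
  assumes "0 \<le> s" "0 < c"
    and "\<And>\<eta>. 0 < \<eta> \<Longrightarrow> \<exists>C. \<forall>k. \<exists>n. covered A (c * 2 powr - real k) n \<and> real n \<le> C * 2 powr (real k * (s + \<eta>))"
  shows "packing_dim A \<le> ereal s"
proof -
  have "packing_measure t A = 0" if t: "s < t" for t
  proof -
    \<comment> \<open>Half of \<open>t - s\<close> is spent as slack, so the box counting exponent
      stays below \<open>t\<close> by the other half. The premeasure of \<open>A\<close> is then 0,
      and the constant sequence serves as decomposition.\<close>
    obtain C where C: "\<And>k. \<exists>n. covered A (c * 2 powr - real k) n \<and> real n \<le> C * 2 powr (real k * (s + (t - s) / 2))"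
      using assms(3)[of "(t - s) / 2"] t by auto
    have "packing_premeasure t A = 0"
      using t assms C by (intro packing_premeasure_eq_0[of t "(t - s) / 2" c A C]) (auto simp: field_simps)
    moreover have "packing_measure t A \<le> (\<Sum>i::nat. packing_premeasure t A)"
      unfolding packing_measure_def by (rule INF_lower2[of "\<lambda>_. A"]) auto
    ultimately show ?thesis by simp
  qed
  then have "packing_dim A \<le> ereal t" if "s < t" for t
    unfolding packing_dim_def using that assms(1) by (intro Inf_lower) auto
  then have "packing_dim A \<le> y" if "ereal s < y" for y
    using that by (cases y) auto
  then show ?thesis by (rule dense_ge)
qed

text \<open>Label by dyadic cubes of side \<open>2 powr - k\<close>. Their diameter is bounded
  through the sum of the coordinates, which is where the factor \<open>real DIM('a)\<close> comes
  from.\<close>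

lemma bounded_covered:
  fixes A :: "'a::euclidean_space set"
  assumes "bounded A"
  shows "\<exists>C. \<forall>k. \<exists>n. covered A (real DIM('a) * 2 powr - real k) n \<and> real n \<le> C * 2 powr (real k * real DIM('a))"
proof -
  obtain R where R: "0 < R" "\<And>x. x \<in> A \<Longrightarrow> norm x \<le> R" using assms by (meson bounded_pos)
  \<comment> \<open>With the \<open>m\<close> below, each coordinate has \<open>2 * m + 1\<close>
    possible labels, and \<open>2 * m + 1 \<le> 2 * R * 2 ^ k + 5\<close>.\<close>
  define C where "C = (2 * R + 5) ^ DIM('a)"
  have "\<exists>n. covered A (real DIM('a) * 2 powr - real k) n \<and> real n \<le> C * 2 powr (real k * real DIM('a))" for k
  proof -
    define g where "g x = (\<lambda>b\<in>(Basis::'a set). \<lfloor>(x \<bullet> b) * 2 ^ k\<rfloor>)" for x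
    define m where "m = \<lceil>R * 2 ^ k\<rceil> + 1"
    have "0 \<le> R * 2 ^ k" using R(1) by simp
    then have m0: "0 \<le> m" unfolding m_def by linarith
    have sub: "g ` A \<subseteq> PiE Basis (\<lambda>_. {- m..m})"
    proof (clarsimp simp: g_def)
      fix x b assume x: "x \<in> A" and b: "(b::'a) \<in> Basis"
      have "\<bar>x \<bullet> b\<bar> \<le> R" using R(2)[OF x] Basis_le_norm[OF b, of x] by linarith
      then have "\<bar>(x \<bullet> b) * 2 ^ k\<bar> \<le> R * 2 ^ k" by (simp add: abs_mult)
      then show "- m \<le> \<lfloor>(x \<bullet> b) * 2 ^ k\<rfloor> \<and> \<lfloor>(x \<bullet> b) * 2 ^ k\<rfloor> \<le> m"
        unfolding m_def by linarith
    qed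
    have finP: "finite (PiE (Basis::'a set) (\<lambda>_. {- m..m}))" by (intro finite_PiE) auto
    have close: "dist x y \<le> real DIM('a) * 2 powr - real k" if "g x = g y" for x y
    proof -
      have "\<bar>(x - y) \<bullet> b\<bar> \<le> 2 powr - real k" if b: "b \<in> Basis" for b
      proof -
        have "\<lfloor>(x \<bullet> b) * 2 ^ k\<rfloor> = \<lfloor>(y \<bullet> b) * 2 ^ k\<rfloor>"
          using fun_cong[OF \<open>g x = g y\<close>, of b] b by (simp add: g_def)
        then have "\<bar>(x \<bullet> b) * 2 ^ k - (y \<bullet> b) * 2 ^ k\<bar> \<le> 1" by linarith
        then have "\<bar>(x - y) \<bullet> b\<bar> * 2 ^ k \<le> 1"
          by (simp add: inner_diff_left left_diff_distrib[symmetric] abs_mult)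
        then show ?thesis by (simp add: powr_minus powr_realpow field_simps)
      qed
      then have "(\<Sum>b\<in>Basis. \<bar>(x - y) \<bullet> b\<bar>) \<le> real DIM('a) * 2 powr - real k"
        by (rule sum_bounded_above)
      then show ?thesis using norm_le_l1[of "x - y"] by (simp add: dist_norm)
    qed
    have "covered ((\<lambda>x. x) ` A) (real DIM('a) * 2 powr - real k) (card (g ` A))"
      by (rule covered_imageI[of g]) (auto intro: close finite_subset[OF sub finP])
    moreover have "real (card (g ` A)) \<le> C * 2 powr (real k * real DIM('a))"
    proof -
      have "card (g ` A) \<le> card (PiE (Basis::'a set) (\<lambda>_. {- m..m}))" by (rule card_mono[OF finP sub])
      also have "\<dots> = (nat (2 * m + 1)) ^ DIM('a)" by (simp add: card_PiE)
      finally have "real (card (g ` A)) \<le> real ((nat (2 * m + 1)) ^ DIM('a))" by (rule of_nat_mono)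
      also have "\<dots> = (real_of_int (2 * m + 1)) ^ DIM('a)" using m0 by simp
      also have "\<dots> \<le> ((2 * R + 5) * 2 ^ k) ^ DIM('a)"
      proof (rule power_mono)
        have "real_of_int m \<le> R * 2 ^ k + 2" unfolding m_def by linarith
        moreover have "(1::real) \<le> 2 ^ k" by (rule one_le_power) simp
        moreover have "(2 * R + 5) * 2 ^ k = 2 * (R * 2 ^ k) + 5 * 2 ^ k" by (simp add: algebra_simps)
        ultimately show "real_of_int (2 * m + 1) \<le> (2 * R + 5) * 2 ^ k"
          unfolding of_int_add of_int_mult by linarith
        show "0 \<le> real_of_int (2 * m + 1)" using m0 by simp
      qed
      also have "\<dots> = C * 2 powr (real k * real DIM('a))"
        by (simp add: C_def power_mult_distrib powr_realpow[symmetric] powr_powr)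
      finally show ?thesis .
    qed
    ultimately show ?thesis by auto
  qed
  then show ?thesis by blast
qed

lemma packing_dim_le_DIM:
  fixes A :: "'a::euclidean_space set"
  assumes "bounded A"
  shows "packing_dim A \<le> ereal DIM('a)"
proof (rule packing_dim_le[where c = "real DIM('a)"])
  obtain C where C: "\<And>k. \<exists>n. covered A (real DIM('a) * 2 powr - real k) n \<and> real n \<le> C * 2 powr (real k * real DIM('a))"
    using bounded_covered[OF assms] by blast
  have C0: "0 \<le> C" using C[of 0] by (auto intro: order_trans[OF of_nat_0_le_iff])
  have "\<exists>n. covered A (real DIM('a) * 2 powr - real k) n \<and> real n \<le> C * 2 powr (real k * (real DIM('a) + \<eta>))" 
    if "0 < \<eta>" for \<eta> k
  proof -
    have "C * 2 powr (real k * real DIM('a)) \<le> C * 2 powr (real k * (real DIM('a) + \<eta>))"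
      using C0 that by (intro mult_left_mono powr_mono) auto
    then show ?thesis using C[of k] by (meson order_trans)
  qed
  then show "\<exists>C. \<forall>k. \<exists>n. covered A (real DIM('a) * 2 powr - real k) n \<and> real n \<le> C * 2 powr (real k * (real DIM('a) + \<eta>))" 
    if "0 < \<eta>" for \<eta> using that by blast
qed auto

subsection \<open>Mass distribution principle\<close>

text \<open>The measure sits on a parameter space, and mass is controlled only in balls centred at
  points \<open>f s\<close> with \<open>s \<in> G\<close>. A covering set that meets the image of
  \<open>G\<close> is therefore replaced by a ball around one of its points from that image, with
  its diameter as radius; adding the masses bounds \<open>emeasure \<mu> G\<close> by a multiple of
  the covering sum.\<close>

lemma hausdorff_measure_mass_distribution:
  fixes \<mu> :: "'s measure" and f :: "'s \<Rightarrow> 'a::metric_space"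
  assumes G: "G \<in> sets \<mu>" "emeasure \<mu> G \<noteq> 0" and fA: "f ` G \<subseteq> A"
    and pos: "0 < \<gamma>" "0 \<le> K" "0 < \<delta>"
    and meas: "\<And>s. s \<in> G \<Longrightarrow> (\<lambda>t. dist (f s) (f t)) \<in> borel_measurable \<mu>"
    and mass: "\<And>s r. s \<in> G \<Longrightarrow> 0 < r \<Longrightarrow> r \<le> \<delta> \<Longrightarrow>
      emeasure \<mu> {t\<in>space \<mu>. dist (f s) (f t) \<le> r} \<le> ennreal (K * r powr \<gamma>)"
  shows "hausdorff_measure \<gamma> A \<noteq> 0"
proof
  assume "hausdorff_measure \<gamma> A = 0"
  then have pre: "hausdorff_premeasure \<gamma> \<delta> A = 0" using pos unfolding hausdorff_measure_eq_0_iff by blast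
  have mass': "emeasure \<mu> {t\<in>space \<mu>. dist (f s) (f t) \<le> r} \<le> ennreal (K * r powr \<gamma>)"
    if s: "s \<in> G" and r: "0 \<le> r" "r \<le> \<delta>" for s r
  proof (cases "r = 0")
    case True
    have eps: "emeasure \<mu> {t\<in>space \<mu>. dist (f s) (f t) \<le> r} \<le> 0 + ennreal e" if e: "0 < e" for e
    proof -
      \<comment> \<open>Solves \<open>(K + 1) * q powr \<gamma> = e\<close>, capped at
        \<open>\<delta>\<close>; \<open>K + 1\<close> instead of \<open>K\<close> avoids division by
        0.\<close>
      define q where "q = min \<delta> ((e / (K + 1)) powr (1 / \<gamma>))"
      have q: "0 < q" "q \<le> \<delta>" using pos e by (auto simp: q_def)
      have "q powr \<gamma> \<le> ((e / (K + 1)) powr (1 / \<gamma>)) powr \<gamma>"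
        using q pos by (intro powr_mono2) (auto simp: q_def)
      also have "\<dots> = e / (K + 1)" using pos e by (simp add: powr_powr)
      finally have "K * q powr \<gamma> \<le> (K + 1) * (e / (K + 1))" using pos e by (intro mult_mono) auto
      also have "\<dots> = e" using pos by simp
      finally have Kq: "K * q powr \<gamma> \<le> e" .
      have "emeasure \<mu> {t\<in>space \<mu>. dist (f s) (f t) \<le> r} \<le> emeasure \<mu> {t\<in>space \<mu>. dist (f s) (f t) \<le> q}"
        using True q meas[OF s] by (intro emeasure_mono) (auto intro: order_trans)
      also have "\<dots> \<le> ennreal (K * q powr \<gamma>)" by (rule mass[OF s q])
      also have "\<dots> \<le> ennreal e" using Kq by (rule ennreal_leI)
      finally show ?thesis by simp
    qed
    have "emeasure \<mu> {t\<in>space \<mu>. dist (f s) (f t) \<le> r} \<le> 0"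
      by (rule ennreal_le_epsilon) (rule eps)
    then show ?thesis using True by simp
  next
    case False
    then show ?thesis using mass[OF s] r by auto
  qed
  have small: "emeasure \<mu> G \<le> 0 + ennreal e" if e: "0 < e" for e
  proof -
    have "hausdorff_premeasure \<gamma> \<delta> A < ennreal (e / (K + 1))" using pre e pos by simp
    then obtain U where U: "A \<subseteq> (\<Union>i. U i)" "\<And>i. bounded (U i)" "\<And>i. diameter (U i) \<le> \<delta>"
      "(\<Sum>i. ennreal (diameter (U i) powr \<gamma>)) < ennreal (e / (K + 1))"
      using hausdorff_premeasure_lessE by metis
    define V where "V i = (if \<exists>s\<in>G. f s \<in> U i
      then {t\<in>space \<mu>. dist (f (SOME s. s \<in> G \<and> f s \<in> U i)) (f t) \<le> diameter (U i)} else {})" for i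
    have V: "V i \<in> sets \<mu>" "emeasure \<mu> (V i) \<le> ennreal (K * diameter (U i) powr \<gamma>)"
      "\<And>t. t \<in> G \<Longrightarrow> f t \<in> U i \<Longrightarrow> t \<in> V i" for i
    proof -
      let ?s = "SOME s. s \<in> G \<and> f s \<in> U i"
      have s: "?s \<in> G" "f ?s \<in> U i" if "\<exists>s\<in>G. f s \<in> U i"
        using someI_ex[of "\<lambda>s. s \<in> G \<and> f s \<in> U i"] that by auto
      show "V i \<in> sets \<mu>" using meas[OF s(1)] by (auto simp: V_def)
      show "emeasure \<mu> (V i) \<le> ennreal (K * diameter (U i) powr \<gamma>)"
        using mass'[OF s(1) _ U(3)] U(2) by (auto simp: V_def)
      show "t \<in> V i" if t: "t \<in> G" "f t \<in> U i" for t
      proof -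
        have ex: "\<exists>s\<in>G. f s \<in> U i" using t by blast
        have "dist (f ?s) (f t) \<le> diameter (U i)"
          using diameter_bounded_bound[OF U(2) s(2)[OF ex] t(2)] .
        moreover have "t \<in> space \<mu>" using G(1) t(1) sets.sets_into_space by blast
        ultimately show ?thesis using ex by (simp add: V_def)
      qed
    qed
    have "G \<subseteq> (\<Union>i. V i)"
    proof
      fix t assume t: "t \<in> G"
      then obtain i where "f t \<in> U i" using U(1) fA by blast
      then show "t \<in> (\<Union>i. V i)" using V(3)[OF t] by blast
    qed
    then have "emeasure \<mu> G \<le> emeasure \<mu> (\<Union>i. V i)"
      using V(1) by (intro emeasure_mono) auto
    also have "\<dots> \<le> (\<Sum>i. emeasure \<mu> (V i))"
      using V(1) by (intro emeasure_subadditive_countably) auto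
    also have "\<dots> \<le> (\<Sum>i. ennreal K * ennreal (diameter (U i) powr \<gamma>))"
      using V(2) pos by (intro suminf_le) (auto simp: ennreal_mult)
    also have "\<dots> = ennreal K * (\<Sum>i. ennreal (diameter (U i) powr \<gamma>))" by simp
    also have "\<dots> \<le> ennreal (K + 1) * ennreal (e / (K + 1))"
      using U(4) pos by (intro mult_mono ennreal_leI) (auto intro: less_imp_le)
    also have "\<dots> = ennreal ((K + 1) * (e / (K + 1)))" using pos e by (intro ennreal_mult[symmetric]) auto
    also have "(K + 1) * (e / (K + 1)) = e" using pos by simp
    finally show ?thesis by simp
  qed
  have "emeasure \<mu> G \<le> 0" by (rule ennreal_le_epsilon) (rule small)
  then show False using G(2) by simp
qed

section \<open>Dimension of paths with controlled oscillation\<close>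

text \<open>
  The fibres of the monotone function \<open>F\<close> are at most \<open>n + 1\<close> consecutive pieces of \<open>{0..T}\<close>.
\<close>

definition osc_index :: "(real \<Rightarrow> 'a::metric_space) \<Rightarrow> real \<Rightarrow> real \<Rightarrow> nat \<Rightarrow> bool" where
  "osc_index f T \<epsilon> n \<longleftrightarrow> (\<exists>F :: real \<Rightarrow> nat. mono_on {0..T} F \<and> (\<forall>x\<in>{0..T}. F x \<le> n) \<and>
     (\<forall>x\<in>{0..T}. \<forall>y\<in>{0..T}. F x = F y \<longrightarrow> dist (f x) (f y) \<le> \<epsilon>))"

text \<open>The exponent acts as an upper box dimension: a slack \<open>\<eta>\<close> is allowed,
  and \<open>C\<close> may depend on the path, on \<open>T\<close> and on \<open>\<eta>\<close>.
  Natural \<open>T\<close> keep the number of almost sure statements countable.\<close>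

definition osc_growth :: "(real \<Rightarrow> 'a::metric_space) \<Rightarrow> real \<Rightarrow> bool" where
  "osc_growth f a \<longleftrightarrow> (\<forall>T::nat. \<forall>\<eta>>0. \<exists>C. \<forall>k::nat. \<exists>n.
     osc_index f (real T) (2 powr - real k) n \<and> real n \<le> C * 2 powr (real k * (a + \<eta>)))"

lemma osc_indexE:
  assumes "osc_index f T \<epsilon> n"
  obtains F :: "real \<Rightarrow> nat"
  where "\<And>x y. 0 \<le> x \<Longrightarrow> x \<le> y \<Longrightarrow> y \<le> T \<Longrightarrow> F x \<le> F y" "\<And>x. 0 \<le> x \<Longrightarrow> x \<le> T \<Longrightarrow> F x \<le> n"
    "\<And>x y. 0 \<le> x \<Longrightarrow> x \<le> T \<Longrightarrow> 0 \<le> y \<Longrightarrow> y \<le> T \<Longrightarrow> F x = F y \<Longrightarrow> dist (f x) (f y) \<le> \<epsilon>"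
proof -
  obtain F :: "real \<Rightarrow> nat" where F: "mono_on {0..T} F" "\<forall>x\<in>{0..T}. F x \<le> n"
    "\<forall>x\<in>{0..T}. \<forall>y\<in>{0..T}. F x = F y \<longrightarrow> dist (f x) (f y) \<le> \<epsilon>"
    using assms unfolding osc_index_def by blast
  show ?thesis
    by (rule that[of F]) (use F in \<open>auto simp: mono_on_def\<close>)
qed

lemma osc_growthE:
  assumes "osc_growth f a" "0 < \<eta>" "0 \<le> a"
  obtains C where "0 \<le> C" "\<And>k. \<exists>n. osc_index f (real T) (2 powr - real k) n \<and>
    real n + 1 \<le> C * 2 powr (real k * (a + \<eta>))"
proof -
  obtain C where C: "\<And>k. \<exists>n. osc_index f (real T) (2 powr - real k) n \<and> real n \<le> C * 2 powr (real k * (a + \<eta>))"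
    using assms unfolding osc_growth_def by blast
  have C0: "0 \<le> C" using C[of 0] by (auto intro: order_trans[OF of_nat_0_le_iff])
  show ?thesis
  proof (rule that[of "C + 1"])
    fix k
    obtain n where n: "osc_index f (real T) (2 powr - real k) n" "real n \<le> C * 2 powr (real k * (a + \<eta>))"
      using C by blast
    have "1 \<le> 2 powr (real k * (a + \<eta>))" using assms by (intro ge_one_powr_ge_zero) auto
    then have "real n + 1 \<le> (C + 1) * 2 powr (real k * (a + \<eta>))" using n(2) by (simp add: distrib_right)
    then show "\<exists>n. osc_index f (real T) (2 powr - real k) n \<and> real n + 1 \<le> (C + 1) * 2 powr (real k * (a + \<eta>))"
      using n(1) by blast
  qed (use C0 in simp)
qed

lemma osc_index_covered:
  assumes "osc_index f T \<epsilon> n"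
  shows "covered (f ` {0..T}) \<epsilon> (n + 1)"
proof -
  obtain F :: "real \<Rightarrow> nat" where F: "\<And>x. 0 \<le> x \<Longrightarrow> x \<le> T \<Longrightarrow> F x \<le> n"
    "\<And>x y. 0 \<le> x \<Longrightarrow> x \<le> T \<Longrightarrow> 0 \<le> y \<Longrightarrow> y \<le> T \<Longrightarrow> F x = F y \<Longrightarrow> dist (f x) (f y) \<le> \<epsilon>"
    by (rule osc_indexE[OF assms]) blast
  have sub: "F ` {0..T} \<subseteq> {..n}" using F(1) by auto
  have "card (F ` {0..T}) \<le> n + 1" using card_mono[OF _ sub] by simp
  then show ?thesis
    by (intro covered_imageI[of F] F(2) finite_subset[OF sub]) auto
qed

lemma covered_imp_bounded:
  assumes "covered A \<epsilon> n"
  shows "bounded A"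
proof -
  obtain g :: "_ \<Rightarrow> nat" where g: "g ` A \<subseteq> {..<n}" "\<And>x y. x \<in> A \<Longrightarrow> y \<in> A \<Longrightarrow> g x = g y \<Longrightarrow> dist x y \<le> \<epsilon>"
    using assms unfolding covered_def by blast
  have "bounded {x\<in>A. g x = i}" for i
    using g(2) unfolding bounded_def by (metis (mono_tags, lifting) mem_Collect_eq)
  then have "bounded (\<Union>i\<in>{..<n}. {x\<in>A. g x = i})" by (intro bounded_UN) auto
  moreover have "A \<subseteq> (\<Union>i\<in>{..<n}. {x\<in>A. g x = i})" using g(1) by auto
  ultimately show ?thesis by (rule bounded_subset)
qed

lemma osc_growth_bounded:
  assumes "osc_growth f a"
  shows "bounded (f ` {0..real T})"
proof -
  obtain n where "osc_index f (real T) (2 powr - real 0) n"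
    using assms unfolding osc_growth_def by (metis zero_less_one)
  then show ?thesis using osc_index_covered covered_imp_bounded by blast
qed

lemma packing_dim_osc_growth_le:
  assumes "osc_growth f a" "0 \<le> a"
  shows "packing_dim (f ` {0..real T}) \<le> ereal a"
proof (rule packing_dim_le[of _ 1])
  fix \<eta> :: real assume \<eta>: "0 < \<eta>"
  obtain C where C: "\<And>k. \<exists>n. osc_index f (real T) (2 powr - real k) n \<and>
    real n + 1 \<le> C * 2 powr (real k * (a + \<eta>))" using osc_growthE[OF assms(1) \<eta> assms(2)] by metis
  have "\<exists>n. covered (f ` {0..real T}) (1 * 2 powr - real k) n \<and> real n \<le> C * 2 powr (real k * (a + \<eta>))" for k
  proof -
    obtain n where n: "osc_index f (real T) (2 powr - real k) n" "real n + 1 \<le> C * 2 powr (real k * (a + \<eta>))"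
      using C by blast
    show ?thesis using osc_index_covered[OF n(1)] n(2) by (intro exI[of _ "n + 1"]) auto
  qed
  then show "\<exists>C. \<forall>k. \<exists>n. covered (f ` {0..real T}) (1 * 2 powr - real k) n \<and> real n \<le> C * 2 powr (real k * (a + \<eta>))"
    by blast
qed (use assms in auto)

lemma dist_Pair_le: "dist (a, b) (c, d) \<le> dist a c + dist b d"
  by (simp add: dist_Pair_Pair sqrt_sum_squares_le_sum)

lemma dyadic_floor_eq_imp_close:
  fixes x y :: real
  assumes "\<lfloor>x * 2 ^ k\<rfloor> = \<lfloor>y * 2 ^ k\<rfloor>"
  shows "\<bar>x - y\<bar> \<le> 2 powr - real k"
proof -
  have "\<bar>x * 2 ^ k - y * 2 ^ k\<bar> \<le> 1" using assms by linarith
  then have "\<bar>x - y\<bar> * 2 ^ k \<le> 1"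
    by (simp add: left_diff_distrib[symmetric] abs_mult)
  then show ?thesis by (simp add: powr_minus powr_realpow field_simps)
qed

text \<open>
  Superposing the dyadic partition of the time axis with a partition into \<open>n + 1\<close> pieces of small
  oscillation costs only the sum, not the product, of the cardinalities: the sum of the two
  monotone indices determines both.
\<close>

lemma packing_dim_graph_le_max:
  fixes f :: "real \<Rightarrow> 'a::metric_space" and e :: "real \<Rightarrow> real"
  assumes osc: "osc_growth f a" "0 \<le> a"
    and e: "mono_on {0..1} e" "e ` {0..1} \<subseteq> {0..real T}"
  shows "packing_dim ((\<lambda>t. (t, f (e t))) ` {0..1}) \<le> ereal (max 1 a)"
proof (rule packing_dim_le[of _ 2])
  fix \<eta> :: real assume \<eta>: "0 < \<eta>"
  let ?G = "(\<lambda>t::real. (t, f (e t))) ` {0..1::real}"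
  obtain C where C: "0 \<le> C" "\<And>k. \<exists>n. osc_index f (real T) (2 powr - real k) n \<and>
    real n + 1 \<le> C * 2 powr (real k * (a + \<eta>))" using osc_growthE[OF osc(1) \<eta> osc(2)] by metis
  have "\<exists>n. covered ?G (2 * 2 powr - real k) n \<and> real n \<le> (C + 1) * 2 powr (real k * (max 1 a + \<eta>))" for k
  proof -
    obtain n where n: "osc_index f (real T) (2 powr - real k) n" "real n + 1 \<le> C * 2 powr (real k * (a + \<eta>))"
      using C by blast
    obtain F :: "real \<Rightarrow> nat" where F: "\<And>x y. 0 \<le> x \<Longrightarrow> x \<le> y \<Longrightarrow> y \<le> real T \<Longrightarrow> F x \<le> F y"
      "\<And>x. 0 \<le> x \<Longrightarrow> x \<le> real T \<Longrightarrow> F x \<le> n"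
      "\<And>x y. 0 \<le> x \<Longrightarrow> x \<le> real T \<Longrightarrow> 0 \<le> y \<Longrightarrow> y \<le> real T \<Longrightarrow> F x = F y \<Longrightarrow> dist (f x) (f y) \<le> 2 powr - real k"
      by (rule osc_indexE[OF n(1)]) blast
    define p where "p t = nat \<lfloor>t * 2 ^ k\<rfloor>" for t :: real
    define g where "g t = F (e t) + p t" for t
    have p_mono: "p s \<le> p t" if "s \<le> t" for s t
      unfolding p_def using that by (intro nat_mono floor_mono mult_right_mono) auto
    have eT: "0 \<le> e t" "e t \<le> real T" if "t \<in> {0..1}" for t using e(2) that by (auto simp: image_subset_iff)
    have e_mono: "e s \<le> e t" if "s \<in> {0..1}" "t \<in> {0..1}" "s \<le> t" for s t using e(1) that by (auto simp: mono_on_def)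
    have ordered: "dist (s, f (e s)) (t, f (e t)) \<le> 2 * 2 powr - real k"
      if st: "s \<in> {0..1}" "t \<in> {0..1}" "g s = g t" "s \<le> t" for s t
    proof -
      have "F (e s) \<le> F (e t)" "p s \<le> p t" using F(1) e_mono eT st p_mono by auto
      then have eq: "F (e s) = F (e t)" "p s = p t" using st(3) by (auto simp: g_def)
      have "\<lfloor>s * 2 ^ k\<rfloor> = \<lfloor>t * 2 ^ k\<rfloor>" using eq(2) st by (simp add: p_def eq_nat_nat_iff)
      then have "dist s t \<le> 2 powr - real k" using dyadic_floor_eq_imp_close by (auto simp: dist_real_def)
      moreover have "dist (f (e s)) (f (e t)) \<le> 2 powr - real k" using F(3) eT st eq(1) by blast
      ultimately show ?thesis using dist_Pair_le[of s "f (e s)" t "f (e t)"] by linarith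
    qed
    have sub: "g ` {0..1} \<subseteq> {..n + 2 ^ k}"
    proof (clarsimp simp: g_def)
      fix t :: real assume t: "0 \<le> t" "t \<le> 1"
      have "p t \<le> 2 ^ k" using p_mono[OF t(2)] by (simp add: p_def nat_power_eq)
      then show "F (e t) + p t \<le> n + 2 ^ k" using F(2) eT[of t] t by (intro add_mono) auto
    qed
    have "covered ?G (2 * 2 powr - real k) (n + 2 ^ k + 1)"
    proof (rule covered_imageI[of g])
      show "finite (g ` {0..1})" using sub finite_subset by blast
      show "card (g ` {0..1}) \<le> n + 2 ^ k + 1" using card_mono[OF _ sub] by simp
      show "dist (s, f (e s)) (t, f (e t)) \<le> 2 * 2 powr - real k"
        if "s \<in> {0..1}" "t \<in> {0..1}" "g s = g t" for s t
        using ordered[of s t] ordered[of t s] that by (cases "s \<le> t") (auto simp: dist_commute)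
    qed
    moreover have "real (n + 2 ^ k + 1) \<le> (C + 1) * 2 powr (real k * (max 1 a + \<eta>))"
    proof -
      have "C * 2 powr (real k * (a + \<eta>)) \<le> C * 2 powr (real k * (max 1 a + \<eta>))"
        using C(1) by (intro mult_left_mono powr_mono) (auto intro: mult_left_mono)
      moreover have "2 powr (real k) \<le> 2 powr (real k * (max 1 a + \<eta>))"
        using \<eta> mult_left_mono[of 1 "max 1 a + \<eta>" "real k"] by (intro powr_mono) auto
      ultimately show ?thesis using n(2) by (simp add: powr_realpow distrib_right)
    qed
    ultimately show ?thesis by blast
  qed
  then show "\<exists>C. \<forall>k. \<exists>n. covered ?G (2 * 2 powr - real k) n \<and> real n \<le> C * 2 powr (real k * (max 1 a + \<eta>))"
    by blast
qed auto

text \<open>Dyadic layer cake. If \<open>w i\<close> is above \<open>(1/2) ^ j\<close> and at most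
  twice that, the summand of layer \<open>j\<close> alone majorizes it; values above 1 are paid by
  \<open>W\<close>, values below the last layer by \<open>(1/2) ^ l\<close>.\<close>

lemma layered_sum_le:
  fixes w :: "'i \<Rightarrow> real"
  assumes fin: "finite A" and w: "\<And>i. i \<in> A \<Longrightarrow> 0 \<le> w i" "\<And>i. i \<in> A \<Longrightarrow> w i \<le> W"
  shows "(\<Sum>i\<in>A. w i) \<le> real (card A) * (1/2) ^ l + W * real (card {i\<in>A. 1 < w i})
    + (\<Sum>j=1..l. 2 * (1/2) ^ j * real (card {i\<in>A. (1/2) ^ j < w i}))"
proof -
  have pt: "w i \<le> (1/2) ^ l + W * of_bool (1 < w i) + (\<Sum>j=1..l. 2 * (1/2) ^ j * of_bool ((1/2) ^ j < w i))"
    if i: "i \<in> A" for i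
  proof (induction l)
    case 0
    then show ?case using w[OF i] by simp
  next
    case (Suc l)
    have "0 \<le> W" using w[OF i] by linarith
    define R where "R = W * of_bool (1 < w i) + (\<Sum>j=1..l. 2 * (1/2) ^ j * of_bool ((1/2) ^ j < w i))"
    have "0 \<le> R" unfolding R_def using \<open>0 \<le> W\<close> by (intro add_nonneg_nonneg sum_nonneg) auto
    have "w i \<le> (1/2) ^ l + R" using Suc by (simp add: R_def)
    then have "w i \<le> (1/2) ^ Suc l + (R + 2 * (1/2) ^ Suc l * of_bool ((1/2) ^ Suc l < w i))"
      using \<open>0 \<le> R\<close> zero_le_power[of "1/2::real" l]
      by (cases "(1/2) ^ Suc l < w i") (simp_all only: of_bool_eq power_Suc, linarith+)
    then show ?case by (simp add: R_def)
  qed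
  have c: "(\<Sum>i\<in>A. of_bool (P i) :: real) = real (card {i\<in>A. P i})" for P
    using fin by (simp add: of_bool_def sum.If_cases Int_def)
  have "(\<Sum>i\<in>A. w i) \<le> (\<Sum>i\<in>A. (1/2) ^ l + W * of_bool (1 < w i) + (\<Sum>j=1..l. 2 * (1/2) ^ j * of_bool ((1/2) ^ j < w i)))"
    by (rule sum_mono) (rule pt)
  also have "\<dots> = real (card A) * (1/2) ^ l + W * real (card {i\<in>A. 1 < w i})
    + (\<Sum>j=1..l. 2 * (1/2) ^ j * real (card {i\<in>A. (1/2) ^ j < w i}))"
  proof -
    have "(\<Sum>i\<in>A. \<Sum>j=1..l. 2 * (1/2) ^ j * of_bool ((1/2) ^ j < w i) :: real)
      = (\<Sum>j=1..l. 2 * (1/2) ^ j * (\<Sum>i\<in>A. of_bool ((1/2) ^ j < w i)))"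
      by (subst sum.swap) (simp only: sum_distrib_left)
    moreover have "(\<Sum>i\<in>A. W * of_bool (1 < w i)) = W * (\<Sum>i\<in>A. of_bool (1 < w i))"
      by (simp only: sum_distrib_left)
    ultimately show ?thesis by (simp only: sum.distrib c sum_constant)
  qed
  finally show ?thesis .
qed

lemma card_image_floor_le:
  fixes S :: "real set"
  assumes "0 \<le> w" "\<And>x y. x \<in> S \<Longrightarrow> y \<in> S \<Longrightarrow> \<bar>x - y\<bar> \<le> w"
  shows "finite (floor ` S)" "real (card (floor ` S)) \<le> 2 * w + 3"
proof -
  have sub: "floor ` S \<subseteq> {\<lfloor>x - w\<rfloor>..\<lfloor>x + w\<rfloor>}" if x: "x \<in> S" for x
  proof clarsimp
    fix y assume "y \<in> S"
    with assms(2)[OF x this] show "\<lfloor>x - w\<rfloor> \<le> \<lfloor>y\<rfloor> \<and> \<lfloor>y\<rfloor> \<le> \<lfloor>x + w\<rfloor>"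
      by (intro conjI floor_mono) linarith+
  qed
  show "finite (floor ` S)" using sub finite_subset by (cases "S = {}") blast+
  show "real (card (floor ` S)) \<le> 2 * w + 3"
  proof (cases "S = {}")
    case False
    then obtain x where x: "x \<in> S" by blast
    have "card (floor ` S) \<le> card {\<lfloor>x - w\<rfloor>..\<lfloor>x + w\<rfloor>}" by (rule card_mono[OF _ sub[OF x]]) simp
    also have "\<dots> = nat (\<lfloor>x + w\<rfloor> + 1 - \<lfloor>x - w\<rfloor>)" by simp
    finally have "real (card (floor ` S)) \<le> real (nat (\<lfloor>x + w\<rfloor> + 1 - \<lfloor>x - w\<rfloor>))" by (rule of_nat_mono)
    also have "\<dots> \<le> 2 * w + 3" using assms(1) by linarith
    finally show ?thesis .
  qed (use assms(1) in simp)
qed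

lemma geometric_sum_le_last:
  fixes \<rho> :: real
  assumes "1 < \<rho>"
  shows "(\<Sum>j=1..l. \<rho> ^ j) \<le> \<rho> / (\<rho> - 1) * \<rho> ^ l"
proof (induction l)
  case 0
  then show ?case using assms by simp
next
  case (Suc l)
  have "(\<Sum>j=1..Suc l. \<rho> ^ j) \<le> \<rho> / (\<rho> - 1) * \<rho> ^ l + \<rho> ^ Suc l" using Suc by simp
  also have "\<dots> = \<rho> / (\<rho> - 1) * \<rho> ^ Suc l" using assms by (simp add: field_simps)
  finally show ?case .
qed

text \<open>
  In a dyadic column of width \<open>\<epsilon> = 2 powr - k\<close> about \<open>1 + w / \<epsilon>\<close> squares meet the graph, where \<open>w\<close> is the
  oscillation in the column. It vanishes unless \<open>e\<close> moves there, and then the range of \<open>d\<close> meets the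
  column; so there are only about \<open>\<epsilon> powr - b\<close> columns with \<open>w > 0\<close>. At most \<open>\<lambda> powr - a\<close> of the
  oscillations exceed \<open>\<lambda>\<close>, and summing over the levels \<open>\<lambda>\<close> down to \<open>\<epsilon> powr (b / a)\<close> bounds the
  total oscillation by \<open>\<epsilon> powr (- b * (1 - 1 / a))\<close>.
\<close>

lemma packing_dim_graph_le:
  fixes f :: "real \<Rightarrow> 'a::euclidean_space" and e d :: "real \<Rightarrow> real"
  assumes DIM: "DIM('a) = 1" and f: "osc_growth f a" "1 < a"
    and d: "osc_growth d b" "0 < b" "b < 1"
    and e: "mono_on {0..1} e" "e ` {0..1} \<subseteq> {0..real T}"
    and inv: "\<And>s t. 0 \<le> s \<Longrightarrow> s \<le> t \<Longrightarrow> t \<le> 1 \<Longrightarrow> e s < e t \<Longrightarrow> \<exists>z\<in>{0..real T}. s \<le> d z \<and> d z \<le> t"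
  shows "packing_dim ((\<lambda>t. (t, f (e t))) ` {0..1}) \<le> ereal (1 + b * (1 - 1 / a))"
proof (rule packing_dim_le[of _ 2])
  show "0 \<le> 1 + b * (1 - 1 / a)" using f d by (intro add_nonneg_nonneg mult_nonneg_nonneg) auto
  fix \<eta> :: real assume \<eta>: "0 < \<eta>"
  let ?G = "(\<lambda>t::real. (t, f (e t))) ` {0..1}"
  let ?\<theta> = "b * (1 - 1 / a) + \<eta>"
  \<comment> \<open>A one-dimensional space is handled through its single basis vector, in which
    distances are differences of coordinates.\<close>
  obtain u :: 'a where u: "Basis = {u}" using DIM card_1_singletonE by blast
  have dist_u: "dist x y = \<bar>x \<bullet> u - y \<bullet> u\<bar>" for x y :: 'a
  proof -
    have "x - y = (\<Sum>b\<in>Basis. ((x - y) \<bullet> b) *\<^sub>R b)" by (simp only: euclidean_representation)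
    also have "\<dots> = ((x - y) \<bullet> u) *\<^sub>R u" by (simp only: u) simp
    finally have "x - y = ((x - y) \<bullet> u) *\<^sub>R u" .
    then have "norm (x - y) = \<bar>(x - y) \<bullet> u\<bar> * norm u" by (metis norm_scaleR)
    moreover have "norm u = 1" by (rule norm_Basis) (simp add: u)
    ultimately show ?thesis by (simp add: dist_norm inner_diff_left)
  qed
  have eT: "0 \<le> e t" "e t \<le> real T" if "0 \<le> t" "t \<le> 1" for t using e(2) that by (auto simp: image_subset_iff)
  have e_mono: "e s \<le> e t" if "0 \<le> s" "s \<le> t" "t \<le> 1" for s t using e(1) that by (auto simp: mono_on_def)
  obtain Cf where Cf: "0 \<le> Cf" "\<And>k. \<exists>n. osc_index f (real T) (2 powr - real k) n \<and>
    real n + 1 \<le> Cf * 2 powr (real k * (a + \<eta>))" using osc_growthE[OF f(1) \<eta>] f(2) by (metis less_eq_real_def less_trans zero_less_one)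
  obtain Cd where Cd: "0 \<le> Cd" "\<And>k. \<exists>n. osc_index d (real T) (2 powr - real k) n \<and>
    real n + 1 \<le> Cd * 2 powr (real k * (b + \<eta>))" using osc_growthE[OF d(1) \<eta>] d(2) by (metis less_eq_real_def)
  obtain B where B: "\<And>x. x \<in> f ` {0..real T} \<Longrightarrow> norm x \<le> B" "0 < B"
    using osc_growth_bounded[OF f(1)] by (metis bounded_pos)
  \<comment> \<open>Ratio of consecutive layers: layer \<open>j\<close> has weight
    \<open>2 powr - j\<close> and at most about \<open>2 powr (j * (a + \<eta>))\<close> columns. As
    \<open>a > 1\<close>, the ratio exceeds 1 and the finest layer dominates.\<close>
  define \<rho> where "\<rho> = 2 powr (a + \<eta> - 1)"
  have \<rho>: "1 < \<rho>" using f \<eta> by (simp add: \<rho>_def)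
  define C1 where "C1 = 4 * Cd + 2 * B * Cf + 2 * Cf * (\<rho> / (\<rho> - 1))"
  have "\<exists>n. covered ?G (2 * 2 powr - real k) n \<and> real n \<le> (6 + 2 * C1) * 2 powr (real k * (1 + ?\<theta>))" for k
  proof -
    define p where "p t = nat \<lfloor>t * 2 ^ k\<rfloor>" for t :: real
    define I where "I i = {t. 0 \<le> t \<and> t \<le> 1 \<and> p t = i}" for i
    define w where "w i = diameter ((f \<circ> e) ` I i)" for i
    define Act where "Act = {i. i \<le> 2 ^ k \<and> (\<exists>s\<in>I i. \<exists>t\<in>I i. e s < e t)}"
    have finA: "finite Act" by (simp add: Act_def)
    have p_mono: "p s \<le> p t" if "s \<le> t" for s t
      unfolding p_def using that by (intro nat_mono floor_mono mult_right_mono) auto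
    have p_le: "p t \<le> 2 ^ k" if "t \<le> 1" for t using p_mono[OF that] by (simp add: p_def nat_power_eq)
    have bdd: "bounded ((f \<circ> e) ` I i)" for i
      by (rule bounded_subset[OF osc_growth_bounded[OF f(1), of T]]) (use eT in \<open>auto simp: I_def\<close>)
    have w_ge: "dist (f (e s)) (f (e t)) \<le> w i" if "s \<in> I i" "t \<in> I i" for s t i
      unfolding w_def using diameter_bounded_bound[OF bdd, of "f (e s)" i "f (e t)"] that by auto
    have w0: "0 \<le> w i" for i unfolding w_def using bdd by simp
    have w_le: "w i \<le> 2 * B" for i
      unfolding w_def
    proof (rule bounded_diameter_le(2))
      fix x y assume "x \<in> (f \<circ> e) ` I i" "y \<in> (f \<circ> e) ` I i"
      then have "norm x \<le> B" "norm y \<le> B" using B(1) eT by (auto simp: I_def)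
      then show "dist x y \<le> 2 * B" using norm_triangle_ineq4[of x y] by (simp add: dist_norm)
    qed (use B in auto)
    have w_exceeds: "\<exists>s\<in>I i. \<exists>t\<in>I i. s \<le> t \<and> r < dist (f (e s)) (f (e t))" if "r < w i" "0 \<le> r" for i r
    proof (rule ccontr)
      assume neg: "\<not> ?thesis"
      have "dist x y \<le> r" if xy: "x \<in> (f \<circ> e) ` I i" "y \<in> (f \<circ> e) ` I i" for x y
      proof -
        obtain s where "s \<in> I i" "x = f (e s)" using xy(1) by auto
        moreover obtain t where "t \<in> I i" "y = f (e t)" using xy(2) by auto
        ultimately show ?thesis using neg by (cases "s \<le> t") (force simp: dist_commute not_less)+
      qed
      then have "w i \<le> r" unfolding w_def using \<open>0 \<le> r\<close> by (intro bounded_diameter_le(2))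
      then show False using \<open>r < w i\<close> by simp
    qed
    have inactive: "w i = 0" if "i \<le> 2 ^ k" "i \<notin> Act" for i
    proof (rule ccontr)
      assume "w i \<noteq> 0"
      then obtain s t where st: "s \<in> I i" "t \<in> I i" "0 < dist (f (e s)) (f (e t))"
        using w_exceeds[of 0 i] w0[of i] by force
      have "\<not> e s < e t" "\<not> e t < e s" using that st by (auto simp: Act_def)
      then have "e s = e t" by simp
      then show False using st(3) by simp
    qed
    have levels: "real (card {i\<in>Act. (1/2) ^ j < w i}) \<le> Cf * 2 powr (real j * (a + \<eta>))" for j
    proof -
      obtain n where n: "osc_index f (real T) (2 powr - real j) n" "real n + 1 \<le> Cf * 2 powr (real j * (a + \<eta>))"
        using Cf by blast
      obtain F :: "real \<Rightarrow> nat" where F: "\<And>x y. 0 \<le> x \<Longrightarrow> x \<le> y \<Longrightarrow> y \<le> real T \<Longrightarrow> F x \<le> F y"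
        "\<And>x. 0 \<le> x \<Longrightarrow> x \<le> real T \<Longrightarrow> F x \<le> n"
        "\<And>x y. 0 \<le> x \<Longrightarrow> x \<le> real T \<Longrightarrow> 0 \<le> y \<Longrightarrow> y \<le> real T \<Longrightarrow> F x = F y \<Longrightarrow> dist (f x) (f y) \<le> 2 powr - real j"
        by (rule osc_indexE[OF n(1)]) blast
      let ?L = "{i\<in>Act. (1/2) ^ j < w i}"
      \<comment> \<open>A column with oscillation above \<open>2 powr - j\<close> makes
        \<open>F\<close> along \<open>e\<close> increase inside it, and this function never
        decreases. Hence its values at the chosen points \<open>\<tau> i\<close> increase strictly
        from column to column, and all of them are at most \<open>n\<close>.\<close>
      have "\<exists>t. \<exists>s\<in>I i. t \<in> I i \<and> F (e s) < F (e t)" if i: "i \<in> ?L" for i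
      proof -
        have "2 powr - real j < w i" using i by (simp add: powr_minus powr_realpow power_one_over inverse_eq_divide)
        then obtain s t where st: "s \<in> I i" "t \<in> I i" "s \<le> t" "2 powr - real j < dist (f (e s)) (f (e t))"
          using w_exceeds[of "2 powr - real j" i] by auto
        have st': "0 \<le> s" "s \<le> t" "t \<le> 1" using st by (auto simp: I_def)
        have "F (e s) \<noteq> F (e t)" using F(3)[of "e s" "e t"] eT st' st(4) by force
        moreover have "F (e s) \<le> F (e t)" using F(1) e_mono eT st' by simp
        ultimately show ?thesis using st by (metis le_neq_implies_less)
      qed
      then obtain \<tau> where \<tau>: "\<And>i. i \<in> ?L \<Longrightarrow> \<exists>s\<in>I i. \<tau> i \<in> I i \<and> F (e s) < F (e (\<tau> i))" by metis
      have less: "F (e (\<tau> i)) < F (e (\<tau> i'))" if ii: "i \<in> ?L" "i' \<in> ?L" "i < i'" for i i'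
      proof -
        obtain s where s: "s \<in> I i'" "\<tau> i' \<in> I i'" "F (e s) < F (e (\<tau> i'))" using \<tau>[OF ii(2)] by blast
        have t: "\<tau> i \<in> I i" using \<tau>[OF ii(1)] by blast
        have "\<tau> i \<le> s" using p_mono[of s "\<tau> i"] s(1) t ii(3) by (cases "\<tau> i \<le> s") (auto simp: I_def)
        then have "F (e (\<tau> i)) \<le> F (e s)" using F(1) e_mono eT s(1) t by (auto simp: I_def)
        then show ?thesis using s(3) by simp
      qed
      have "inj_on (\<lambda>i. F (e (\<tau> i))) ?L"
      proof (rule inj_onI)
        fix i i' assume "i \<in> ?L" "i' \<in> ?L" "F (e (\<tau> i)) = F (e (\<tau> i'))"
        then show "i = i'" using less[of i i'] less[of i' i] by (cases i i' rule: linorder_cases) auto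
      qed
      moreover have "(\<lambda>i. F (e (\<tau> i))) ` ?L \<subseteq> {..n}"
        using \<tau> F(2) eT by (fastforce simp: I_def)
      ultimately have "card ?L \<le> card {..n}" by (intro card_inj_on_le) auto
      then show ?thesis using n(2) by simp
    qed
    have actives: "real (card Act) \<le> 2 * (Cd * 2 powr (real k * (b + \<eta>)))"
    proof -
      obtain n where n: "osc_index d (real T) (2 powr - real k) n" "real n + 1 \<le> Cd * 2 powr (real k * (b + \<eta>))"
        using Cd by blast
      obtain F :: "real \<Rightarrow> nat" where F: "\<And>x. 0 \<le> x \<Longrightarrow> x \<le> real T \<Longrightarrow> F x \<le> n"
        "\<And>x y. 0 \<le> x \<Longrightarrow> x \<le> real T \<Longrightarrow> 0 \<le> y \<Longrightarrow> y \<le> real T \<Longrightarrow> F x = F y \<Longrightarrow> dist (d x) (d y) \<le> 2 powr - real k"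
        by (rule osc_indexE[OF n(1)]) blast
      have "\<exists>z. 0 \<le> z \<and> z \<le> real T \<and> 0 \<le> d z \<and> p (d z) = i" if i: "i \<in> Act" for i
      proof -
        obtain s t where st: "s \<in> I i" "t \<in> I i" "e s < e t" using i by (auto simp: Act_def)
        then have st': "0 \<le> s" "s \<le> 1" "0 \<le> t" "t \<le> 1" "p s = i" "p t = i" by (auto simp: I_def)
        have "s \<le> t" using e_mono[of t s] st(3) st' by linarith
        then obtain z where z: "z \<in> {0..real T}" "s \<le> d z" "d z \<le> t" using inv st(3) st' by blast
        have "p (d z) = i" using p_mono[OF z(2)] p_mono[OF z(3)] st' by simp
        then show ?thesis using z st' by auto
      qed
      then obtain z where z: "\<And>i. i \<in> Act \<Longrightarrow> 0 \<le> z i \<and> z i \<le> real T \<and> 0 \<le> d (z i) \<and> p (d (z i)) = i"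
        by metis
      \<comment> \<open>Only columns of equal parity are compared: neighbouring columns can share a
        piece of \<open>d\<close>, but points of columns two apart differ by more than the
        oscillation of a piece. This costs the factor 2.\<close>
      have dis: "F (z i) \<noteq> F (z i')" if "i \<in> Act" "i' \<in> Act" "i < i'" "i mod 2 = i' mod 2" for i i'
      proof
        assume "F (z i) = F (z i')"
        then have "dist (d (z i)) (d (z i')) \<le> 2 powr - real k" using F(2) z that(1,2) by blast
        then have "\<bar>d (z i) - d (z i')\<bar> * 2 ^ k \<le> 2 powr - real k * 2 ^ k"
          by (intro mult_right_mono) (auto simp: dist_real_def)
        then have close: "\<bar>d (z i) * 2 ^ k - d (z i') * 2 ^ k\<bar> \<le> 1"
          by (simp add: left_diff_distrib[symmetric] abs_mult powr_minus powr_realpow)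
        have fl: "\<lfloor>d (z i) * 2 ^ k\<rfloor> = int i" "\<lfloor>d (z i') * 2 ^ k\<rfloor> = int i'"
        proof -
          have "0 \<le> \<lfloor>d (z i) * 2 ^ k\<rfloor>" "0 \<le> \<lfloor>d (z i') * 2 ^ k\<rfloor>"
            using z[OF that(1)] z[OF that(2)] by simp_all
          then show "\<lfloor>d (z i) * 2 ^ k\<rfloor> = int i" "\<lfloor>d (z i') * 2 ^ k\<rfloor> = int i'"
            using z[OF that(1)] z[OF that(2)] by (metis p_def int_nat_eq)+
        qed
        have "i + 2 \<le> i'" using that(3,4) by presburger
        then show False using close fl by linarith
      qed
      have "inj_on (\<lambda>i. (i mod 2, F (z i))) Act"
      proof (rule inj_onI)
        fix i i' assume "i \<in> Act" "i' \<in> Act" "(i mod 2, F (z i)) = (i' mod 2, F (z i'))"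
        then show "i = i'" using dis[of i i'] dis[of i' i] by (cases i i' rule: linorder_cases) auto
      qed
      moreover have "(\<lambda>i. (i mod 2, F (z i))) ` Act \<subseteq> {0, 1} \<times> {..n}"
        using z F(1) by auto
      ultimately have "card Act \<le> card ({0, 1::nat} \<times> {..n})" by (intro card_inj_on_le) auto
      also have "\<dots> = 2 * (n + 1)" by (simp add: card_cartesian_product)
      finally have "real (card Act) \<le> real (2 * (n + 1))" by (rule of_nat_mono)
      then show ?thesis using n(2) by (simp add: distrib_left)
    qed
    have sum_w: "(\<Sum>i\<in>Act. w i) \<le> C1 * 2 powr (real k * ?\<theta>)"
    proof -
      \<comment> \<open>The cut-off balances two errors: the unresolved part
        \<open>card Act * (1/2) ^ l\<close> and the finest layer \<open>\<rho> ^ l\<close> are both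
        of order \<open>2 powr (k * b * (1 - 1 / a))\<close>, up to the slack
        \<open>\<eta>\<close>.\<close>
      define l where "l = nat \<lfloor>real k * b / a\<rfloor>"
      have "0 \<le> real k * b / a" using f d by simp
      then have l: "real l \<le> real k * b / a" "real k * b / a < real l + 1" unfolding l_def by linarith+
      have le1: "1 \<le> 2 powr (real k * ?\<theta>)"
        using f d \<eta> by (intro ge_one_powr_ge_zero mult_nonneg_nonneg add_nonneg_nonneg) auto
      have half: "(1/2) ^ j = (2::real) powr - real j" for j
        by (simp add: powr_minus powr_realpow power_one_over inverse_eq_divide)
      have s1: "real (card Act) * (1/2) ^ l \<le> 4 * Cd * 2 powr (real k * ?\<theta>)"
      proof -
        have "real (card Act) * (1/2) ^ l \<le> (2 * (Cd * 2 powr (real k * (b + \<eta>)))) * (2 powr - real l)"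
          using actives by (simp add: half mult_right_mono)
        also have "\<dots> \<le> (2 * (Cd * 2 powr (real k * (b + \<eta>)))) * (2 powr (1 - real k * b / a))"
          using l Cd by (intro mult_left_mono powr_mono) auto
        also have "\<dots> = 2 * Cd * 2 powr (real k * (b + \<eta>) + (1 - real k * b / a))"
          by (simp only: powr_add mult_ac)
        also have "real k * (b + \<eta>) + (1 - real k * b / a) = 1 + real k * ?\<theta>" by (simp add: algebra_simps)
        also have "2 * Cd * 2 powr (1 + real k * ?\<theta>) = 4 * Cd * 2 powr (real k * ?\<theta>)" by (simp add: powr_add)
        finally show ?thesis .
      qed
      have s2: "2 * B * real (card {i\<in>Act. 1 < w i}) \<le> 2 * B * Cf * 2 powr (real k * ?\<theta>)"
      proof -
        have "real (card {i\<in>Act. 1 < w i}) \<le> Cf" using levels[of 0] by simp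
        also have "\<dots> \<le> Cf * 2 powr (real k * ?\<theta>)" using le1 Cf(1) mult_left_mono by fastforce
        finally show ?thesis using B(2) by (simp add: mult_left_mono mult.assoc)
      qed
      have s3: "(\<Sum>j=1..l. 2 * (1/2) ^ j * real (card {i\<in>Act. (1/2) ^ j < w i}))
        \<le> 2 * Cf * (\<rho> / (\<rho> - 1)) * 2 powr (real k * ?\<theta>)"
      proof -
        have rl: "\<rho> ^ l \<le> 2 powr (real k * ?\<theta>)"
        proof -
          have "\<rho> ^ l = 2 powr ((a + \<eta> - 1) * real l)" by (simp add: \<rho>_def powr_power mult.commute)
          also have "\<dots> \<le> 2 powr ((a + \<eta> - 1) * (real k * b / a))"
            using l f \<eta> by (intro powr_mono mult_left_mono) auto
          also have "\<dots> \<le> 2 powr (real k * ?\<theta>)"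
          proof (rule powr_mono)
            have "b / a \<le> 1" using f d by simp
            have "(a + \<eta> - 1) * (real k * b / a) = real k * (b * (1 - 1 / a) + \<eta> * (b / a))"
              using f by (simp add: field_simps)
            also have "\<dots> \<le> real k * ?\<theta>"
              using \<open>b / a \<le> 1\<close> \<eta> mult_left_mono[of "b / a" 1 \<eta>] by (intro mult_left_mono add_left_mono) auto
            finally show "(a + \<eta> - 1) * (real k * b / a) \<le> real k * ?\<theta>" .
          qed simp
          finally show ?thesis .
        qed
        have "(\<Sum>j=1..l. 2 * (1/2) ^ j * real (card {i\<in>Act. (1/2) ^ j < w i})) \<le> (\<Sum>j=1..l. 2 * Cf * \<rho> ^ j)"
        proof (rule sum_mono)
          fix j
          have "2 * (1/2) ^ j * real (card {i\<in>Act. (1/2) ^ j < w i}) \<le> 2 * (2 powr - real j) * (Cf * 2 powr (real j * (a + \<eta>)))"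
            unfolding half[symmetric] by (intro mult_left_mono levels) auto
          also have "\<dots> = 2 * Cf * 2 powr (- real j + real j * (a + \<eta>))" by (simp only: powr_add mult_ac)
          also have "- real j + real j * (a + \<eta>) = (a + \<eta> - 1) * real j" by (simp add: algebra_simps)
          also have "2 powr ((a + \<eta> - 1) * real j) = \<rho> ^ j" by (simp add: \<rho>_def powr_power mult.commute)
          finally show "2 * (1/2) ^ j * real (card {i\<in>Act. (1/2) ^ j < w i}) \<le> 2 * Cf * \<rho> ^ j" .
        qed
        also have "\<dots> = 2 * Cf * (\<Sum>j=1..l. \<rho> ^ j)" by (simp add: sum_distrib_left)
        also have "\<dots> \<le> 2 * Cf * (\<rho> / (\<rho> - 1) * \<rho> ^ l)"
          using geometric_sum_le_last[OF \<rho>] Cf(1) by (intro mult_left_mono) auto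
        also have "\<dots> \<le> 2 * Cf * (\<rho> / (\<rho> - 1) * 2 powr (real k * ?\<theta>))"
          using rl Cf(1) \<rho> by (intro mult_left_mono) auto
        finally show ?thesis by (simp only: mult.assoc)
      qed
      have "(\<Sum>i\<in>Act. w i) \<le> real (card Act) * (1/2) ^ l + 2 * B * real (card {i\<in>Act. 1 < w i})
        + (\<Sum>j=1..l. 2 * (1/2) ^ j * real (card {i\<in>Act. (1/2) ^ j < w i}))"
        by (rule layered_sum_le) (use finA w0 w_le in auto)
      also have "\<dots> \<le> C1 * 2 powr (real k * ?\<theta>)"
        using s1 s2 s3 by (simp add: C1_def distrib_right)
      finally show ?thesis .
    qed
    \<comment> \<open>Row of the dyadic square that contains the graph point; together with the
      column \<open>p t\<close> it is the label of the cover.\<close>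
    define q where "q t = \<lfloor>(f (e t) \<bullet> u) * 2 ^ k\<rfloor>" for t
    have q_card: "finite (q ` I i)" "real (card (q ` I i)) \<le> 2 * (w i * 2 ^ k) + 3" for i
    proof -
      have c: "\<bar>x - y\<bar> \<le> w i * 2 ^ k" if xy: "x \<in> (\<lambda>t. (f (e t) \<bullet> u) * 2 ^ k) ` I i" "y \<in> (\<lambda>t. (f (e t) \<bullet> u) * 2 ^ k) ` I i" for x y
      proof -
        obtain s t where st: "s \<in> I i" "t \<in> I i" "x = (f (e s) \<bullet> u) * 2 ^ k" "y = (f (e t) \<bullet> u) * 2 ^ k" using xy by blast
        have "\<bar>x - y\<bar> = dist (f (e s)) (f (e t)) * 2 ^ k"
          unfolding st dist_u left_diff_distrib[symmetric] abs_mult by simp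
        then show ?thesis using w_ge[OF st(1,2)] by (simp add: mult_right_mono)
      qed
      have im: "q ` I i = floor ` (\<lambda>t. (f (e t) \<bullet> u) * 2 ^ k) ` I i" by (auto simp: q_def image_image)
      show "finite (q ` I i)" "real (card (q ` I i)) \<le> 2 * (w i * 2 ^ k) + 3"
        unfolding im using card_image_floor_le[OF _ c] w0 by auto
    qed
    define g where "g t = (p t, q t)" for t
    have sub: "g ` {0..1} \<subseteq> (SIGMA i:{..2 ^ k}. q ` I i)"
      using p_le by (auto simp: g_def I_def)
    have finS: "finite (SIGMA i:{..(2::nat) ^ k}. q ` I i)" using q_card by blast
    have "covered ?G (2 * 2 powr - real k) (card (g ` {0..1}))"
    proof (rule covered_imageI[of g])
      show "finite (g ` {0..1})" using sub finS finite_subset by blast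
      show "dist (s, f (e s)) (t, f (e t)) \<le> 2 * 2 powr - real k"
        if st: "s \<in> {0..1}" "t \<in> {0..1}" "g s = g t" for s t
      proof -
        have "\<lfloor>s * 2 ^ k\<rfloor> = \<lfloor>t * 2 ^ k\<rfloor>" using st by (simp add: g_def p_def eq_nat_nat_iff)
        then have "dist s t \<le> 2 powr - real k" using dyadic_floor_eq_imp_close by (auto simp: dist_real_def)
        moreover have "dist (f (e s)) (f (e t)) \<le> 2 powr - real k"
          unfolding dist_u using st(3) by (intro dyadic_floor_eq_imp_close) (simp add: g_def q_def)
        ultimately show ?thesis using dist_Pair_le[of s "f (e s)" t "f (e t)"] by linarith
      qed
    qed simp
    moreover have "real (card (g ` {0..1})) \<le> (6 + 2 * C1) * 2 powr (real k * (1 + ?\<theta>))"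
    proof -
      have "card (g ` {0..1}) \<le> card (SIGMA i:{..(2::nat) ^ k}. q ` I i)" by (rule card_mono[OF finS sub])
      also have "\<dots> = (\<Sum>i\<le>2 ^ k. card (q ` I i))" using q_card by (intro card_SigmaI) auto
      finally have "real (card (g ` {0..1})) \<le> (\<Sum>i\<le>2 ^ k. real (card (q ` I i)))"
        unfolding of_nat_sum[symmetric] by (rule of_nat_mono)
      also have "\<dots> \<le> (\<Sum>i\<le>2 ^ k. 2 * (w i * 2 ^ k) + 3)" by (intro sum_mono q_card)
      also have "\<dots> = 2 * 2 ^ k * (\<Sum>i\<le>2 ^ k. w i) + 3 * (2 ^ k + 1)"
        by (simp add: sum.distrib sum_distrib_left mult_ac)
      also have "(\<Sum>i\<le>(2::nat) ^ k. w i) = (\<Sum>i\<in>Act. w i)"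
        using inactive by (intro sum.mono_neutral_right) (auto simp: Act_def)
      also have "2 * 2 ^ k * (\<Sum>i\<in>Act. w i) + 3 * (2 ^ k + 1) \<le> 2 * 2 ^ k * (C1 * 2 powr (real k * ?\<theta>)) + 6 * 2 ^ k"
        using sum_w one_le_power[of "2::real" k] by (intro add_mono mult_left_mono) auto
      also have "\<dots> \<le> 2 * 2 ^ k * (C1 * 2 powr (real k * ?\<theta>)) + 6 * 2 ^ k * 2 powr (real k * ?\<theta>)"
      proof -
        have "1 \<le> 2 powr (real k * ?\<theta>)"
          using f d \<eta> by (intro ge_one_powr_ge_zero mult_nonneg_nonneg add_nonneg_nonneg) auto
        then show ?thesis by (simp add: mult_le_cancel_left1)
      qed
      also have "\<dots> = (6 + 2 * C1) * (2 powr real k * 2 powr (real k * ?\<theta>))"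
        by (simp add: powr_realpow algebra_simps)
      also have "2 powr real k * 2 powr (real k * ?\<theta>) = 2 powr (real k * (1 + ?\<theta>))"
        by (simp add: powr_add[symmetric] distrib_left)
      finally show ?thesis .
    qed
    ultimately show ?thesis by blast
  qed
  then show "\<exists>C. \<forall>k. \<exists>n. covered ?G (2 * 2 powr - real k) n \<and> real n \<le> C * 2 powr (real k * (1 + b * (1 - 1 / a) + \<eta>))"
    by (simp add: add.assoc) blast
qed auto

section \<open>Small balls\<close>

locale stable_motion = prob_space M for M :: "'w measure" +
  fixes Y :: "real \<Rightarrow> 'w \<Rightarrow> 'a::euclidean_space" and \<alpha> :: real
  assumes stable: "stable_levy_motion M \<alpha> Y" and index_pos: "0 < \<alpha>"
begin

lemma levy: "levy_process M Y"
  using stable by (simp add: stable_levy_motion_def)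

lemma measurable_Y: "0 \<le> t \<Longrightarrow> Y t \<in> borel_measurable M"
  using levy by (simp add: levy_process_def)

lemma AE_Y_0: "AE \<omega> in M. Y 0 \<omega> = 0"
  using levy by (simp add: levy_process_def)

lemma AE_cadlag: "AE \<omega> in M. cadlag (\<lambda>t. Y t \<omega>)"
  using levy by (simp add: levy_process_def)

lemma increments_indep:
  "0 \<le> t 0 \<Longrightarrow> strict_mono_on {..n} t \<Longrightarrow>
    indep_vars (\<lambda>_. borel) (\<lambda>i \<omega>. Y (t (Suc i)) \<omega> - Y (t i) \<omega>) {..<n::nat}"
  using levy by (simp add: levy_process_def)

lemma distr_increment:
  assumes "0 \<le> s" "0 \<le> h"
  shows "distr M borel (\<lambda>\<omega>. Y (s + h) \<omega> - Y s \<omega>) = distr M borel (Y h)"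
proof -
  have "distr M borel (\<lambda>\<omega>. Y (s + h) \<omega> - Y s \<omega>) = distr M borel (\<lambda>\<omega>. Y h \<omega> - Y 0 \<omega>)"
    using levy assms by (simp add: levy_process_def)
  also have "\<dots> = distr M borel (Y h)"
    using AE_Y_0 measurable_Y assms by (intro distr_cong_AE) auto
  finally show ?thesis .
qed

lemma measurable_process_path:
  assumes "\<And>t. 0 \<le> t \<Longrightarrow> Z t \<in> borel_measurable M"
  shows "process_path Z \<in> measurable M path_space"
  unfolding path_space_def process_path_def using assms by (intro measurable_restrict) auto

text \<open>Self-similarity for events of the whole path: smallness at many times at once, as in the
  calm stretches, is not determined by the one-time laws.\<close>

lemma prob_scale:
  assumes "0 < c" "A \<in> sets path_space"
  shows "prob {\<omega>\<in>space M. process_path (\<lambda>x. Y (c * x)) \<omega> \<in> A}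
    = prob {\<omega>\<in>space M. process_path (\<lambda>x \<omega>. c powr (1 / \<alpha>) *\<^sub>R Y x \<omega>) \<omega> \<in> A}"
proof -
  have [measurable]: "process_path (\<lambda>x. Y (c * x)) \<in> measurable M path_space"
    "process_path (\<lambda>x \<omega>. c powr (1 / \<alpha>) *\<^sub>R Y x \<omega>) \<in> measurable M path_space"
    using measurable_Y assms(1) by (auto intro!: measurable_process_path borel_measurable_scaleR)
  have "process_law M (\<lambda>x. Y (c * x)) = process_law M (\<lambda>x \<omega>. c powr (1 / \<alpha>) *\<^sub>R Y x \<omega>)"
    using stable assms(1) by (simp add: stable_levy_motion_def)
  then have "measure (process_law M (\<lambda>x. Y (c * x))) A = measure (process_law M (\<lambda>x \<omega>. c powr (1 / \<alpha>) *\<^sub>R Y x \<omega>)) A"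
    by simp
  then show ?thesis
    using assms(2) by (simp add: process_law_def measure_distr vimage_def Int_def conj_commute)
qed

lemma distr_scale:
  assumes "0 < c" "0 \<le> t"
  shows "distr M borel (Y (c * t)) = distr M borel (\<lambda>\<omega>. c powr (1 / \<alpha>) *\<^sub>R Y t \<omega>)"
proof -
  have m: "process_path (\<lambda>x. Y (c * x)) \<in> measurable M path_space"
    "process_path (\<lambda>x \<omega>. c powr (1 / \<alpha>) *\<^sub>R Y x \<omega>) \<in> measurable M path_space"
    using measurable_Y assms(1) by (auto intro!: measurable_process_path borel_measurable_scaleR)
  have p: "(\<lambda>f. f t) \<in> borel_measurable path_space"
    unfolding path_space_def using assms(2) by (intro measurable_component_singleton) simp
  have "distr (process_law M (\<lambda>x. Y (c * x))) borel (\<lambda>f. f t)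
      = distr (process_law M (\<lambda>x \<omega>. c powr (1 / \<alpha>) *\<^sub>R Y x \<omega>)) borel (\<lambda>f. f t)"
    using stable assms(1) by (simp add: stable_levy_motion_def)
  then show ?thesis
    unfolding process_law_def distr_distr[OF p m(1)] distr_distr[OF p m(2)]
    using assms by (simp add: comp_def process_path_def)
qed

lemma prob_norm_increment_le:
  assumes "0 \<le> s" "0 < h"
  shows "prob {\<omega>\<in>space M. norm (Y (s + h) \<omega> - Y s \<omega>) \<le> r}
    = prob {\<omega>\<in>space M. norm (Y 1 \<omega>) \<le> r * h powr - (1 / \<alpha>)}"
proof -
  have m: "Y (s + h) \<in> borel_measurable M" "Y s \<in> borel_measurable M" "Y h \<in> borel_measurable M" "Y 1 \<in> borel_measurable M"
    using measurable_Y assms by auto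
  note [measurable] = m
  have "prob {\<omega>\<in>space M. norm (Y (s + h) \<omega> - Y s \<omega>) \<le> r}
      = measure (distr M borel (\<lambda>\<omega>. Y (s + h) \<omega> - Y s \<omega>)) {x. norm x \<le> r}"
    by (subst measure_distr) (auto simp: vimage_def Int_def conj_commute intro!: arg_cong[where f=prob])
  also have "\<dots> = measure (distr M borel (Y (h * 1))) {x. norm x \<le> r}"
    using distr_increment assms by simp
  also have "\<dots> = measure (distr M borel (\<lambda>\<omega>. h powr (1 / \<alpha>) *\<^sub>R Y 1 \<omega>)) {x. norm x \<le> r}"
    by (subst distr_scale) (use assms in auto)
  also have "\<dots> = prob {\<omega>\<in>space M. norm (h powr (1 / \<alpha>) *\<^sub>R Y 1 \<omega>) \<le> r}"
    by (subst measure_distr) (auto simp: vimage_def Int_def conj_commute intro!: arg_cong[where f=prob])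
  also have "{\<omega>\<in>space M. norm (h powr (1 / \<alpha>) *\<^sub>R Y 1 \<omega>) \<le> r} = {\<omega>\<in>space M. norm (Y 1 \<omega>) \<le> r * h powr - (1 / \<alpha>)}"
    using assms(2) by (auto simp: powr_minus field_simps)
  finally show ?thesis .
qed

text \<open>The characteristic function of the vector \<open>Y t\<close> at \<open>\<xi>\<close>,
  reduced to a real distribution by projecting onto \<open>\<xi>\<close>, so that the facts on
  \<open>char\<close> apply.\<close>

definition cf :: "'a \<Rightarrow> real \<Rightarrow> complex" where
  "cf \<xi> t = char (distr M borel (\<lambda>\<omega>. \<xi> \<bullet> Y t \<omega>)) 1"

lemma cf_eq_integral: "0 \<le> t \<Longrightarrow> cf \<xi> t = (CLINT \<omega>|M. iexp (\<xi> \<bullet> Y t \<omega>))"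
  unfolding cf_def char_def using measurable_Y by (subst integral_distr) auto

lemma norm_cf_le_1:
  assumes "0 \<le> t" shows "norm (cf \<xi> t) \<le> 1"
proof -
  interpret D: real_distribution "distr M borel (\<lambda>\<omega>. \<xi> \<bullet> Y t \<omega>)"
    using measurable_Y[OF assms] by (intro real_distribution_distr) auto
  show ?thesis unfolding cf_def by (rule D.cmod_char_le_1)
qed

lemma distr_compose:
  assumes "distr M borel U = distr M borel V" "U \<in> borel_measurable M" "V \<in> borel_measurable M" "g \<in> borel_measurable borel"
  shows "distr M borel (\<lambda>\<omega>. g (U \<omega>)) = distr M borel (\<lambda>\<omega>. g (V \<omega>))"
proof -
  have "distr M borel (g \<circ> U) = distr (distr M borel U) borel g"
    using assms by (intro distr_distr[symmetric]) auto
  also have "\<dots> = distr (distr M borel V) borel g" using assms(1) by simp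
  also have "\<dots> = distr M borel (g \<circ> V)"
    using assms by (intro distr_distr) auto
  finally show ?thesis by (simp add: comp_def)
qed

lemma cf_scale:
  assumes "0 < c" "0 \<le> t"
  shows "cf \<xi> (c * t) = cf (c powr (1 / \<alpha>) *\<^sub>R \<xi>) t"
proof -
  have [measurable]: "Y (c * t) \<in> borel_measurable M" "Y t \<in> borel_measurable M"
    using measurable_Y assms by auto
  have "distr M borel (\<lambda>\<omega>. \<xi> \<bullet> Y (c * t) \<omega>) = distr M borel (\<lambda>\<omega>. \<xi> \<bullet> (c powr (1 / \<alpha>) *\<^sub>R Y t \<omega>))"
    using distr_compose[OF distr_scale[OF assms], of "\<lambda>x. \<xi> \<bullet> x"] by measurable
  then show ?thesis by (simp add: cf_def)
qed

lemma cf_add: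
  assumes "0 < s" "0 < h"
  shows "cf \<xi> (s + h) = cf \<xi> s * cf \<xi> h"
proof -
  define t where "t i = (if i = 0 then 0 else if i = Suc 0 then s else s + h)" for i :: nat
  have m: "Y (s + h) \<in> borel_measurable M" "Y s \<in> borel_measurable M" "Y h \<in> borel_measurable M" "Y 0 \<in> borel_measurable M"
    using measurable_Y assms by auto
  note [measurable] = m
  have "indep_vars (\<lambda>_. borel) (\<lambda>i \<omega>. Y (t (Suc i)) \<omega> - Y (t i) \<omega>) {..<2}"
    using assms by (intro increments_indep) (auto simp: t_def strict_mono_on_def)
  then have "indep_vars (\<lambda>_. borel) (\<lambda>i \<omega>. \<xi> \<bullet> (Y (t (Suc i)) \<omega> - Y (t i) \<omega>)) {..<2}"
    by (rule indep_vars_compose2) auto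
  then have ch: "char (distr M borel (\<lambda>\<omega>. \<Sum>i<2. \<xi> \<bullet> (Y (t (Suc i)) \<omega> - Y (t i) \<omega>))) 1
      = (\<Prod>i<2. char (distr M borel (\<lambda>\<omega>. \<xi> \<bullet> (Y (t (Suc i)) \<omega> - Y (t i) \<omega>))) 1)"
    by (rule char_distr_sum)
  have two: "{..<2} = {0, Suc 0}" by auto
  have "distr M borel (\<lambda>\<omega>. \<Sum>i<2. \<xi> \<bullet> (Y (t (Suc i)) \<omega> - Y (t i) \<omega>)) = distr M borel (\<lambda>\<omega>. \<xi> \<bullet> Y (s + h) \<omega>)"
    using AE_Y_0 by (intro distr_cong_AE) (auto simp: two t_def inner_diff_right)
  moreover have "distr M borel (\<lambda>\<omega>. \<xi> \<bullet> (Y (t (Suc 0)) \<omega> - Y (t 0) \<omega>)) = distr M borel (\<lambda>\<omega>. \<xi> \<bullet> Y s \<omega>)"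
    using AE_Y_0 by (intro distr_cong_AE) (auto simp: t_def inner_diff_right)
  moreover have "distr M borel (\<lambda>\<omega>. \<xi> \<bullet> (Y (t (Suc (Suc 0))) \<omega> - Y (t (Suc 0)) \<omega>)) = distr M borel (\<lambda>\<omega>. \<xi> \<bullet> Y h \<omega>)"
    using distr_compose[OF distr_increment[of s h], of "\<lambda>x. \<xi> \<bullet> x"] assms by (simp add: t_def)
  ultimately show ?thesis using ch by (simp add: cf_def two)
qed

text \<open>Split off unit time intervals one at a time; over the remaining time the modulus is at
  most 1. With integer powers only, no characteristic exponent has to be constructed.\<close>

lemma norm_cf_le_power:
  "real n \<le> t \<Longrightarrow> norm (cf \<xi> t) \<le> norm (cf \<xi> 1) ^ n"
proof (induction n arbitrary: t)
  case 0
  then show ?case using norm_cf_le_1 by simp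
next
  case (Suc n)
  show ?case
  proof (cases "t = 1")
    \<comment> \<open>\<open>cf_add\<close> takes positive durations only, so
      \<open>t - 1 = 0\<close> is treated apart.\<close>
    case True
    then have "n = 0" using Suc.prems by simp
    then show ?thesis using True by simp
  next
    case False
    then have t: "0 < t - 1" "real n \<le> t - 1" using Suc.prems by auto
    have "cf \<xi> t = cf \<xi> (t - 1) * cf \<xi> 1" using cf_add[of "t - 1" 1 \<xi>] t by simp
    then have "norm (cf \<xi> t) = norm (cf \<xi> (t - 1)) * norm (cf \<xi> 1)" by (simp add: norm_mult)
    also have "\<dots> \<le> norm (cf \<xi> 1) ^ n * norm (cf \<xi> 1)"
      using Suc.IH[OF t(2)] by (intro mult_right_mono) auto
    finally show ?thesis by (simp add: mult.commute)
  qed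
qed

lemma cf_continuous: "continuous_on UNIV (\<lambda>\<xi>. cf \<xi> 1)"
proof (rule continuous_at_imp_continuous_on, rule ballI)
  fix \<xi> :: 'a
  have m: "Y 1 \<in> borel_measurable M" using measurable_Y by simp
  note [measurable] = m
  show "isCont (\<lambda>\<xi>. cf \<xi> 1) \<xi>"
    unfolding continuous_at_sequentially comp_def
  proof safe
    fix X assume X: "X \<longlonglongrightarrow> \<xi>"
    show "(\<lambda>n. cf (X n) 1) \<longlonglongrightarrow> cf \<xi> 1"
      unfolding cf_eq_integral[OF zero_le_one]
      by (rule integral_dominated_convergence[where w="\<lambda>_. 1"]) (auto intro!: tendsto_intros X)
  qed
qed

end

text \<open>
  If \<open>E (exp (i x / n))\<close> has modulus one, then \<open>x / n\<close> is a.s. constant modulo \<open>2 * pi\<close>; for large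
  \<open>n\<close> this pins down \<open>x\<close>.
\<close>

lemma (in real_distribution) char_norm_1_imp_const:
  assumes "\<And>n::nat. 0 < n \<Longrightarrow> norm (char M (1 / real n)) = 1"
  shows "\<exists>c. AE x in M. x = c"
proof -
  have "\<exists>\<theta>. AE x in M. cos (x / real n - \<theta>) = 1" if n: "0 < n" for n :: nat
  proof -
    \<comment> \<open>After rotation by \<open>- \<theta>\<close> the mean of the cosine equals its
      largest value 1, so \<open>1 - cos\<close> is nonnegative with integral 0.\<close>
    define \<theta> where "\<theta> = Arg (char M (1 / real n))"
    have c: "char M (1 / real n) = cis \<theta>"
      using assms[OF n] rcis_cmod_Arg[of "char M (1 / real n)"] by (simp add: \<theta>_def rcis_def)
    have int: "integrable M (\<lambda>x. iexp (1 / real n * x))" by (rule integrable_iexp) auto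
    have "(CLINT x|M. cis (- \<theta>) * iexp (1 / real n * x)) = cis (- \<theta>) * char M (1 / real n)"
      unfolding char_def using int by simp
    also have "\<dots> = 1" unfolding c by (simp add: cis_mult)
    finally have 1: "(CLINT x|M. cis (- \<theta>) * iexp (1 / real n * x)) = 1" .
    have int2: "integrable M (\<lambda>x. cis (- \<theta>) * iexp (1 / real n * x))"
      using int by (rule integrable_mult_right)
    have cis: "cis (- \<theta>) * iexp (1 / real n * x) = cis (x / real n - \<theta>)" for x
    proof -
      have "iexp (1 / real n * x) = cis (x / real n)" by (simp add: cis_conv_exp)
      then show ?thesis by (simp add: cis_mult)
    qed
    have I: "(LINT x|M. cos (x / real n - \<theta>)) = 1" "integrable M (\<lambda>x. cos (x / real n - \<theta>))"
      using integral_Re[OF int2] integrable_Re[OF int2] 1 unfolding cis by simp_all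
    then have "(LINT x|M. 1 - cos (x / real n - \<theta>)) = 0"
      by (simp add: prob_space del: space_eq_univ)
    then have "AE x in M. 1 - cos (x / real n - \<theta>) = 0"
      using I(2) by (subst (asm) integral_nonneg_eq_0_iff_AE) auto
    then show ?thesis by (intro exI[of _ \<theta>]) auto
  qed
  then have "\<forall>n::nat. \<exists>\<theta>. AE x in M. 0 < n \<longrightarrow> cos (x / real n - \<theta>) = 1"
    by auto
  from choice[OF this] obtain \<theta> where "\<forall>n::nat. AE x in M. 0 < n \<longrightarrow> cos (x / real n - \<theta> n) = 1"
    by blast
  then have ae: "AE x in M. \<forall>n::nat. 0 < n \<longrightarrow> cos (x / real n - \<theta> n) = 1"
    by (simp add: AE_all_countable)
  \<comment> \<open>Any point of the almost sure event can serve as the constant; the rest shows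
    that all other points of the event coincide with it.\<close>
  have "\<exists>c. \<forall>n::nat. 0 < n \<longrightarrow> cos (c / real n - \<theta> n) = 1"
  proof (rule ccontr)
    assume "\<not> ?thesis"
    then have none: "\<not> (\<forall>n::nat. 0 < n \<longrightarrow> cos (c / real n - \<theta> n) = 1)" for c by blast
    have "AE x in M. False" using ae by (rule eventually_mono) (use none in blast)
    then show False by simp
  qed
  then obtain c where c: "\<And>n::nat. 0 < n \<Longrightarrow> cos (c / real n - \<theta> n) = 1" by blast
  have "AE x in M. x = c"
    using ae
  proof (rule eventually_mono)
    fix x assume x: "\<forall>n::nat. 0 < n \<longrightarrow> cos (x / real n - \<theta> n) = 1"
    obtain n :: nat where n: "\<bar>x - c\<bar> < real n" using reals_Archimedean2[of "\<bar>x - c\<bar>"] by blast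
    then have n0: "0 < n" by (cases n) auto
    have "cos (x / real n - \<theta> n) = 1" using x n0 by blast
    then obtain k :: int where "x / real n - \<theta> n = of_int k * 2 * pi" unfolding cos_one_2pi_int by blast
    moreover obtain l :: int where "c / real n - \<theta> n = of_int l * 2 * pi"
      using c[OF n0] unfolding cos_one_2pi_int by blast
    ultimately have k: "x / real n - \<theta> n = of_int k * 2 * pi" "c / real n - \<theta> n = of_int l * 2 * pi" by blast+
    have "(x - c) / real n = of_int (k - l) * 2 * pi" using k by (simp add: diff_divide_distrib algebra_simps)
    moreover have "\<bar>(x - c) / real n\<bar> < 1" using n n0 by simp
    ultimately have "\<bar>real_of_int (k - l)\<bar> * 2 * pi < 1" by (simp only: abs_mult abs_numeral abs_of_pos[OF pi_gt_zero])
    moreover have "\<bar>real_of_int (k - l)\<bar> * 1 \<le> \<bar>real_of_int (k - l)\<bar> * (2 * pi)"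
      using pi_gt3 by (intro mult_left_mono) auto
    ultimately have "\<bar>real_of_int (k - l)\<bar> < 1" by (simp only: mult.assoc mult_1_right)
    then have "k = l" by linarith
    then have "x / real n - \<theta> n = c / real n - \<theta> n" using k by (simp only:)
    then show "x = c" using n0 by simp
  qed
  then show ?thesis by blast
qed

section \<open>From decaying characteristic functions to small ball bounds\<close>

lemma power_le_exp:
  fixes s c :: real
  assumes "0 \<le> s" "0 < c" "0 < (m::nat)"
  shows "s ^ m \<le> (real m / c) ^ m * exp (c * s)"
proof -
  have "c * s / real m \<le> exp (c * s / real m)"
    using exp_ge_add_one_self[of "c * s / real m"] by linarith
  then have "(c * s / real m) ^ m \<le> exp (c * s / real m) ^ m"
    using assms by (intro power_mono) auto
  also have "exp (c * s / real m) ^ m = exp (c * s)"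
    using assms by (simp flip: exp_of_nat_mult)
  finally have "(real m / c) ^ m * (c * s / real m) ^ m \<le> (real m / c) ^ m * exp (c * s)"
    using assms by (intro mult_left_mono) auto
  then show ?thesis using assms by (simp flip: power_mult_distrib)
qed

text \<open>An integrable majorant is all that is needed later. An integer \<open>m\<close> with
  \<open>2 \<le> \<alpha> * real m\<close> turns exponential decay in
  \<open>\<bar>v\<bar> powr \<alpha>\<close> into decay like \<open>1 / v\<^sup>2\<close>; rounding
  the exponent down costs the factor \<open>exp c\<close> in \<open>A\<close>. In the constant, 2
  serves \<open>\<bar>v\<bar> \<le> 1\<close> and \<open>2 * A\<close> the rest.\<close>

lemma stretched_exponential_le:
  fixes \<alpha> p :: real
  assumes "0 < \<alpha>" "0 < p" "p < 1"
  obtains C where "0 < C" "\<And>v. p powr (real (nat \<lfloor>\<bar>v\<bar> powr \<alpha>\<rfloor>)) \<le> C * inverse (1 + v\<^sup>2)"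
proof -
  define c where "c = - ln p"
  have c: "0 < c" using assms by (simp add: c_def)
  define m where "m = nat \<lceil>2 / \<alpha>\<rceil>"
  have m: "0 < m" "2 \<le> \<alpha> * real m"
  proof -
    have "2 / \<alpha> \<le> real m" unfolding m_def by linarith
    then show "2 \<le> \<alpha> * real m" using assms by (simp add: field_simps)
    then show "0 < m" using assms by (cases m) auto
  qed
  define A where "A = exp c * (real m / c) ^ m"
  have A: "0 < A" using c m by (simp add: A_def)
  show ?thesis
  proof (rule that[of "2 + 2 * A"])
    fix v :: real
    let ?n = "real (nat \<lfloor>\<bar>v\<bar> powr \<alpha>\<rfloor>)"
    have p: "p powr ?n = exp (- c * ?n)" using assms by (simp add: powr_def c_def mult.commute)
    show "p powr ?n \<le> (2 + 2 * A) * inverse (1 + v\<^sup>2)"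
    proof (cases "\<bar>v\<bar> \<le> 1")
      case True
      then have "v\<^sup>2 \<le> 1" by (simp add: abs_square_le_1)
      then have "1 \<le> 2 * inverse (1 + v\<^sup>2)" by (simp add: field_simps add_pos_nonneg)
      also have "\<dots> \<le> (2 + 2 * A) * inverse (1 + v\<^sup>2)" using A by (intro mult_right_mono) auto
      finally have "1 \<le> (2 + 2 * A) * inverse (1 + v\<^sup>2)" .
      moreover have "p powr ?n \<le> 1" using p c by simp
      ultimately show ?thesis by linarith
    next
      case False
      then have v: "1 < \<bar>v\<bar>" by simp
      let ?s = "\<bar>v\<bar> powr \<alpha>"
      have "v\<^sup>2 = \<bar>v\<bar> powr 2" using v by (simp add: powr_numeral)
      also have "\<dots> \<le> \<bar>v\<bar> powr (\<alpha> * real m)" using v m by (intro powr_mono) auto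
      also have "\<dots> = ?s ^ m" by (subst powr_realpow[symmetric]) (use v in \<open>auto simp: powr_powr\<close>)
      also have "\<dots> \<le> (real m / c) ^ m * exp (c * ?s)" using c m by (intro power_le_exp) auto
      finally have v2: "v\<^sup>2 * exp (- c * ?s) \<le> (real m / c) ^ m"
        by (simp add: exp_minus field_simps)
      have "1 \<le> v\<^sup>2" using one_le_power[of "\<bar>v\<bar>" 2] v by simp
      then have "p powr ?n * (1 + v\<^sup>2) \<le> p powr ?n * (2 * v\<^sup>2)"
        by (intro mult_left_mono) auto
      also have "\<dots> \<le> (exp c * exp (- c * ?s)) * (2 * v\<^sup>2)"
      proof (rule mult_right_mono)
        have "?s - 1 \<le> ?n" by linarith
        then have "c * (?s - 1) \<le> c * ?n" using c by (intro mult_left_mono) auto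
        then show "p powr ?n \<le> exp c * exp (- c * ?s)" unfolding p exp_add[symmetric] by (simp add: algebra_simps)
      qed simp
      also have "\<dots> = 2 * exp c * (v\<^sup>2 * exp (- c * ?s))" by simp
      also have "\<dots> \<le> 2 * exp c * (real m / c) ^ m" using v2 by (intro mult_left_mono) auto
      also have "\<dots> \<le> 2 + 2 * A" by (simp add: A_def)
      finally show ?thesis by (simp add: field_simps add_pos_nonneg)
    qed
  qed (use A in simp)
qed

lemma nn_integral_inverse_1_plus_square_finite:
  "(\<integral>\<^sup>+ x. ennreal (inverse (1 + x\<^sup>2)) \<partial>lborel) < \<infinity>"
proof -
  have "integrable lborel (\<lambda>x::real. inverse (1 + x\<^sup>2))"
    using integrable_inverse_1_plus_square by (simp add: set_integrable_def)
  then show ?thesis by (simp add: integrable_iff_bounded)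
qed

text \<open>The Gaussian density is at most 1, and a substitution does the rest. The factor
  \<open>\<rho>\<close> gained here in every coordinate is the source of the power of
  \<open>\<rho>\<close> in the small ball bounds.\<close>

lemma nn_integral_std_normal_scaled_le:
  assumes [measurable]: "g \<in> borel_measurable borel" and "0 < \<rho>"
  shows "(\<integral>\<^sup>+ x. ennreal (g (x / \<rho>)) \<partial>std_normal_distribution) \<le> ennreal \<rho> * (\<integral>\<^sup>+ x. ennreal (g x) \<partial>lborel)"
proof -
  have le1: "std_normal_density x \<le> 1" for x
  proof -
    have "1 \<le> sqrt (2 * pi)" using pi_gt3 by simp
    then have "1 / sqrt (2 * pi) * exp (- x\<^sup>2 / 2) \<le> 1 * 1"
      by (intro mult_mono) (auto simp: divide_le_eq_1)
    then show ?thesis by (simp add: std_normal_density_def)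
  qed
  have "(\<integral>\<^sup>+ x. ennreal (g (x / \<rho>)) \<partial>std_normal_distribution)
    = (\<integral>\<^sup>+ x. ennreal (std_normal_density x) * ennreal (g (x / \<rho>)) \<partial>lborel)"
    by (intro nn_integral_density) auto
  also have "\<dots> \<le> (\<integral>\<^sup>+ x. 1 * ennreal (g (x / \<rho>)) \<partial>lborel)"
    using le1 by (intro nn_integral_mono mult_right_mono) (auto simp flip: ennreal_1 intro: ennreal_leI)
  also have "\<dots> = (\<integral>\<^sup>+ x. ennreal (g (x / \<rho>)) \<partial>lborel)" by simp
  also have "\<dots> = ennreal \<rho> * (\<integral>\<^sup>+ x. ennreal (g x) \<partial>lborel)"
    using assms by (subst nn_integral_real_affine[where c = \<rho> and t = 0]) auto
  finally show ?thesis .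
qed

lemma norm_sum_orthonormal_ge:
  fixes B :: "'a::euclidean_space set"
  assumes "finite B" "pairwise orthogonal B" "\<And>b. b \<in> B \<Longrightarrow> norm b = 1" "b \<in> B"
  shows "\<bar>x b\<bar> \<le> norm (\<Sum>b\<in>B. x b *\<^sub>R b)"
proof -
  have "(\<Sum>c\<in>B. x c *\<^sub>R c) \<bullet> b = (\<Sum>c\<in>B. x c * (c \<bullet> b))" by (simp add: inner_sum_left)
  also have "\<dots> = (\<Sum>c\<in>B. if c = b then x b else 0)"
  proof (rule sum.cong)
    fix c assume "c \<in> B"
    then show "x c * (c \<bullet> b) = (if c = b then x b else 0)"
      using assms by (cases "c = b") (auto simp: pairwise_def orthogonal_def dot_square_norm)
  qed simp
  also have "\<dots> = x b" using assms by simp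
  finally have "\<bar>x b\<bar> = \<bar>(\<Sum>c\<in>B. x c *\<^sub>R c) \<bullet> b\<bar>" by simp
  also have "\<dots> \<le> norm (\<Sum>c\<in>B. x c *\<^sub>R c) * norm b" by (rule Cauchy_Schwarz_ineq2)
  finally show ?thesis using assms by simp
qed

text \<open>
  A Gaussian bump dominates the indicator of a ball, and it is itself the characteristic function of
  a Gaussian vector; by Fubini, small balls are controlled by the decay of the characteristic
  function of \<open>Y\<close>.
\<close>

lemma (in prob_space) small_ball_le_char:
  fixes Z :: "'a \<Rightarrow> 'b::euclidean_space"
  assumes [measurable]: "Z \<in> borel_measurable M"
    and B: "finite B" "pairwise orthogonal B" "\<And>b. b \<in> B \<Longrightarrow> norm b = 1"
    and g: "g \<in> borel_measurable borel" "\<And>v. 0 \<le> g v" and K: "(\<integral>\<^sup>+ v. ennreal (g v) \<partial>lborel) \<le> ennreal K" "0 \<le> K"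
    and decay: "\<And>x. norm (CLINT \<omega>|M. iexp ((\<Sum>b\<in>B. x b *\<^sub>R b) \<bullet> Z \<omega>)) \<le> (\<Prod>b\<in>B. g (x b))"
    and "0 < \<rho>"
  shows "prob {\<omega>\<in>space M. norm (Z \<omega>) \<le> \<rho>} \<le> (2 * K * \<rho>) ^ card B"
proof -
  let ?N = std_normal_distribution
  interpret N: real_distribution ?N by (rule real_dist_normal_dist)
  interpret P: product_prob_space "\<lambda>_. ?N" B
    by standard
  interpret PP: prob_space "Pi\<^sub>M B (\<lambda>_. ?N)" by (rule prob_space_PiM) (rule N.prob_space_axioms)
  interpret MP: pair_prob_space M "Pi\<^sub>M B (\<lambda>_. ?N)" ..
  note [measurable] = g(1)
  \<comment> \<open>\<open>x\<close> will be a standard Gaussian vector; divided by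
    \<open>\<rho>\<close> it tests \<open>Z\<close> on the ball of radius
    \<open>\<rho>\<close>.\<close>
  define \<Phi> where "\<Phi> x \<omega> = iexp ((\<Sum>b\<in>B. (x b / \<rho>) *\<^sub>R b) \<bullet> Z \<omega>)" for x \<omega>
  have \<Phi>_meas [measurable]: "(\<lambda>(\<omega>, x). \<Phi> x \<omega>) \<in> borel_measurable (M \<Otimes>\<^sub>M Pi\<^sub>M B (\<lambda>_. ?N))"
    unfolding \<Phi>_def by measurable
  have gauss: "(CLINT x|Pi\<^sub>M B (\<lambda>_. ?N). \<Phi> x \<omega>) = complex_of_real (\<Prod>b\<in>B. exp (- ((b \<bullet> Z \<omega>) / \<rho>)\<^sup>2 / 2))" for \<omega>
  proof -
    have "\<Phi> x \<omega> = (\<Prod>b\<in>B. iexp ((b \<bullet> Z \<omega>) / \<rho> * x b))" for x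
    proof -
      have "\<i> * complex_of_real ((\<Sum>b\<in>B. (x b / \<rho>) *\<^sub>R b) \<bullet> Z \<omega>) = (\<Sum>b\<in>B. \<i> * complex_of_real ((b \<bullet> Z \<omega>) / \<rho> * x b))"
        by (simp add: inner_sum_left sum_distrib_left mult_ac)
      then show ?thesis unfolding \<Phi>_def by (simp only: exp_sum[OF B(1)])
    qed
    then have "(CLINT x|Pi\<^sub>M B (\<lambda>_. ?N). \<Phi> x \<omega>) = (CLINT x|Pi\<^sub>M B (\<lambda>_. ?N). (\<Prod>b\<in>B. iexp ((b \<bullet> Z \<omega>) / \<rho> * x b)))"
      by simp
    also have "\<dots> = (\<Prod>b\<in>B. CLINT x|?N. iexp ((b \<bullet> Z \<omega>) / \<rho> * x))"
      by (intro P.product_integral_prod B(1) N.integrable_iexp) auto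
    also have "\<dots> = (\<Prod>b\<in>B. char ?N ((b \<bullet> Z \<omega>) / \<rho>))" by (simp only: char_def)
    finally show ?thesis by (simp add: char_std_normal_distribution)
  qed
  have \<Phi>_int: "integrable (M \<Otimes>\<^sub>M Pi\<^sub>M B (\<lambda>_. ?N)) (\<lambda>(\<omega>, x). \<Phi> x \<omega>)"
    by (rule MP.integrable_const_bound[where B = 1]) (auto simp: \<Phi>_def)
  let ?E = "\<lambda>\<omega>. \<Prod>b\<in>B. exp (- ((b \<bullet> Z \<omega>) / \<rho>)\<^sup>2 / 2)"
  have E01: "0 \<le> ?E \<omega>" "?E \<omega> \<le> 1" for \<omega> by (auto intro!: prod_nonneg prod_le_1)
  have E_int: "integrable M ?E"
    by (rule integrable_const_bound[where B = 1]) (use E01 in auto)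
  have E_nonneg: "0 \<le> (LINT \<omega>|M. ?E \<omega>)"
    by (rule Bochner_Integration.integral_nonneg) (rule E01)
  have "(LINT \<omega>|M. ?E \<omega>) = norm (CLINT \<omega>|M. complex_of_real (?E \<omega>))"
    by (simp only: integral_complex_of_real norm_of_real abs_of_nonneg[OF E_nonneg])
  also have "(CLINT \<omega>|M. complex_of_real (?E \<omega>)) = (CLINT \<omega>|M. CLINT x|Pi\<^sub>M B (\<lambda>_. ?N). \<Phi> x \<omega>)"
    by (simp only: gauss)
  also have "\<dots> = (CLINT x|Pi\<^sub>M B (\<lambda>_. ?N). CLINT \<omega>|M. \<Phi> x \<omega>)"
    by (rule MP.Fubini_integral[symmetric]) (rule \<Phi>_int)
  also have "ennreal (norm \<dots>) \<le> (\<integral>\<^sup>+ x. ennreal (norm (CLINT \<omega>|M. \<Phi> x \<omega>)) \<partial>Pi\<^sub>M B (\<lambda>_. ?N))"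
    by (rule integral_norm_bound_ennreal) (use MP.integrable_snd[OF \<Phi>_int] in simp)
  also have "\<dots> \<le> (\<integral>\<^sup>+ x. (\<Prod>b\<in>B. ennreal (g (x b / \<rho>))) \<partial>Pi\<^sub>M B (\<lambda>_. ?N))"
    using decay[of "\<lambda>b. _ b / \<rho>"] g(2) unfolding \<Phi>_def
    by (intro nn_integral_mono) (simp add: prod_ennreal ennreal_leI)
  also have "\<dots> = (\<Prod>b\<in>B. \<integral>\<^sup>+ x. ennreal (g (x / \<rho>)) \<partial>?N)"
    by (rule P.product_nn_integral_prod) (use B in auto)
  also have "\<dots> \<le> (\<Prod>b\<in>B. ennreal (\<rho> * K))"
  proof (rule prod_mono_ennreal)
    have "(\<integral>\<^sup>+ x. ennreal (g (x / \<rho>)) \<partial>?N) \<le> ennreal \<rho> * (\<integral>\<^sup>+ x. ennreal (g x) \<partial>lborel)"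
      by (rule nn_integral_std_normal_scaled_le) (use g \<open>0 < \<rho>\<close> in auto)
    also have "\<dots> \<le> ennreal \<rho> * ennreal K" by (intro mult_left_mono K) simp
    finally show "(\<integral>\<^sup>+ x. ennreal (g (x / \<rho>)) \<partial>?N) \<le> ennreal (\<rho> * K)"
      using \<open>0 < \<rho>\<close> K by (simp add: ennreal_mult)
  qed
  also have "\<dots> = ennreal ((\<rho> * K) ^ card B)" using \<open>0 < \<rho>\<close> K by (simp add: ennreal_power)
  finally have I: "(LINT \<omega>|M. ?E \<omega>) \<le> (\<rho> * K) ^ card B"
    using \<open>0 < \<rho>\<close> K by (subst (asm) ennreal_le_iff) auto
  \<comment> \<open>On the ball every coordinate of \<open>Z \<omega>\<close> is at most
    \<open>\<rho>\<close> in modulus, so each Gaussian factor is at least \<open>1 - 1/2\<close>.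
    This is the factor 2 per coordinate in the conclusion.\<close>
  have ind: "(1/2) ^ card B * indicator {\<omega>\<in>space M. norm (Z \<omega>) \<le> \<rho>} \<omega> \<le> ?E \<omega>" for \<omega>
  proof (cases "\<omega> \<in> {\<omega>\<in>space M. norm (Z \<omega>) \<le> \<rho>}")
    case True
    have "(1/2) ^ card B = (\<Prod>b\<in>B. 1/2::real)" by simp
    also have "\<dots> \<le> ?E \<omega>"
    proof (rule prod_mono, safe)
      fix b assume b: "b \<in> B"
      have "\<bar>b \<bullet> Z \<omega>\<bar> \<le> norm b * norm (Z \<omega>)" by (rule Cauchy_Schwarz_ineq2)
      then have "\<bar>(b \<bullet> Z \<omega>) / \<rho>\<bar> \<le> 1" using B(3)[OF b] True \<open>0 < \<rho>\<close> by simp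
      then have "((b \<bullet> Z \<omega>) / \<rho>)\<^sup>2 \<le> 1" by (simp only: abs_square_le_1)
      then have "1/2 \<le> 1 + (- ((b \<bullet> Z \<omega>) / \<rho>)\<^sup>2 / 2)" by simp
      also have "\<dots> \<le> exp (- ((b \<bullet> Z \<omega>) / \<rho>)\<^sup>2 / 2)" by (rule exp_ge_add_one_self)
      finally show "1/2 \<le> exp (- ((b \<bullet> Z \<omega>) / \<rho>)\<^sup>2 / 2)" .
    qed simp
    finally show ?thesis using True by simp
  qed (use E01 in simp)
  have "(1/2) ^ card B * prob {\<omega>\<in>space M. norm (Z \<omega>) \<le> \<rho>} = (LINT \<omega>|M. (1/2) ^ card B * indicator {\<omega>\<in>space M. norm (Z \<omega>) \<le> \<rho>} \<omega>)"
    by simp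
  also have "\<dots> \<le> (LINT \<omega>|M. ?E \<omega>)"
    by (rule integral_mono[OF _ E_int ind])
      (intro integrable_mult_right integrable_real_indicator, auto simp: less_top[symmetric])
  also note I
  finally have "2 ^ card B * ((1/2) ^ card B * prob {\<omega>\<in>space M. norm (Z \<omega>) \<le> \<rho>}) \<le> 2 ^ card B * (\<rho> * K) ^ card B"
    by (intro mult_left_mono) auto
  then show ?thesis by (simp add: power_one_over power_mult_distrib mult_ac)
qed

context stable_motion
begin

text \<open>With \<open>c = (1 / real n) powr \<alpha>\<close> the value at \<open>\<xi> / n\<close>
  equals \<open>cf \<xi> c\<close>, a factor of
  \<open>cf \<xi> 1 = cf \<xi> c * cf \<xi> (1 - c)\<close>. If a product of factors of modulus at
  most 1 has modulus 1, so has each factor; thus \<open>char_norm_1_imp_const\<close>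
  applies.\<close>

lemma cf_norm_1_imp_const:
  assumes "norm (cf \<xi> 1) = 1"
  shows "\<exists>c. AE \<omega> in M. \<xi> \<bullet> Y 1 \<omega> = c"
proof -
  have m: "Y 1 \<in> borel_measurable M" using measurable_Y by auto
  note [measurable] = m
  interpret D: real_distribution "distr M borel (\<lambda>\<omega>. \<xi> \<bullet> Y 1 \<omega>)"
    by (rule real_distribution_distr) simp
  have "norm (char (distr M borel (\<lambda>\<omega>. \<xi> \<bullet> Y 1 \<omega>)) (1 / real n)) = 1" if n: "0 < n" for n :: nat
  proof -
    have "char (distr M borel (\<lambda>\<omega>. \<xi> \<bullet> Y 1 \<omega>)) (1 / real n) = cf ((1 / real n) *\<^sub>R \<xi>) 1"
      unfolding char_def by (simp add: cf_eq_integral integral_distr)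
    also have "norm \<dots> = 1"
    proof (cases "n = 1")
      case True
      then show ?thesis using assms by simp
    next
      case False
      define c where "c = (1 / real n) powr \<alpha>"
      have "1 / real n < 1" using n False by simp
      then have c: "0 < c" "c < 1" using n index_pos powr_less_mono2[of \<alpha> "1 / real n" 1] by (auto simp: c_def)
      have "c powr (1 / \<alpha>) = 1 / real n" using n index_pos by (simp add: c_def powr_powr)
      then have "cf ((1 / real n) *\<^sub>R \<xi>) 1 = cf \<xi> c" using cf_scale[of c 1 \<xi>] c by simp
      moreover have "cf \<xi> 1 = cf \<xi> c * cf \<xi> (1 - c)" using cf_add[of c "1 - c" \<xi>] c by simp
      then have "1 = norm (cf \<xi> c) * norm (cf \<xi> (1 - c))" using assms by (simp add: norm_mult)
      moreover have "norm (cf \<xi> c) \<le> 1" "norm (cf \<xi> (1 - c)) \<le> 1" using norm_cf_le_1 c by auto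
      moreover have "norm (cf \<xi> c) * norm (cf \<xi> (1 - c)) \<le> norm (cf \<xi> c) * 1"
        using calculation(4) by (intro mult_left_mono) auto
      ultimately show ?thesis by simp
    qed
    finally show ?thesis .
  qed
  then obtain c where "AE x in distr M borel (\<lambda>\<omega>. \<xi> \<bullet> Y 1 \<omega>). x = c"
    using D.char_norm_1_imp_const by blast
  then have "AE \<omega> in M. \<xi> \<bullet> Y 1 \<omega> = c"
    by (subst (asm) AE_distr_iff) auto
  then show ?thesis by blast
qed

text \<open>Scaling exchanges length for time: \<open>cf u 1\<close> is the value at the unit vector
  \<open>u /\<^sub>R norm u\<close> after time \<open>norm u powr \<alpha>\<close>.\<close>

lemma norm_cf_le_power_radial:
  assumes "u \<noteq> 0"
  shows "norm (cf u 1) \<le> norm (cf (u /\<^sub>R norm u) 1) ^ nat \<lfloor>norm u powr \<alpha>\<rfloor>"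
proof -
  let ?s = "norm u"
  have s: "0 < ?s" using assms by simp
  have "(?s powr \<alpha>) powr (1 / \<alpha>) = ?s" using s index_pos by (simp add: powr_powr)
  then have "cf (u /\<^sub>R ?s) (?s powr \<alpha> * 1) = cf (?s *\<^sub>R (u /\<^sub>R ?s)) 1"
    using cf_scale[of "?s powr \<alpha>" 1 "u /\<^sub>R ?s"] s by simp
  also have "?s *\<^sub>R (u /\<^sub>R ?s) = u" using s by simp
  finally have "cf u 1 = cf (u /\<^sub>R ?s) (?s powr \<alpha>)" by simp
  moreover have "real (nat \<lfloor>?s powr \<alpha>\<rfloor>) \<le> ?s powr \<alpha>" by simp
  ultimately show ?thesis using norm_cf_le_power by metis
qed

text \<open>Continuity on the compact unit sphere of \<open>V\<close> gives a uniform
  \<open>q\<close>, and scaling along rays extends the bound to \<open>V\<close>. The lower cap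
  \<open>1/2\<close> keeps \<open>q\<close> positive, as needed when its powers are rewritten with
  \<open>powr\<close>.\<close>

lemma cf_decay_on_subspace:
  assumes V: "subspace V" and nondeg: "\<And>u. u \<in> V \<Longrightarrow> norm u = 1 \<Longrightarrow> norm (cf u 1) < 1"
  obtains q where "0 < q" "q < 1" "\<And>u. u \<in> V \<Longrightarrow> norm (cf u 1) \<le> q ^ nat \<lfloor>norm u powr \<alpha>\<rfloor>"
proof -
  define S where "S = V \<inter> sphere 0 1"
  have comp: "compact S" unfolding S_def using closed_subspace[OF V] by (simp add: closed_Int_compact)
  have "\<exists>q. 0 < q \<and> q < 1 \<and> (\<forall>u\<in>S. norm (cf u 1) \<le> q)"
  proof (cases "S = {}")
    case True
    then show ?thesis by (intro exI[of _ "1/2"]) auto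
  next
    case False
    have "continuous_on S (\<lambda>u. norm (cf u 1))"
      by (intro continuous_on_norm continuous_on_subset[OF cf_continuous]) auto
    from continuous_attains_sup[OF comp False this] obtain u
      where u: "u \<in> S" "\<And>v. v \<in> S \<Longrightarrow> norm (cf v 1) \<le> norm (cf u 1)" by blast
    have "norm (cf u 1) < 1" using nondeg u(1) by (auto simp: S_def)
    then show ?thesis using u(2) by (intro exI[of _ "max (1/2) (norm (cf u 1))"]) (auto simp: le_max_iff_disj)
  qed
  then obtain q where q: "0 < q" "q < 1" "\<And>u. u \<in> S \<Longrightarrow> norm (cf u 1) \<le> q" by blast
  show ?thesis
  proof (rule that[OF q(1,2)])
    fix u assume u: "u \<in> V"
    show "norm (cf u 1) \<le> q ^ nat \<lfloor>norm u powr \<alpha>\<rfloor>"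
    proof (cases "u = 0")
      case True
      then show ?thesis using norm_cf_le_1[of 1 u] by simp
    next
      case False
      have "u /\<^sub>R norm u \<in> S" using False u V by (simp add: S_def subspace_scale)
      then have "norm (cf (u /\<^sub>R norm u) 1) \<le> q" by (rule q(3))
      then have "norm (cf (u /\<^sub>R norm u) 1) ^ nat \<lfloor>norm u powr \<alpha>\<rfloor> \<le> q ^ nat \<lfloor>norm u powr \<alpha>\<rfloor>"
        by (intro power_mono) auto
      then show ?thesis using norm_cf_le_power_radial[OF False] by linarith
    qed
  qed
qed

lemma small_ball_on_subspace:
  assumes V: "subspace V" and nondeg: "\<And>u. u \<in> V \<Longrightarrow> norm u = 1 \<Longrightarrow> norm (cf u 1) < 1"
  obtains K where "0 \<le> K" "\<And>\<rho>. 0 < \<rho> \<Longrightarrow> prob {\<omega>\<in>space M. norm (Y 1 \<omega>) \<le> \<rho>} \<le> (K * \<rho>) ^ dim V"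
proof -
  obtain q where q: "0 < q" "q < 1" "\<And>u. u \<in> V \<Longrightarrow> norm (cf u 1) \<le> q ^ nat \<lfloor>norm u powr \<alpha>\<rfloor>"
    using cf_decay_on_subspace[OF assms] by blast
  obtain B where B: "B \<subseteq> V" "pairwise orthogonal B" "\<And>b. b \<in> B \<Longrightarrow> norm b = 1" "independent B"
    "card B = dim V" "span B = V" using orthonormal_basis_subspace[OF V] by metis
  have finB: "finite B" using B(4) by (rule independent_imp_finite)
  \<comment> \<open>Decay in \<open>norm u\<close> has to become a product over coordinates. No
    coordinate exceeds \<open>norm u\<close>, so the average of the coordinate exponents is at most
    the exponent at \<open>norm u\<close>; splitting \<open>q\<close> into \<open>card B\<close>
    equal factors \<open>p\<close> realises this average.\<close>
  define p where "p = q powr (1 / real (card B))"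
  show ?thesis
  proof (cases "B = {}")
    case True
    then have "dim V = 0" using B(5) by simp
    then show ?thesis by (intro that[of 0]) (auto simp del: dim_eq_0)
  next
    case False
    then have k: "0 < card B" using finB by (simp add: card_gt_0_iff)
    have p: "0 < p" "p < 1"
      using q k powr_less_mono2[of "1 / real (card B)" q 1] by (auto simp: p_def)
    obtain C where C: "0 < C" "\<And>v. p powr (real (nat \<lfloor>\<bar>v\<bar> powr \<alpha>\<rfloor>)) \<le> C * inverse (1 + v\<^sup>2)"
      using stretched_exponential_le[OF index_pos p] by blast
    define g where "g v = p powr (real (nat \<lfloor>\<bar>v\<bar> powr \<alpha>\<rfloor>))" for v
    have g_meas: "g \<in> borel_measurable borel" unfolding g_def by measurable
    define I where "I = enn2real (\<integral>\<^sup>+ x. ennreal (inverse (1 + x\<^sup>2)) \<partial>lborel)"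
    have I: "0 \<le> I" "(\<integral>\<^sup>+ x. ennreal (inverse (1 + x\<^sup>2)) \<partial>lborel) = ennreal I"
      using nn_integral_inverse_1_plus_square_finite by (auto simp: I_def)
    have gK: "(\<integral>\<^sup>+ v. ennreal (g v) \<partial>lborel) \<le> ennreal (C * I)"
    proof -
      have "(\<integral>\<^sup>+ v. ennreal (g v) \<partial>lborel) \<le> (\<integral>\<^sup>+ v. ennreal C * ennreal (inverse (1 + v\<^sup>2)) \<partial>lborel)"
        using C by (intro nn_integral_mono) (auto simp: g_def simp flip: ennreal_mult intro!: ennreal_leI)
      also have "\<dots> = ennreal C * (\<integral>\<^sup>+ v. ennreal (inverse (1 + v\<^sup>2)) \<partial>lborel)"
        by (rule nn_integral_cmult) simp
      also have "\<dots> = ennreal (C * I)" using C(1) I by (simp add: ennreal_mult)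
      finally show ?thesis .
    qed
    have decay: "norm (CLINT \<omega>|M. iexp ((\<Sum>b\<in>B. x b *\<^sub>R b) \<bullet> Y 1 \<omega>)) \<le> (\<Prod>b\<in>B. g (x b))" for x
    proof -
      let ?u = "\<Sum>b\<in>B. x b *\<^sub>R b"
      let ?n = "\<lambda>v. nat \<lfloor>\<bar>v\<bar> powr \<alpha>\<rfloor>"
      have "?u \<in> V" unfolding B(6)[symmetric] by (intro span_sum span_scale span_base)
      then have "norm (cf ?u 1) \<le> q ^ ?n (norm ?u)" using q(3)[of ?u] by simp
      also have "\<dots> = q powr real (?n (norm ?u))" by (rule powr_realpow[OF q(1), symmetric])
      also have "\<dots> \<le> q powr (\<Sum>b\<in>B. 1 / real (card B) * real (?n (x b)))"
      proof (rule powr_mono')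
        have "(\<Sum>b\<in>B. 1 / real (card B) * real (?n (x b))) \<le> (\<Sum>b\<in>B. 1 / real (card B) * real (?n (norm ?u)))"
        proof (intro sum_mono mult_left_mono of_nat_mono nat_mono floor_mono powr_mono2)
          fix b assume "b \<in> B"
          then show "\<bar>x b\<bar> \<le> \<bar>norm ?u\<bar>" using norm_sum_orthonormal_ge[OF finB B(2,3)] by simp
        qed (use index_pos in auto)
        then show "(\<Sum>b\<in>B. 1 / real (card B) * real (?n (x b))) \<le> real (?n (norm ?u))" using k by simp
      qed (use q in auto)
      also have "\<dots> = (\<Prod>b\<in>B. q powr (1 / real (card B) * real (?n (x b))))"
        using q by (simp only: powr_sum)
      also have "\<dots> = (\<Prod>b\<in>B. g (x b))" by (simp add: g_def p_def powr_powr)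
      finally show ?thesis by (simp add: cf_eq_integral)
    qed
    have "prob {\<omega>\<in>space M. norm (Y 1 \<omega>) \<le> \<rho>} \<le> (2 * (C * I) * \<rho>) ^ card B" if "0 < \<rho>" for \<rho>
      by (rule small_ball_le_char[OF _ finB B(2,3) g_meas _ gK _ decay that])
        (use measurable_Y C I in \<open>auto simp: g_def\<close>)
    then show ?thesis using C I B(5) by (intro that[of "2 * (C * I)"]) auto
  qed
qed

text \<open>
  If a component of \<open>Y 1\<close> is a nonzero constant (a drift, which is possible only for \<open>\<alpha> = 1\<close>), then
  \<open>norm (Y 1)\<close> is bounded away from \<open>0\<close>. Otherwise \<open>Y 1\<close> lives on the orthogonal complement of the
  directions in which it vanishes, and its characteristic function decays on that subspace.
\<close>

lemma small_ball:
  assumes nc: "not_confined M \<alpha> Y" and \<gamma>: "0 \<le> \<gamma>" "\<gamma> \<le> min (real DIM('a)) \<alpha>"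
  obtains C where "0 \<le> C" "\<And>\<rho>. 0 < \<rho> \<Longrightarrow> prob {\<omega>\<in>space M. norm (Y 1 \<omega>) \<le> \<rho>} \<le> C * \<rho> powr \<gamma>"
proof (cases "\<exists>\<xi> c. (AE \<omega> in M. \<xi> \<bullet> Y 1 \<omega> = c) \<and> c \<noteq> 0")
  case True
  then obtain \<xi> c where \<xi>: "AE \<omega> in M. \<xi> \<bullet> Y 1 \<omega> = c" "c \<noteq> 0" by blast
  have m: "Y 1 \<in> borel_measurable M" using measurable_Y by auto
  note [measurable] = m
  have "norm \<xi> \<noteq> 0" using \<xi> by auto
  then have n\<xi>: "0 < norm \<xi>" by simp
  \<comment> \<open>By Cauchy-Schwarz \<open>norm (Y 1 \<omega>)\<close> is almost surely at least
    \<open>r\<close>; for radii from \<open>r\<close> on, the constant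
    \<open>(1 / r) powr \<gamma>\<close> makes the bound at least 1.\<close>
  define r where "r = \<bar>c\<bar> / norm \<xi>"
  have r: "0 < r" using \<xi>(2) n\<xi> by (simp add: r_def)
  show ?thesis
  proof (rule that[of "(1 / r) powr \<gamma>"])
    fix \<rho> :: real assume \<rho>: "0 < \<rho>"
    show "prob {\<omega>\<in>space M. norm (Y 1 \<omega>) \<le> \<rho>} \<le> (1 / r) powr \<gamma> * \<rho> powr \<gamma>"
    proof (cases "\<rho> < r")
      case True
      have "AE \<omega> in M. \<not> norm (Y 1 \<omega>) \<le> \<rho>"
        using \<xi>(1)
      proof eventually_elim
        case (elim \<omega>)
        have "\<bar>c\<bar> \<le> norm \<xi> * norm (Y 1 \<omega>)" using Cauchy_Schwarz_ineq2[of \<xi> "Y 1 \<omega>"] elim by simp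
        then have "r \<le> norm (Y 1 \<omega>)" using n\<xi> by (simp add: r_def field_simps)
        then show ?case using True by simp
      qed
      then have "prob {\<omega>\<in>space M. norm (Y 1 \<omega>) \<le> \<rho>} = 0" by (subst prob_eq_0) auto
      then show ?thesis by simp
    next
      case False
      then have "1 \<le> (\<rho> / r) powr \<gamma>" using r \<gamma> by (intro ge_one_powr_ge_zero) auto
      also have "\<dots> = (1 / r) powr \<gamma> * \<rho> powr \<gamma>" using r \<rho> by (simp flip: powr_mult)
      finally show ?thesis using prob_le_1 order_trans by blast
    qed
  qed simp
next
  case False
  then have zero: "\<And>\<xi> c. AE \<omega> in M. \<xi> \<bullet> Y 1 \<omega> = c \<Longrightarrow> c = 0" by blast
  define V0 where "V0 = {\<xi>. AE \<omega> in M. \<xi> \<bullet> Y 1 \<omega> = 0}"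
  have V0: "subspace V0"
  proof (rule subspaceI)
    show "0 \<in> V0" by (simp add: V0_def)
    show "x + y \<in> V0" if "x \<in> V0" "y \<in> V0" for x y
    proof -
      have "AE \<omega> in M. x \<bullet> Y 1 \<omega> = 0" "AE \<omega> in M. y \<bullet> Y 1 \<omega> = 0" using that by (auto simp: V0_def)
      then have "AE \<omega> in M. (x + y) \<bullet> Y 1 \<omega> = 0" by eventually_elim (simp add: inner_add_left)
      then show ?thesis by (simp add: V0_def)
    qed
    show "c *\<^sub>R x \<in> V0" if "x \<in> V0" for c x
    proof -
      have "AE \<omega> in M. x \<bullet> Y 1 \<omega> = 0" using that by (auto simp: V0_def)
      then have "AE \<omega> in M. (c *\<^sub>R x) \<bullet> Y 1 \<omega> = 0" by eventually_elim simp
      then show ?thesis by (simp add: V0_def)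
    qed
  qed
  define V where "V = V0\<^sup>\<bottom>"
  have V: "subspace V" unfolding V_def by (rule subspace_orthogonal_comp)
  obtain B where B: "B \<subseteq> V0" "independent B" "V0 \<subseteq> span B" "card B = dim V0"
    by (rule basis_exists)
  have finB: "finite B" using B(2) by (rule independent_imp_finite)
  have "AE \<omega> in M. \<forall>b\<in>B. b \<bullet> Y 1 \<omega> = 0"
    using B(1) by (intro AE_finite_allI finB) (auto simp: V0_def)
  then have "AE \<omega> in M. Y 1 \<omega> \<in> V"
  proof eventually_elim
    case (elim \<omega>)
    have "orthogonal (Y 1 \<omega>) \<xi>" if "\<xi> \<in> span B" for \<xi>
      by (rule orthogonal_to_span[OF that]) (use elim in \<open>auto simp: orthogonal_def inner_commute\<close>)
    then show ?case using B(3) unfolding V_def orthogonal_comp_def by (auto simp: orthogonal_commute)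
  qed
  then have dimV: "min (real DIM('a)) \<alpha> \<le> real (dim V)"
    using nc V unfolding not_confined_def by blast
  have nondeg: "norm (cf u 1) < 1" if u: "u \<in> V" "norm u = 1" for u
  proof (rule ccontr)
    assume "\<not> norm (cf u 1) < 1"
    then have "norm (cf u 1) = 1" using norm_cf_le_1[of 1 u] by simp
    then obtain c where c: "AE \<omega> in M. u \<bullet> Y 1 \<omega> = c" using cf_norm_1_imp_const by blast
    then have "u \<in> V0" using zero[OF c] by (simp add: V0_def)
    then have "u \<bullet> u = 0" using u(1) by (auto simp: V_def orthogonal_comp_def orthogonal_def)
    then show False using u(2) by simp
  qed
  obtain K where K: "0 \<le> K" "\<And>\<rho>. 0 < \<rho> \<Longrightarrow> prob {\<omega>\<in>space M. norm (Y 1 \<omega>) \<le> \<rho>} \<le> (K * \<rho>) ^ dim V"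
    using small_ball_on_subspace[OF V nondeg] by blast
  show ?thesis
  \<comment> \<open>The 1 covers \<open>\<rho> > 1\<close>, where the bound is trivial. For
    \<open>\<rho> \<le> 1\<close> the exponent \<open>dim V\<close> may be lowered to
    \<open>\<gamma>\<close>, and non-confinement yields \<open>\<gamma> \<le> dim V\<close>.\<close>
  proof (rule that[of "max 1 (K ^ dim V)"])
    fix \<rho> :: real assume \<rho>: "0 < \<rho>"
    show "prob {\<omega>\<in>space M. norm (Y 1 \<omega>) \<le> \<rho>} \<le> max 1 (K ^ dim V) * \<rho> powr \<gamma>"
    proof (cases "\<rho> \<le> 1")
      case True
      have "prob {\<omega>\<in>space M. norm (Y 1 \<omega>) \<le> \<rho>} \<le> K ^ dim V * \<rho> powr real (dim V)"
        using K(2)[OF \<rho>] \<rho> by (simp add: power_mult_distrib powr_realpow)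
      also have "\<dots> \<le> max 1 (K ^ dim V) * \<rho> powr \<gamma>"
        using \<rho> True dimV \<gamma> by (intro mult_mono powr_mono') auto
      finally show ?thesis .
    next
      case False
      then have "1 * 1 \<le> max 1 (K ^ dim V) * \<rho> powr \<gamma>"
        using \<gamma> by (intro mult_mono ge_one_powr_ge_zero) auto
      then show ?thesis using prob_le_1 order_trans by (metis mult_1)
    qed
  qed simp
qed

end

section \<open>Oscillation of stable paths\<close>

text \<open>
  \<open>greedy \<epsilon> x j\<close> is the displacement of the walk with steps \<open>x\<close> since it was last reset; it is reset
  when it exceeds \<open>\<epsilon>\<close>. Step \<open>j\<close> leads from time \<open>j\<close> to time \<open>j + 1\<close>, and \<open>hit \<epsilon> x j\<close> says that it
  causes a reset.
\<close>

fun greedy :: "real \<Rightarrow> (nat \<Rightarrow> 'a::real_normed_vector) \<Rightarrow> nat \<Rightarrow> 'a" where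
  "greedy \<epsilon> x 0 = 0"
| "greedy \<epsilon> x (Suc j) = (if \<epsilon> < norm (greedy \<epsilon> x j + x j) then 0 else greedy \<epsilon> x j + x j)"

definition hit :: "real \<Rightarrow> (nat \<Rightarrow> 'a::real_normed_vector) \<Rightarrow> nat \<Rightarrow> bool" where
  "hit \<epsilon> x j \<longleftrightarrow> \<epsilon> < norm (greedy \<epsilon> x j + x j)"

lemma greedy_cong: "(\<And>i. i < j \<Longrightarrow> x i = y i) \<Longrightarrow> greedy \<epsilon> x j = greedy \<epsilon> y j"
  by (induction j) auto

lemma hit_cong: "(\<And>i. i \<le> j \<Longrightarrow> x i = y i) \<Longrightarrow> hit \<epsilon> x j \<longleftrightarrow> hit \<epsilon> y j"
  unfolding hit_def using greedy_cong[of j x y \<epsilon>] by simp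

lemma norm_greedy_le: "0 \<le> \<epsilon> \<Longrightarrow> norm (greedy \<epsilon> x j) \<le> \<epsilon>"
  by (cases j) auto

lemma greedy_no_hit:
  assumes "i \<le> k" "\<And>j. i \<le> j \<Longrightarrow> j < k \<Longrightarrow> \<not> hit \<epsilon> x j"
  shows "greedy \<epsilon> x k = greedy \<epsilon> x i + (\<Sum>j=i..<k. x j)"
  using assms
proof (induction k)
  case 0
  then show ?case by simp
next
  case (Suc k)
  show ?case
  proof (cases "i = Suc k")
    case False
    then have "i \<le> k" using Suc.prems(1) by simp
    moreover have "\<not> hit \<epsilon> x k" using Suc.prems(2)[of k] \<open>i \<le> k\<close> by simp
    ultimately show ?thesis using Suc.IH Suc.prems(2) by (auto simp: hit_def)
  qed simp
qed

text \<open>After a reset the displacement equals the partial sums from \<open>Suc j\<close> on for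
  as long as no further reset occurs, and these are assumed to be at most \<open>\<epsilon>\<close>;
  hence the strong induction.\<close>

lemma no_hit_after:
  assumes "hit \<epsilon> x j" "\<And>l. l \<le> L \<Longrightarrow> norm (\<Sum>i=Suc j..<Suc j + l. x i) \<le> \<epsilon>"
  shows "i < L \<Longrightarrow> \<not> hit \<epsilon> x (Suc j + i)"
proof (induction i rule: less_induct)
  case (less i)
  have "greedy \<epsilon> x (Suc j) = 0" using assms(1) by (simp add: hit_def)
  moreover have "greedy \<epsilon> x (Suc j + i) = greedy \<epsilon> x (Suc j) + (\<Sum>k=Suc j..<Suc j + i. x k)"
  proof (rule greedy_no_hit)
    fix k assume "Suc j \<le> k" "k < Suc j + i"
    then show "\<not> hit \<epsilon> x k" using less.IH[of "k - Suc j"] less.prems by simp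
  qed simp
  ultimately have "greedy \<epsilon> x (Suc j + i) + x (Suc j + i) = (\<Sum>k=Suc j..<Suc j + Suc i. x k)" by simp
  then show ?case using assms(2)[of "Suc i"] less.prems unfolding hit_def by (simp only: not_less)
qed

lemma measurable_greedy [measurable (raw)]:
  fixes x :: "nat \<Rightarrow> 'b \<Rightarrow> 'a::euclidean_space"
  assumes "\<And>i. i < j \<Longrightarrow> x i \<in> borel_measurable N"
  shows "(\<lambda>\<omega>. greedy \<epsilon> (\<lambda>i. x i \<omega>) j) \<in> borel_measurable N"
  using assms
proof (induction j)
  case (Suc j)
  have [measurable]: "(\<lambda>\<omega>. greedy \<epsilon> (\<lambda>i. x i \<omega>) j) \<in> borel_measurable N" "x j \<in> borel_measurable N"
    using Suc by auto
  show ?case by simp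
qed simp

lemma measurable_hit:
  fixes x :: "nat \<Rightarrow> 'b \<Rightarrow> 'a::euclidean_space"
  assumes "\<And>i. i \<le> j \<Longrightarrow> x i \<in> borel_measurable N"
  shows "{\<omega>\<in>space N. hit \<epsilon> (\<lambda>i. x i \<omega>) j} \<in> sets N"
proof -
  have [measurable]: "(\<lambda>\<omega>. greedy \<epsilon> (\<lambda>i. x i \<omega>) j) \<in> borel_measurable N" "x j \<in> borel_measurable N"
    using assms by (auto intro!: measurable_greedy)
  show ?thesis unfolding hit_def by measurable
qed

context prob_space
begin

text \<open>The hit depends on the steps up to \<open>j\<close>, the calm on the steps from
  \<open>Suc j\<close> on: disjoint blocks of independent variables.\<close>

lemma prob_hit_and_calm:
  fixes \<xi> :: "nat \<Rightarrow> 'a \<Rightarrow> 'b::euclidean_space"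
  assumes ind: "indep_vars (\<lambda>_. borel) \<xi> {..<n}" and n: "Suc j + L \<le> n"
  shows "prob {\<omega>\<in>space M. hit \<epsilon> (\<lambda>i. \<xi> i \<omega>) j \<and> (\<forall>l\<le>L. norm (\<Sum>i=Suc j..<Suc j + l. \<xi> i \<omega>) \<le> \<epsilon>)}
    = prob {\<omega>\<in>space M. hit \<epsilon> (\<lambda>i. \<xi> i \<omega>) j} * prob {\<omega>\<in>space M. \<forall>l\<le>L. norm (\<Sum>i=Suc j..<Suc j + l. \<xi> i \<omega>) \<le> \<epsilon>}"
proof -
  let ?A = "{..j}" and ?B = "{Suc j..<Suc j + L}"
  let ?PA = "Pi\<^sub>M ?A (\<lambda>_. borel :: 'b measure)" and ?PB = "Pi\<^sub>M ?B (\<lambda>_. borel :: 'b measure)"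
  let ?XA = "{x\<in>space ?PA. hit \<epsilon> x j}"
  let ?XB = "{x\<in>space ?PB. \<forall>l\<le>L. norm (\<Sum>i=Suc j..<Suc j + l. x i) \<le> \<epsilon>}"
  have iv: "indep_var ?PA (\<lambda>\<omega>. restrict (\<lambda>i. \<xi> i \<omega>) ?A) ?PB (\<lambda>\<omega>. restrict (\<lambda>i. \<xi> i \<omega>) ?B)"
    by (rule indep_var_restrict[OF ind]) (use n in auto)
  have XA: "?XA \<in> sets ?PA"
    using measurable_hit[of j "\<lambda>i x. x i" ?PA \<epsilon>] by auto
  have XB: "?XB \<in> sets ?PB"
  proof -
    have *: "{x\<in>space ?PB. norm (\<Sum>i=Suc j..<Suc j + l. x i) \<le> \<epsilon>} \<in> sets ?PB" if l: "l \<in> {..L}" for l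
    proof -
      have [measurable]: "(\<lambda>x. \<Sum>i=Suc j..<Suc j + l. x i) \<in> borel_measurable ?PB"
        using l by (intro borel_measurable_sum measurable_component_singleton) auto
      show ?thesis by measurable
    qed
    have "{x\<in>space ?PB. \<forall>l\<in>{..L}. norm (\<Sum>i=Suc j..<Suc j + l. x i) \<le> \<epsilon>} \<in> sets ?PB"
      by (rule sets.sets_Collect_finite_All'[OF *]) simp_all
    then show ?thesis by (simp only: Ball_def atMost_iff)
  qed
  have sp: "restrict (\<lambda>i. \<xi> i \<omega>) I \<in> space (Pi\<^sub>M I (\<lambda>_. borel :: 'b measure))" for \<omega> I
    by (simp add: space_PiM)
  have hA: "hit \<epsilon> (restrict (\<lambda>i. \<xi> i \<omega>) ?A) j \<longleftrightarrow> hit \<epsilon> (\<lambda>i. \<xi> i \<omega>) j" for \<omega>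
    by (rule hit_cong) simp
  have sB: "(\<Sum>i=Suc j..<Suc j + l. restrict (\<lambda>i. \<xi> i \<omega>) ?B i) = (\<Sum>i=Suc j..<Suc j + l. \<xi> i \<omega>)" if "l \<le> L" for l \<omega>
    using that by (intro sum.cong) auto
  have eA: "(\<lambda>\<omega>. restrict (\<lambda>i. \<xi> i \<omega>) ?A) -` ?XA \<inter> space M = {\<omega>\<in>space M. hit \<epsilon> (\<lambda>i. \<xi> i \<omega>) j}"
    using sp[of _ ?A] hA by auto
  have eB: "(\<lambda>\<omega>. restrict (\<lambda>i. \<xi> i \<omega>) ?B) -` ?XB \<inter> space M = {\<omega>\<in>space M. \<forall>l\<le>L. norm (\<Sum>i=Suc j..<Suc j + l. \<xi> i \<omega>) \<le> \<epsilon>}"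
    using sp[of _ ?B] sB by auto
  have "(\<lambda>\<omega>. (restrict (\<lambda>i. \<xi> i \<omega>) ?A, restrict (\<lambda>i. \<xi> i \<omega>) ?B)) -` (?XA \<times> ?XB) \<inter> space M
      = ((\<lambda>\<omega>. restrict (\<lambda>i. \<xi> i \<omega>) ?A) -` ?XA \<inter> space M) \<inter> ((\<lambda>\<omega>. restrict (\<lambda>i. \<xi> i \<omega>) ?B) -` ?XB \<inter> space M)"
    by auto
  also have "\<dots> = {\<omega>\<in>space M. hit \<epsilon> (\<lambda>i. \<xi> i \<omega>) j \<and> (\<forall>l\<le>L. norm (\<Sum>i=Suc j..<Suc j + l. \<xi> i \<omega>) \<le> \<epsilon>)}"
    unfolding eA eB by auto
  finally show ?thesis using indep_varD[OF iv XA XB] unfolding eA eB by simp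
qed

text \<open>
  A hit that is followed by a calm stretch of length \<open>L\<close> is the last one for \<open>L\<close> steps. So among
  \<open>L\<close> consecutive steps these events are disjoint, and by independence each has at least half the
  probability of the hit itself.
\<close>

lemma sum_prob_hit_le:
  fixes \<xi> :: "nat \<Rightarrow> 'a \<Rightarrow> 'b::euclidean_space"
  assumes ind: "indep_vars (\<lambda>_. borel) \<xi> {..<n + L}" and L: "0 < L"
    and calm: "\<And>j. j < n \<Longrightarrow> 1/2 \<le> prob {\<omega>\<in>space M. \<forall>l\<le>L. norm (\<Sum>i=Suc j..<Suc j + l. \<xi> i \<omega>) \<le> \<epsilon>}"
  shows "(\<Sum>j<n. prob {\<omega>\<in>space M. hit \<epsilon> (\<lambda>i. \<xi> i \<omega>) j}) \<le> 2 * (real n / real L + 1)"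
proof -
  have \<xi>_meas [measurable]: "\<xi> i \<in> borel_measurable M" if "i < n + L" for i
    using ind that by (auto simp: indep_vars_def)
  define H where "H j = {\<omega>\<in>space M. hit \<epsilon> (\<lambda>i. \<xi> i \<omega>) j}" for j
  define E where "E j = {\<omega>\<in>space M. hit \<epsilon> (\<lambda>i. \<xi> i \<omega>) j \<and> (\<forall>l\<le>L. norm (\<Sum>i=Suc j..<Suc j + l. \<xi> i \<omega>) \<le> \<epsilon>)}" for j
  have H_sets: "H j \<in> events" if "j < n" for j
    unfolding H_def using that by (intro measurable_hit \<xi>_meas) auto
  have E_sets: "E j \<in> events" if "j < n" for j
  proof -
    have *: "{\<omega>\<in>space M. norm (\<Sum>i=Suc j..<Suc j + l. \<xi> i \<omega>) \<le> \<epsilon>} \<in> events" if "l \<in> {..L}" for l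
    proof -
      have [measurable]: "(\<lambda>\<omega>. \<Sum>i=Suc j..<Suc j + l. \<xi> i \<omega>) \<in> borel_measurable M"
        using that \<open>j < n\<close> by (intro borel_measurable_sum \<xi>_meas) auto
      show ?thesis by measurable
    qed
    have "{\<omega>\<in>space M. \<forall>l\<in>{..L}. norm (\<Sum>i=Suc j..<Suc j + l. \<xi> i \<omega>) \<le> \<epsilon>} \<in> events"
      by (rule sets.sets_Collect_finite_All'[OF *]) simp_all
    then have "H j \<inter> {\<omega>\<in>space M. \<forall>l\<in>{..L}. norm (\<Sum>i=Suc j..<Suc j + l. \<xi> i \<omega>) \<le> \<epsilon>} \<in> events"
      using H_sets[OF that] by (rule sets.Int[rotated])
    also have "H j \<inter> {\<omega>\<in>space M. \<forall>l\<in>{..L}. norm (\<Sum>i=Suc j..<Suc j + l. \<xi> i \<omega>) \<le> \<epsilon>} = E j"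
      by (auto simp: H_def E_def)
    finally show ?thesis .
  qed
  have half: "prob (H j) \<le> 2 * prob (E j)" if j: "j < n" for j
  proof -
    have "prob (E j) = prob (H j) * prob {\<omega>\<in>space M. \<forall>l\<le>L. norm (\<Sum>i=Suc j..<Suc j + l. \<xi> i \<omega>) \<le> \<epsilon>}"
      unfolding E_def H_def by (rule prob_hit_and_calm[OF ind]) (use j in simp)
    moreover have "prob (H j) * (1/2) \<le> prob (H j) * prob {\<omega>\<in>space M. \<forall>l\<le>L. norm (\<Sum>i=Suc j..<Suc j + l. \<xi> i \<omega>) \<le> \<epsilon>}"
      by (intro mult_left_mono calm j) simp
    ultimately show ?thesis by simp
  qed
  have disj: "E j \<inter> E j' = {}" if "j < j'" "j' \<le> j + L" for j j'
  proof (rule ccontr)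
    assume "E j \<inter> E j' \<noteq> {}"
    then obtain \<omega> where \<omega>: "\<omega> \<in> E j" "\<omega> \<in> E j'" by blast
    have "\<not> hit \<epsilon> (\<lambda>i. \<xi> i \<omega>) (Suc j + (j' - Suc j))"
      by (rule no_hit_after[where L = L]) (use \<omega>(1) that in \<open>auto simp: E_def\<close>)
    then show False using \<omega>(2) that(1) by (simp add: E_def)
  qed
  have block: "(\<Sum>j\<in>{j. j < n \<and> j div L = i}. prob (H j)) \<le> 2" for i
  proof -
    let ?J = "{j. j < n \<and> j div L = i}"
    have dis: "disjoint_family_on E ?J"
      unfolding disjoint_family_on_def
    proof (intro ballI impI)
      fix j j' assume j: "j \<in> ?J" "j' \<in> ?J" "j \<noteq> j'"
      have "j < i * L + L" "i * L \<le> j" "j' < i * L + L" "i * L \<le> j'"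
      proof -
        have "j = i * L + j mod L" "j' = i * L + j' mod L" "j mod L < L" "j' mod L < L"
          using j L div_mult_mod_eq[of j L] div_mult_mod_eq[of j' L] by auto
        then show "j < i * L + L" "i * L \<le> j" "j' < i * L + L" "i * L \<le> j'" by linarith+
      qed
      then show "E j \<inter> E j' = {}"
        using disj[of j j'] disj[of j' j] j(3) by (cases "j < j'") (auto simp: Int_commute)
    qed
    have "(\<Sum>j\<in>?J. prob (H j)) \<le> (\<Sum>j\<in>?J. 2 * prob (E j))" by (intro sum_mono half) simp
    also have "\<dots> = 2 * (\<Sum>j\<in>?J. prob (E j))" by (simp add: sum_distrib_left)
    also have "(\<Sum>j\<in>?J. prob (E j)) = prob (\<Union>j\<in>?J. E j)"
      by (rule finite_measure_finite_Union[symmetric]) (use E_sets dis in auto)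
    also have "2 * prob (\<Union>j\<in>?J. E j) \<le> 2 * 1" by (intro mult_left_mono prob_le_1) simp
    finally show ?thesis by simp
  qed
  have "(\<Sum>j<n. prob (H j)) = (\<Sum>i\<in>(\<lambda>j. j div L) ` {..<n}. \<Sum>j\<in>{j\<in>{..<n}. j div L = i}. prob (H j))"
    by (rule sum.image_gen) simp
  also have "\<dots> \<le> (\<Sum>i\<in>(\<lambda>j. j div L) ` {..<n}. 2)" using block by (intro sum_mono) simp
  also have "\<dots> = 2 * real (card ((\<lambda>j. j div L) ` {..<n}))" by simp
  also have "\<dots> \<le> 2 * (real n / real L + 1)"
  proof -
    have sub: "(\<lambda>j. j div L) ` {..<n} \<subseteq> {..n div L}" by (auto intro: div_le_mono)
    have "card ((\<lambda>j. j div L) ` {..<n}) \<le> n div L + 1" using card_mono[OF _ sub] by simp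
    then have "real (card ((\<lambda>j. j div L) ` {..<n})) \<le> real (n div L) + 1" by linarith
    also have "real (n div L) \<le> real n / real L" by (rule of_nat_div_le_of_nat)
    finally show ?thesis by simp
  qed
  finally show ?thesis by (simp add: H_def)
qed

end

text \<open>Rounding up approaches \<open>x\<close> from the right. Grid points equal to
  \<open>x\<close> may occur, so the limit is taken along \<open>nhds x\<close> restricted to
  \<open>{x..}\<close>.\<close>

lemma grid_tendsto_at_right:
  fixes x :: real and f :: "real \<Rightarrow> 'a::t2_space"
  assumes "continuous (at_right x) f" "0 \<le> x"
  shows "(\<lambda>m. f (real (nat \<lceil>x * 2 ^ m\<rceil>) / 2 ^ m)) \<longlonglongrightarrow> f x"
proof -
  let ?y = "\<lambda>m. real (nat \<lceil>x * 2 ^ m\<rceil>) / 2 ^ m"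
  have ge: "x \<le> ?y m" and le: "?y m \<le> x + (1/2) ^ m" for m
  proof -
    have "0 \<le> x * 2 ^ m" using assms by simp
    then have "x * 2 ^ m \<le> real (nat \<lceil>x * 2 ^ m\<rceil>)" "real (nat \<lceil>x * 2 ^ m\<rceil>) \<le> x * 2 ^ m + 1" by linarith+
    then show "x \<le> ?y m" "?y m \<le> x + (1/2) ^ m" by (auto simp: field_simps power_one_over)
  qed
  have "(\<lambda>m. x + (1/2) ^ m) \<longlonglongrightarrow> x + 0" by (intro tendsto_intros LIMSEQ_power_zero) simp
  then have y: "?y \<longlonglongrightarrow> x"
    using ge le by (intro tendsto_sandwich[of "\<lambda>_. x" ?y sequentially "\<lambda>m. x + (1/2) ^ m"]) auto
  have "(f \<longlongrightarrow> f x) (at x within {x..})"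
    using assms(1) unfolding continuous_within by (simp add: at_within_Ici_at_right)
  then have "(f \<longlongrightarrow> f x) (inf (nhds x) (principal {x..}))"
    unfolding tendsto_def eventually_at_filter eventually_inf_principal
    by (auto elim!: eventually_mono dest: topological_tendstoD)
  moreover have "filterlim ?y (inf (nhds x) (principal {x..})) sequentially"
    using y ge by (simp add: filterlim_inf filterlim_principal)
  ultimately show ?thesis by (rule filterlim_compose)
qed

text \<open>
  Let \<open>F y\<close> be the least number of hits up to time \<open>y\<close> that is attained on infinitely many of the good
  dyadic grids. If \<open>F y = F z\<close>, then on infinitely many grids there is no hit between \<open>y\<close> and \<open>z\<close>.
\<close>

lemma osc_index_of_frequently_few_hits:
  fixes f :: "real \<Rightarrow> 'a::real_normed_vector"
  assumes rc: "\<And>x. 0 \<le> x \<Longrightarrow> continuous (at_right x) f" and "0 < \<epsilon>"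
    and freq: "\<exists>\<^sub>F m in sequentially.
      card {j. j < T * 2 ^ m \<and> hit \<epsilon> (\<lambda>j. f (real (Suc j) / 2 ^ m) - f (real j / 2 ^ m)) j} \<le> n"
  shows "osc_index f (real T) (2 * \<epsilon>) n"
proof -
  define x where "x m j = f (real (Suc j) / 2 ^ m) - f (real j / 2 ^ m)" for m j :: nat
  define good where "good m \<longleftrightarrow> card {j. j < T * 2 ^ m \<and> hit \<epsilon> (x m) j} \<le> n" for m
  define c where "c m y = nat \<lceil>y * 2 ^ m\<rceil>" for m and y :: real
  define G where "G m y = card {j. j < c m y \<and> hit \<epsilon> (x m) j}" for m y
  have freq': "\<exists>\<^sub>F m in sequentially. good m" using freq unfolding good_def x_def .
  have c_mono: "c m y \<le> c m z" if "y \<le> z" for m y z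
    unfolding c_def using that by (intro nat_mono ceiling_mono mult_right_mono) auto
  have G_mono: "G m y \<le> G m z" if "y \<le> z" for m y z
    unfolding G_def using c_mono[OF that, of m] by (intro card_mono) auto
  have c_T: "c m (real T) = T * 2 ^ m" for m
  proof -
    have "real T * 2 ^ m = of_int (int (T * 2 ^ m))" by simp
    then show ?thesis unfolding c_def by (simp only: ceiling_of_int nat_int)
  qed
  have G_le: "G m y \<le> n" if "good m" "y \<le> real T" for m y
    using G_mono[OF that(2), of m] that(1) by (simp add: good_def G_def c_T)
  define F where "F y = (LEAST i. \<exists>\<^sub>F m in sequentially. good m \<and> G m y = i)" for y
  \<comment> \<open>Pigeonhole: on the good grids the count has at most \<open>n + 1\<close> values,
    so one of them recurs infinitely often.\<close>
  have ex: "\<exists>i\<le>n. \<exists>\<^sub>F m in sequentially. good m \<and> G m y = i" if "y \<le> real T" for y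
  proof -
    have "\<exists>\<^sub>F m in sequentially. \<exists>i\<in>{..n}. good m \<and> G m y = i"
      using freq' by (rule frequently_elim1) (use G_le that in auto)
    then show ?thesis unfolding frequently_bex_finite_distrib[OF finite_atMost] by blast
  qed
  have F: "\<exists>\<^sub>F m in sequentially. good m \<and> G m y = F y" if y: "y \<le> real T" for y
  proof -
    obtain i where "\<exists>\<^sub>F m in sequentially. good m \<and> G m y = i" using ex[OF y] by blast
    then show ?thesis unfolding F_def by (rule LeastI)
  qed
  have F_least: "F y \<le> i" if "\<exists>\<^sub>F m in sequentially. good m \<and> G m y = i" for y i
    unfolding F_def using that by (rule Least_le)
  have F_n: "F y \<le> n" if y: "y \<le> real T" for y
  proof -
    obtain i where "i \<le> n" "\<exists>\<^sub>F m in sequentially. good m \<and> G m y = i" using ex[OF y] by blast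
    then show ?thesis using F_least[of y i] by simp
  qed
  have F_mono: "F y \<le> F z" if yz: "y \<le> z" "z \<le> real T" for y z
  proof -
    have "\<exists>\<^sub>F m in sequentially. \<exists>i\<in>{..F z}. good m \<and> G m y = i"
      using F[OF yz(2)]
    proof (rule frequently_elim1)
      fix m assume "good m \<and> G m z = F z"
      then show "\<exists>i\<in>{..F z}. good m \<and> G m y = i" using G_mono[OF yz(1), of m] by simp
    qed
    then have "\<exists>i\<in>{..F z}. \<exists>\<^sub>F m in sequentially. good m \<and> G m y = i"
      by (simp only: frequently_bex_finite_distrib finite_atMost)
    then obtain i where "i \<in> {..F z}" "\<exists>\<^sub>F m in sequentially. good m \<and> G m y = i"
      by (rule bexE)
    then show ?thesis using F_least[of y i] by simp
  qed
  have close: "dist (f y) (f z) \<le> 2 * \<epsilon>" if yz: "0 \<le> y" "y \<le> z" "z \<le> real T" "F y = F z" for y z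
  proof (rule ccontr)
    assume "\<not> dist (f y) (f z) \<le> 2 * \<epsilon>"
    then have far: "2 * \<epsilon> < dist (f y) (f z)" by simp
    have "(\<lambda>m. dist (f (real (c m y) / 2 ^ m)) (f (real (c m z) / 2 ^ m))) \<longlonglongrightarrow> dist (f y) (f z)"
      unfolding c_def using yz by (intro tendsto_dist grid_tendsto_at_right rc) auto
    then have ev: "\<forall>\<^sub>F m in sequentially. 2 * \<epsilon> < dist (f (real (c m y) / 2 ^ m)) (f (real (c m z) / 2 ^ m))"
      using far by (rule order_tendstoD(1))
    \<comment> \<open>As \<open>F y = F z\<close> is the least recurring count for \<open>y\<close>,
      smaller counts occur on finitely many good grids only. With monotonicity this forces
      \<open>G m y = G m z\<close> on infinitely many grids.\<close>
    have fewer: "\<not> (\<exists>\<^sub>F m in sequentially. \<exists>i\<in>{..<F z}. good m \<and> G m y = i)"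
    proof
      assume "\<exists>\<^sub>F m in sequentially. \<exists>i\<in>{..<F z}. good m \<and> G m y = i"
      then have "\<exists>i\<in>{..<F z}. \<exists>\<^sub>F m in sequentially. good m \<and> G m y = i"
        by (simp only: frequently_bex_finite_distrib finite_lessThan)
      then obtain i where "i \<in> {..<F z}" "\<exists>\<^sub>F m in sequentially. good m \<and> G m y = i"
        by (rule bexE)
      then show False using F_least[of y i] yz(4) by simp
    qed
    have "\<exists>\<^sub>F m in sequentially. (good m \<and> G m z = F z) \<and> (\<not> (\<exists>i\<in>{..<F z}. good m \<and> G m y = i)
        \<and> 2 * \<epsilon> < dist (f (real (c m y) / 2 ^ m)) (f (real (c m z) / 2 ^ m)))"
      using frequently_eventually_conj[OF F[OF yz(3)] eventually_conj[OF fewer[unfolded not_frequently] ev]]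
      by (simp only: conj_commute conj_left_commute)
    from frequently_ex[OF this] obtain m where m: "good m" "G m z = F z" "\<not> (\<exists>i\<in>{..<F z}. good m \<and> G m y = i)"
      "2 * \<epsilon> < dist (f (real (c m y) / 2 ^ m)) (f (real (c m z) / 2 ^ m))"
      by blast
    have "G m y = G m z" using m G_mono[OF yz(2), of m] by force
    moreover have "{j. j < c m y \<and> hit \<epsilon> (x m) j} \<subseteq> {j. j < c m z \<and> hit \<epsilon> (x m) j}"
      using c_mono[OF yz(2), of m] by auto
    ultimately have same: "{j. j < c m y \<and> hit \<epsilon> (x m) j} = {j. j < c m z \<and> hit \<epsilon> (x m) j}"
      unfolding G_def by (intro card_subset_eq) auto
    \<comment> \<open>Equal counts mean no reset between \<open>y\<close> and \<open>z\<close>, so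
      the increment of \<open>f\<close> is a difference of two greedy displacements of norm at most
      \<open>\<epsilon>\<close>; hence \<open>2 * \<epsilon>\<close>.\<close>
    have "greedy \<epsilon> (x m) (c m z) = greedy \<epsilon> (x m) (c m y) + (\<Sum>j=c m y..<c m z. x m j)"
    proof (rule greedy_no_hit[OF c_mono[OF yz(2)]])
      fix j assume j: "c m y \<le> j" "j < c m z"
      show "\<not> hit \<epsilon> (x m) j"
      proof
        assume "hit \<epsilon> (x m) j"
        then have "j \<in> {j. j < c m z \<and> hit \<epsilon> (x m) j}" using j(2) by simp
        then have "j < c m y" unfolding same[symmetric] by simp
        then show False using j(1) by simp
      qed
    qed
    moreover have "(\<Sum>j=c m y..<c m z. x m j) = f (real (c m z) / 2 ^ m) - f (real (c m y) / 2 ^ m)"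
      using sum_Suc_diff'[OF c_mono[OF yz(2)], of "\<lambda>j. f (real j / 2 ^ m)" m] by (simp only: x_def)
    ultimately have "f (real (c m z) / 2 ^ m) - f (real (c m y) / 2 ^ m) = greedy \<epsilon> (x m) (c m z) - greedy \<epsilon> (x m) (c m y)"
      by simp
    then have "dist (f (real (c m y) / 2 ^ m)) (f (real (c m z) / 2 ^ m)) \<le> norm (greedy \<epsilon> (x m) (c m z)) + norm (greedy \<epsilon> (x m) (c m y))"
      by (simp only: dist_norm norm_minus_commute[of "f (real (c m y) / 2 ^ m)"] norm_triangle_ineq4)
    also have "\<dots> \<le> \<epsilon> + \<epsilon>" using assms(2) by (intro add_mono norm_greedy_le) auto
    finally show False using m(4) by simp
  qed
  show ?thesis
    unfolding osc_index_def
  proof (intro exI[of _ F] conjI ballI impI)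
    show "mono_on {0..real T} F" by (auto simp: mono_on_def intro: F_mono)
    show "F y \<le> n" if "y \<in> {0..real T}" for y using F_n that by simp
    show "dist (f y) (f z) \<le> 2 * \<epsilon>" if yz: "y \<in> {0..real T}" "z \<in> {0..real T}" "F y = F z" for y z
    proof (cases "y \<le> z")
      case True
      then show ?thesis by (intro close) (use yz in auto)
    next
      case False
      then have "dist (f z) (f y) \<le> 2 * \<epsilon>" by (intro close) (use yz in auto)
      then show ?thesis by (simp only: dist_commute)
    qed
  qed
qed

text \<open>The right-hand side depends on the steps only through their common law, so stretches of
  equal length starting at different places are calm with the same probability.\<close>

lemma (in prob_space) prob_calm_eq_measure_PiM:
  fixes X :: "nat \<Rightarrow> 'a \<Rightarrow> 'b::euclidean_space"
  assumes ind: "indep_vars (\<lambda>_. borel) X {..<L}" and L: "0 < L"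
    and law: "\<And>i. i < L \<Longrightarrow> distr M borel (X i) = N"
  shows "prob {\<omega>\<in>space M. \<forall>l\<le>L. norm (\<Sum>i<l. X i \<omega>) \<le> \<epsilon>}
    = measure (Pi\<^sub>M {..<L} (\<lambda>_. N)) {x\<in>space (Pi\<^sub>M {..<L} (\<lambda>_. borel)). \<forall>l\<le>L. norm (\<Sum>i<l. x i) \<le> \<epsilon>}"
proof -
  let ?P = "Pi\<^sub>M {..<L} (\<lambda>_. borel :: 'b measure)"
  let ?S = "{x\<in>space ?P. \<forall>l\<le>L. norm (\<Sum>i<l. x i) \<le> \<epsilon>}"
  have X: "X i \<in> borel_measurable M" if "i < L" for i
    using ind that by (auto simp: indep_vars_def)
  have S: "?S \<in> sets ?P"
  proof -
    have *: "{x\<in>space ?P. norm (\<Sum>i<l. x i) \<le> \<epsilon>} \<in> sets ?P" if l: "l \<in> {..L}" for l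
    proof -
      have [measurable]: "(\<lambda>x. \<Sum>i<l. x i) \<in> borel_measurable ?P"
        using l by (intro borel_measurable_sum measurable_component_singleton) auto
      show ?thesis by measurable
    qed
    have "{x\<in>space ?P. \<forall>l\<in>{..L}. norm (\<Sum>i<l. x i) \<le> \<epsilon>} \<in> sets ?P"
      by (rule sets.sets_Collect_finite_All'[OF *]) simp_all
    then show ?thesis by (simp only: Ball_def atMost_iff)
  qed
  have m: "(\<lambda>\<omega>. \<lambda>i\<in>{..<L}. X i \<omega>) \<in> measurable M ?P"
    using X by (intro measurable_restrict) auto
  have "distr M ?P (\<lambda>\<omega>. \<lambda>i\<in>{..<L}. X i \<omega>) = Pi\<^sub>M {..<L} (\<lambda>i. distr M borel (X i))"
    using indep_vars_iff_distr_eq_PiM'[where I = "{..<L}" and M' = "\<lambda>_. borel" and X = X] X ind L by auto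
  also have "\<dots> = Pi\<^sub>M {..<L} (\<lambda>_. N)" using law by (intro PiM_cong) auto
  finally have "measure (Pi\<^sub>M {..<L} (\<lambda>_. N)) ?S = measure (distr M ?P (\<lambda>\<omega>. \<lambda>i\<in>{..<L}. X i \<omega>)) ?S" by simp
  also have "\<dots> = prob ((\<lambda>\<omega>. \<lambda>i\<in>{..<L}. X i \<omega>) -` ?S \<inter> space M)" by (rule measure_distr[OF m S])
  also have "(\<lambda>\<omega>. \<lambda>i\<in>{..<L}. X i \<omega>) -` ?S \<inter> space M = {\<omega>\<in>space M. \<forall>l\<le>L. norm (\<Sum>i<l. X i \<omega>) \<le> \<epsilon>}"
  proof -
    have "(\<Sum>i<l. (\<lambda>i\<in>{..<L}. X i \<omega>) i) = (\<Sum>i<l. X i \<omega>)" if "l \<le> L" for l \<omega>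
      using that by (intro sum.cong) auto
    then show ?thesis by (auto simp: space_PiM)
  qed
  finally show ?thesis by simp
qed

section \<open>Calm stretches and the number of resets of a stable motion\<close>

context stable_motion
begin

text \<open>By right continuity at 0 the path stays in the unit ball for some random time. The
  events \<open>B n\<close>, stated over rational times for measurability, increase to an almost
  sure event. The bound does not depend on the number of observation times, which allows the grids
  to be refined.\<close>

lemma small_time_calm:
  obtains h where "0 < h"
    "\<And>(t::nat \<Rightarrow> real) L. (\<And>l. 0 \<le> t l \<and> t l \<le> h) \<Longrightarrow> 1/2 \<le> prob {\<omega>\<in>space M. \<forall>l\<le>L. norm (Y (t l) \<omega>) \<le> 1}"
proof -
  define B where "B n = {\<omega>\<in>space M. \<forall>q\<in>\<rat> \<inter> {0..1 / real (Suc n)}. norm (Y q \<omega>) \<le> 1}" for n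
  have B_sets: "B n \<in> events" for n
  proof -
    have "{\<omega>\<in>space M. \<forall>q\<in>\<rat> \<inter> {0..1 / real (Suc n)}. norm (Y q \<omega>) \<le> 1} \<in> sets M"
    proof (rule sets.sets_Collect_countable_All')
      show "countable (\<rat> \<inter> {0..1 / real (Suc n)})" using countable_rat by blast
      fix q assume "q \<in> \<rat> \<inter> {0..1 / real (Suc n)}"
      then have [measurable]: "Y q \<in> borel_measurable M" using measurable_Y by auto
      show "{\<omega>\<in>space M. norm (Y q \<omega>) \<le> 1} \<in> sets M" by measurable
    qed
    then show ?thesis by (simp only: B_def)
  qed
  have inc: "incseq B"
  proof (rule incseq_SucI)
    fix n
    have "1 / real (Suc (Suc n)) \<le> 1 / real (Suc n)" by (simp add: divide_simps)
    then show "B n \<le> B (Suc n)" unfolding B_def by auto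
  qed
  have rc: "\<exists>b>t. \<forall>y>t. y < b \<longrightarrow> P (Y y \<omega>)"
    if "cadlag (\<lambda>t. Y t \<omega>)" "0 \<le> t" "open {x. P x}" "P (Y t \<omega>)" for t \<omega> P
  proof -
    have "continuous (at_right t) (\<lambda>t. Y t \<omega>)" using that by (simp add: cadlag_def)
    then have "((\<lambda>t. Y t \<omega>) \<longlongrightarrow> Y t \<omega>) (at_right t)" by (simp add: continuous_within)
    from topological_tendstoD[OF this that(3)] have "\<forall>\<^sub>F y in at_right t. P (Y y \<omega>)" using that(4) by simp
    then show ?thesis unfolding eventually_at_right_field .
  qed
  have "AE \<omega> in M. \<omega> \<in> (\<Union>n. B n)"
    using AE_cadlag AE_Y_0 AE_space
  proof eventually_elim
    case (elim \<omega>)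
    have "open {x::'a. norm x < 1}" using open_ball[of "0::'a" 1] by (simp add: ball_def)
    then obtain b where b: "0 < b" "\<And>y. 0 < y \<Longrightarrow> y < b \<Longrightarrow> norm (Y y \<omega>) < 1"
      using rc[of \<omega> 0 "\<lambda>x. norm x < 1"] elim by auto
    obtain n where n: "1 / real (Suc n) < b" using b(1) nat_approx_posE by blast
    have "norm (Y q \<omega>) \<le> 1" if "q \<in> \<rat> \<inter> {0..1 / real (Suc n)}" for q
      using that b(2)[of q] n elim(2) by (cases "q = 0") auto
    then have "\<omega> \<in> B n" using elim(3) by (simp add: B_def)
    then show ?case by blast
  qed
  then have "prob (\<Union>n. B n) = 1" using B_sets by (subst prob_eq_1) auto
  moreover have "(\<lambda>n. prob (B n)) \<longlonglongrightarrow> prob (\<Union>n. B n)"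
    using B_sets inc by (intro finite_Lim_measure_incseq) auto
  ultimately have "\<forall>\<^sub>F n in sequentially. 1/2 < prob (B n)" by (intro order_tendstoD(1)) auto
  then obtain n where n: "1/2 < prob (B n)" using eventually_happens' sequentially_bot by blast
  \<comment> \<open>Half the window of \<open>B n\<close>: every \<open>s \<le> h\<close> still has
    rationals of the window to its right, so right continuity carries the bound over to
    \<open>s\<close>.\<close>
  define h where "h = 1 / (2 * real (Suc n))"
  have hn: "0 < h" "h < 1 / real (Suc n)" by (auto simp: h_def divide_simps)
  show ?thesis
  proof (rule that[OF hn(1)])
    fix t :: "nat \<Rightarrow> real" and L assume t: "\<And>l. 0 \<le> t l \<and> t l \<le> h"
    have ev: "{\<omega>\<in>space M. \<forall>l\<le>L. norm (Y (t l) \<omega>) \<le> 1} \<in> events"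
    proof -
      have *: "{\<omega>\<in>space M. norm (Y (t l) \<omega>) \<le> 1} \<in> events" if "l \<in> {..L}" for l
      proof -
        have [measurable]: "Y (t l) \<in> borel_measurable M" using t measurable_Y by auto
        show ?thesis by measurable
      qed
      have "{\<omega>\<in>space M. \<forall>l\<in>{..L}. norm (Y (t l) \<omega>) \<le> 1} \<in> events"
        by (rule sets.sets_Collect_finite_All'[OF *]) simp_all
      then show ?thesis by (simp only: Ball_def atMost_iff)
    qed
    have "AE \<omega> in M. \<omega> \<in> B n \<longrightarrow> \<omega> \<in> {\<omega>\<in>space M. \<forall>l\<le>L. norm (Y (t l) \<omega>) \<le> 1}"
      using AE_cadlag
    proof eventually_elim
      case (elim \<omega>)
      have "norm (Y s \<omega>) \<le> 1" if B: "\<omega> \<in> B n" and s: "0 \<le> s" "s \<le> h" for s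
      proof (rule ccontr)
        assume "\<not> norm (Y s \<omega>) \<le> 1"
        then have far: "1 < norm (Y s \<omega>)" by simp
        have "open {x::'a. 1 < norm x}" by (intro open_Collect_less continuous_intros)
        then obtain b where b: "s < b" "\<And>y. s < y \<Longrightarrow> y < b \<Longrightarrow> 1 < norm (Y y \<omega>)"
          using rc[of \<omega> s "\<lambda>x. 1 < norm x"] elim s far by auto
        have "s < min b (1 / real (Suc n))" using b s hn by simp
        then obtain q where q: "q \<in> \<rat>" "s < q" "q < min b (1 / real (Suc n))" using Rats_dense_in_real by blast
        then have "norm (Y q \<omega>) \<le> 1" using B s by (simp add: B_def)
        then show False using b(2)[of q] q by simp
      qed
      then show ?case using t by (auto simp: B_def)
    qed
    then have "prob (B n) \<le> prob {\<omega>\<in>space M. \<forall>l\<le>L. norm (Y (t l) \<omega>) \<le> 1}"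
      by (rule finite_measure_mono_AE) (rule ev)
    then show "1/2 \<le> prob {\<omega>\<in>space M. \<forall>l\<le>L. norm (Y (t l) \<omega>) \<le> 1}" using n by simp
  qed
qed

definition step :: "nat \<Rightarrow> nat \<Rightarrow> 'w \<Rightarrow> 'a" where
  "step m j \<omega> = Y (real (Suc j) / 2 ^ m) \<omega> - Y (real j / 2 ^ m) \<omega>"

lemma step_indep: "indep_vars (\<lambda>_. borel) (\<lambda>i. step m (a + i)) {..<n}"
proof -
  have "indep_vars (\<lambda>_. borel) (\<lambda>i \<omega>. Y (real (a + Suc i) / 2 ^ m) \<omega> - Y (real (a + i) / 2 ^ m) \<omega>) {..<n}"
    by (rule increments_indep[of "\<lambda>i. real (a + i) / 2 ^ m"])
      (auto simp: strict_mono_on_def divide_strict_right_mono)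
  then show ?thesis unfolding step_def by simp
qed

lemma distr_step: "distr M borel (step m j) = distr M borel (Y (1 / 2 ^ m))"
proof -
  have "real j / 2 ^ m + 1 / 2 ^ m = real (Suc j) / 2 ^ m" by (simp add: add_divide_distrib)
  then show ?thesis using distr_increment[of "real j / 2 ^ m" "1 / 2 ^ m"] by (simp add: step_def[abs_def])
qed

lemma measurable_step: "step m j \<in> borel_measurable M"
  unfolding step_def[abs_def] using measurable_Y by (intro borel_measurable_diff) auto

text \<open>Rescaling time by \<open>\<epsilon> powr \<alpha>\<close> turns the threshold
  \<open>\<epsilon>\<close> into 1 and the stretch into times at most \<open>h\<close>. For a
  stretch from time 0 the steps telescope to the path; \<open>prob_calm_eq_measure_PiM\<close>
  carries the bound to every start \<open>a\<close>.\<close>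

lemma prob_calm_ge_half:
  assumes h: "\<And>(t::nat \<Rightarrow> real) L. (\<And>l. 0 \<le> t l \<and> t l \<le> h) \<Longrightarrow> 1/2 \<le> prob {\<omega>\<in>space M. \<forall>l\<le>L. norm (Y (t l) \<omega>) \<le> 1}"
    and \<epsilon>: "0 < \<epsilon>" and L: "0 < L" "real L / 2 ^ m \<le> h * \<epsilon> powr \<alpha>"
  shows "1/2 \<le> prob {\<omega>\<in>space M. \<forall>l\<le>L. norm (\<Sum>i=a..<a + l. step m i \<omega>) \<le> \<epsilon>}"
proof -
  have sh: "(\<Sum>i=a..<a + l. step m i \<omega>) = (\<Sum>i<l. step m (a + i) \<omega>)" for a l \<omega>
    using sum.atLeastLessThan_shift_0[of "\<lambda>i. step m i \<omega>" a "a + l"] by (simp add: lessThan_atLeast0 comp_def)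
  have shift: "prob {\<omega>\<in>space M. \<forall>l\<le>L. norm (\<Sum>i<l. step m (a + i) \<omega>) \<le> \<epsilon>}
    = measure (Pi\<^sub>M {..<L} (\<lambda>_. distr M borel (Y (1 / 2 ^ m)))) {x\<in>space (Pi\<^sub>M {..<L} (\<lambda>_. borel)). \<forall>l\<le>L. norm (\<Sum>i<l. x i) \<le> \<epsilon>}" for a
    by (rule prob_calm_eq_measure_PiM[OF step_indep L(1) distr_step])
  define c where "c = \<epsilon> powr \<alpha>"
  have c: "0 < c" "c powr (1 / \<alpha>) = \<epsilon>" using \<epsilon> index_pos by (auto simp: c_def powr_powr)
  \<comment> \<open>The truncation keeps all \<open>t l\<close> within \<open>{0..h}\<close>: the
    hypothesis on \<open>h\<close> constrains every index, not only those up to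
    \<open>L\<close>.\<close>
  define t where "t l = real (min l L) / 2 ^ m / c" for l
  have t: "0 \<le> t l \<and> t l \<le> h" for l
  proof -
    have "real (min l L) / 2 ^ m \<le> real L / 2 ^ m" by (intro divide_right_mono) auto
    then have "real (min l L) / 2 ^ m \<le> h * c" using L(2) by (simp add: c_def)
    then show ?thesis using c by (simp add: t_def pos_divide_le_eq mult_ac)
  qed
  define A where "A = {f\<in>space (path_space :: (real \<Rightarrow> 'a) measure). \<forall>l\<in>{..L}. norm (f (t l)) \<le> \<epsilon>}"
  have A: "A \<in> sets path_space"
    unfolding A_def
  proof (rule sets.sets_Collect_finite_All')
    fix l
    have [measurable]: "(\<lambda>f. f (t l)) \<in> borel_measurable (path_space :: (real \<Rightarrow> 'a) measure)"
      unfolding path_space_def using t by (intro measurable_component_singleton) simp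
    show "{f\<in>space (path_space :: (real \<Rightarrow> 'a) measure). norm (f (t l)) \<le> \<epsilon>} \<in> sets path_space" by measurable
  qed simp_all
  have sp: "process_path Z \<omega> \<in> space (path_space :: (real \<Rightarrow> 'a) measure)" for Z :: "real \<Rightarrow> 'w \<Rightarrow> 'a" and \<omega>
    by (simp add: process_path_def path_space_def space_PiM)
  have "1/2 \<le> prob {\<omega>\<in>space M. \<forall>l\<le>L. norm (Y (t l) \<omega>) \<le> 1}" by (rule h) (rule t)
  also have "{\<omega>\<in>space M. \<forall>l\<le>L. norm (Y (t l) \<omega>) \<le> 1} = {\<omega>\<in>space M. process_path (\<lambda>x \<omega>. c powr (1 / \<alpha>) *\<^sub>R Y x \<omega>) \<omega> \<in> A}"
    unfolding A_def using t \<epsilon> sp by (auto simp: process_path_def c(2))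
  also have "prob \<dots> = prob {\<omega>\<in>space M. process_path (\<lambda>x. Y (c * x)) \<omega> \<in> A}"
    by (rule prob_scale[OF c(1) A, symmetric])
  also have "{\<omega>\<in>space M. process_path (\<lambda>x. Y (c * x)) \<omega> \<in> A} = {\<omega>\<in>space M. \<forall>l\<le>L. norm (Y (real l / 2 ^ m) \<omega>) \<le> \<epsilon>}"
  proof -
    have "c * t l = real l / 2 ^ m" if "l \<le> L" for l using that c(1) by (simp add: t_def min_def)
    then show ?thesis unfolding A_def using t sp by (auto simp: process_path_def)
  qed
  also have "prob \<dots> \<le> prob {\<omega>\<in>space M. \<forall>l\<le>L. norm (\<Sum>i<l. step m (0 + i) \<omega>) \<le> \<epsilon>}"
  proof (rule finite_measure_mono_AE)
    show "AE \<omega> in M. \<omega> \<in> {\<omega>\<in>space M. \<forall>l\<le>L. norm (Y (real l / 2 ^ m) \<omega>) \<le> \<epsilon>} \<longrightarrow>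
      \<omega> \<in> {\<omega>\<in>space M. \<forall>l\<le>L. norm (\<Sum>i<l. step m (0 + i) \<omega>) \<le> \<epsilon>}"
      using AE_Y_0
    proof eventually_elim
      case (elim \<omega>)
      have "(\<Sum>i<l. step m i \<omega>) = Y (real l / 2 ^ m) \<omega>" for l
        using sum_lessThan_telescope[of "\<lambda>j. Y (real j / 2 ^ m) \<omega>" l] elim by (simp add: step_def)
      then show ?case by simp
    qed
    have *: "{\<omega>\<in>space M. norm (\<Sum>i<l. step m (0 + i) \<omega>) \<le> \<epsilon>} \<in> events" for l
    proof -
      have [measurable]: "(\<lambda>\<omega>. \<Sum>i<l. step m (0 + i) \<omega>) \<in> borel_measurable M"
        by (intro borel_measurable_sum measurable_step)
      show ?thesis by measurable
    qed
    have "{\<omega>\<in>space M. \<forall>l\<in>{..L}. norm (\<Sum>i<l. step m (0 + i) \<omega>) \<le> \<epsilon>} \<in> events"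
      by (rule sets.sets_Collect_finite_All'[OF *]) simp_all
    then show "{\<omega>\<in>space M. \<forall>l\<le>L. norm (\<Sum>i<l. step m (0 + i) \<omega>) \<le> \<epsilon>} \<in> events"
      by (simp only: Ball_def atMost_iff)
  qed
  also have "\<dots> = prob {\<omega>\<in>space M. \<forall>l\<le>L. norm (\<Sum>i<l. step m (a + i) \<omega>) \<le> \<epsilon>}"
    unfolding shift ..
  finally show ?thesis unfolding sh .
qed

definition hits :: "nat \<Rightarrow> real \<Rightarrow> nat \<Rightarrow> 'w \<Rightarrow> nat" where
  "hits T \<epsilon> m \<omega> = card {j. j < T * 2 ^ m \<and> hit \<epsilon> (\<lambda>j. step m j \<omega>) j}"

lemma hits_eq_sum: "ennreal (real (hits T \<epsilon> m \<omega>)) = (\<Sum>j<T * 2 ^ m. indicator {\<omega>. hit \<epsilon> (\<lambda>j. step m j \<omega>) j} \<omega>)"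
proof -
  have "(\<Sum>j<T * 2 ^ m. indicator {\<omega>. hit \<epsilon> (\<lambda>j. step m j \<omega>) j} \<omega> :: ennreal)
    = (\<Sum>j\<in>{j. j < T * 2 ^ m \<and> hit \<epsilon> (\<lambda>j. step m j \<omega>) j}. 1)"
    by (intro sum.mono_neutral_cong_right) (auto simp: indicator_def)
  then show ?thesis by (simp add: hits_def ennreal_of_nat_eq_real_of_nat)
qed

lemma step_hit_sets: "{\<omega>\<in>space M. hit \<epsilon> (\<lambda>j. step m j \<omega>) j} \<in> sets M"
  by (rule measurable_hit) (rule measurable_step)

lemma measurable_hits: "(\<lambda>\<omega>. ennreal (real (hits T \<epsilon> m \<omega>))) \<in> borel_measurable M"
  unfolding hits_eq_sum
  by (intro borel_measurable_sum borel_measurable_indicator') (use step_hit_sets in \<open>auto simp: vimage_def Int_def conj_commute\<close>)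

lemma nn_integral_hits: "(\<integral>\<^sup>+ \<omega>. ennreal (real (hits T \<epsilon> m \<omega>)) \<partial>M)
    = ennreal (\<Sum>j<T * 2 ^ m. prob {\<omega>\<in>space M. hit \<epsilon> (\<lambda>j. step m j \<omega>) j})"
proof -
  have "(\<integral>\<^sup>+ \<omega>. ennreal (real (hits T \<epsilon> m \<omega>)) \<partial>M)
      = (\<integral>\<^sup>+ \<omega>. (\<Sum>j<T * 2 ^ m. indicator {\<omega>\<in>space M. hit \<epsilon> (\<lambda>j. step m j \<omega>) j} \<omega>) \<partial>M)"
    unfolding hits_eq_sum by (intro nn_integral_cong sum.cong) (auto simp: indicator_def)
  also have "\<dots> = (\<Sum>j<T * 2 ^ m. \<integral>\<^sup>+ \<omega>. indicator {\<omega>\<in>space M. hit \<epsilon> (\<lambda>j. step m j \<omega>) j} \<omega> \<partial>M)"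
    by (rule nn_integral_sum) (use step_hit_sets in auto)
  also have "\<dots> = (\<Sum>j<T * 2 ^ m. ennreal (prob {\<omega>\<in>space M. hit \<epsilon> (\<lambda>j. step m j \<omega>) j}))"
    using step_hit_sets by (simp add: emeasure_eq_measure)
  also have "\<dots> = ennreal (\<Sum>j<T * 2 ^ m. prob {\<omega>\<in>space M. hit \<epsilon> (\<lambda>j. step m j \<omega>) j})"
    by (rule sum_ennreal) simp
  finally show ?thesis .
qed

text \<open>Blocks of \<open>L\<close> steps are chosen to last about
  \<open>h * \<epsilon> powr \<alpha>\<close>, so the number of blocks depends on
  \<open>\<epsilon>\<close> but hardly on the grid.\<close>

lemma expected_hits_bound:
  obtains C where "0 \<le> C" "\<And>\<epsilon>. 0 < \<epsilon> \<Longrightarrow> \<epsilon> \<le> 1 \<Longrightarrow>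
    \<forall>\<^sub>F m in sequentially. (\<integral>\<^sup>+ \<omega>. ennreal (real (hits T \<epsilon> m \<omega>)) \<partial>M) \<le> ennreal (C * \<epsilon> powr - \<alpha>)"
proof -
  obtain h where h: "0 < h"
    "\<And>(t::nat \<Rightarrow> real) L. (\<And>l. 0 \<le> t l \<and> t l \<le> h) \<Longrightarrow> 1/2 \<le> prob {\<omega>\<in>space M. \<forall>l\<le>L. norm (Y (t l) \<omega>) \<le> 1}"
    by (rule small_time_calm) blast
  show ?thesis
  \<comment> \<open>Rounding \<open>L\<close> down loses at most a factor 2, which gives the 4; the
    incomplete block in \<open>sum_prob_hit_le\<close> is paid by
    \<open>2 \<le> 2 * \<epsilon> powr - \<alpha>\<close>.\<close>
  proof (rule that[of "4 * real T / h + 2"])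
    fix \<epsilon> :: real assume \<epsilon>: "0 < \<epsilon>" "\<epsilon> \<le> 1"
    define r where "r = h * \<epsilon> powr \<alpha>"
    have r: "0 < r" using h \<epsilon> by (simp add: r_def)
    have "\<forall>\<^sub>F m in sequentially. 1 / r \<le> 2 ^ m"
    proof -
      obtain N :: nat where N: "1 / r < 2 ^ N" using real_arch_pow[of 2 "1 / r"] by auto
      show ?thesis
      proof (rule eventually_sequentiallyI)
        fix m assume "N \<le> m"
        then have "(2::real) ^ N \<le> 2 ^ m" by (intro power_increasing) auto
        then show "1 / r \<le> 2 ^ m" using N by linarith
      qed
    qed
    then show "\<forall>\<^sub>F m in sequentially. (\<integral>\<^sup>+ \<omega>. ennreal (real (hits T \<epsilon> m \<omega>)) \<partial>M) \<le> ennreal ((4 * real T / h + 2) * \<epsilon> powr - \<alpha>)"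
    proof (rule eventually_mono)
      fix m :: nat assume "1 / r \<le> 2 ^ m"
      then have m: "1 \<le> r * 2 ^ m" using r by (simp add: field_simps)
      define L where "L = nat \<lfloor>r * 2 ^ m\<rfloor>"
      have L: "0 < L" "real L \<le> r * 2 ^ m" "r * 2 ^ m \<le> 2 * real L"
      proof -
        have fl: "1 \<le> \<lfloor>r * 2 ^ m\<rfloor>" using m by linarith
        then have "real L = of_int \<lfloor>r * 2 ^ m\<rfloor>" by (simp add: L_def)
        then show "0 < L" "real L \<le> r * 2 ^ m" "r * 2 ^ m \<le> 2 * real L" using fl by linarith+
      qed
      have "(\<Sum>j<T * 2 ^ m. prob {\<omega>\<in>space M. hit \<epsilon> (\<lambda>i. step m i \<omega>) j}) \<le> 2 * (real (T * 2 ^ m) / real L + 1)"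
      proof (rule sum_prob_hit_le[OF _ L(1)])
        show "indep_vars (\<lambda>_. borel) (step m) {..<T * 2 ^ m + L}"
          using step_indep[of m 0 "T * 2 ^ m + L"] by simp
        show "1/2 \<le> prob {\<omega>\<in>space M. \<forall>l\<le>L. norm (\<Sum>i=Suc j..<Suc j + l. step m i \<omega>) \<le> \<epsilon>}" for j
          by (rule prob_calm_ge_half[OF h(2) \<epsilon>(1) L(1)]) (use L(2) in \<open>auto simp: r_def field_simps\<close>)
      qed
      also have "\<dots> \<le> (4 * real T / h + 2) * \<epsilon> powr - \<alpha>"
      proof -
        have "real (T * 2 ^ m) / real L \<le> real (T * 2 ^ m) / (r * 2 ^ m / 2)"
          using L r by (intro divide_left_mono) auto
        also have "\<dots> = 2 * real T / r" using r by simp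
        also have "\<dots> = 2 * real T / h * \<epsilon> powr - \<alpha>" by (simp add: r_def powr_minus divide_simps)
        finally have "real (T * 2 ^ m) / real L \<le> 2 * real T / h * \<epsilon> powr - \<alpha>" .
        moreover have "1 \<le> \<epsilon> powr - \<alpha>"
        proof -
          have "\<epsilon> powr \<alpha> \<le> 1" using \<epsilon> index_pos by (intro powr_le1) auto
          then show ?thesis using \<epsilon> by (simp add: powr_minus field_simps)
        qed
        moreover have "2 * (x + 1) \<le> 2 * y + 2 * z" if "x \<le> y" "1 \<le> z" for x y z :: real
          using add_mono[OF that] by simp
        ultimately have "2 * (real (T * 2 ^ m) / real L + 1) \<le> 2 * (2 * real T / h * \<epsilon> powr - \<alpha>) + 2 * \<epsilon> powr - \<alpha>"
          by blast
        also have "\<dots> = (4 * real T / h + 2) * \<epsilon> powr - \<alpha>" by (simp add: algebra_simps)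
        finally show ?thesis .
      qed
      finally show "(\<integral>\<^sup>+ \<omega>. ennreal (real (hits T \<epsilon> m \<omega>)) \<partial>M) \<le> ennreal ((4 * real T / h + 2) * \<epsilon> powr - \<alpha>)"
        unfolding nn_integral_hits by (rule ennreal_leI)
    qed
  qed (use h in simp)
qed

end

text \<open>Fatou bounds the mean of each lower limit. Weighted by
  \<open>2 powr - (real k * (a + \<eta>))\<close> the bounds form a geometric series, so the
  weighted sum of the lower limits is almost surely finite, and its value \<open>g\<close> serves
  all scales \<open>k\<close> at once.\<close>

lemma (in prob_space) AE_liminf_bound:
  fixes N :: "nat \<Rightarrow> nat \<Rightarrow> 'a \<Rightarrow> real"
  assumes meas: "\<And>k m. (\<lambda>\<omega>. ennreal (N k m \<omega>)) \<in> borel_measurable M"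
    and bound: "\<And>k. \<forall>\<^sub>F m in sequentially. (\<integral>\<^sup>+ \<omega>. ennreal (N k m \<omega>) \<partial>M) \<le> ennreal (C * 2 powr (real k * a))"
    and C: "0 \<le> C" and \<eta>: "0 < \<eta>"
  shows "AE \<omega> in M. \<exists>g\<ge>0. \<forall>k. \<exists>\<^sub>F m in sequentially. N k m \<omega> < g * 2 powr (real k * (a + \<eta>)) + 1"
proof -
  define l where "l k \<omega> = liminf (\<lambda>m. ennreal (N k m \<omega>))" for k \<omega>
  define G where "G \<omega> = (\<Sum>k. ennreal (2 powr - (real k * (a + \<eta>))) * l k \<omega>)" for \<omega>
  have l_meas [measurable]: "l k \<in> borel_measurable M" for k
    unfolding l_def[abs_def] using meas by (intro borel_measurable_liminf)
  have "(\<integral>\<^sup>+ \<omega>. l k \<omega> \<partial>M) \<le> ennreal (C * 2 powr (real k * a))" for k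
  proof -
    have "(\<integral>\<^sup>+ \<omega>. l k \<omega> \<partial>M) \<le> liminf (\<lambda>m. \<integral>\<^sup>+ \<omega>. ennreal (N k m \<omega>) \<partial>M)"
      unfolding l_def using meas by (intro nn_integral_liminf)
    also have "\<dots> \<le> limsup (\<lambda>m. \<integral>\<^sup>+ \<omega>. ennreal (N k m \<omega>) \<partial>M)" by (intro Liminf_le_Limsup) simp
    also have "\<dots> \<le> ennreal (C * 2 powr (real k * a))" using bound by (intro Limsup_bounded)
    finally show ?thesis .
  qed
  then have lk: "(\<integral>\<^sup>+ \<omega>. ennreal (2 powr - (real k * (a + \<eta>))) * l k \<omega> \<partial>M) \<le> ennreal (C * (2 powr - \<eta>) ^ k)" for k
  proof -
    have "(\<integral>\<^sup>+ \<omega>. ennreal (2 powr - (real k * (a + \<eta>))) * l k \<omega> \<partial>M) = ennreal (2 powr - (real k * (a + \<eta>))) * (\<integral>\<^sup>+ \<omega>. l k \<omega> \<partial>M)"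
      by (rule nn_integral_cmult) simp
    also have "\<dots> \<le> ennreal (2 powr - (real k * (a + \<eta>))) * ennreal (C * 2 powr (real k * a))"
      using \<open>(\<integral>\<^sup>+ \<omega>. l k \<omega> \<partial>M) \<le> ennreal (C * 2 powr (real k * a))\<close> by (intro mult_left_mono) auto
    also have "\<dots> = ennreal (C * (2 powr - (real k * (a + \<eta>)) * 2 powr (real k * a)))"
      using C by (simp add: ennreal_mult[symmetric] mult_ac)
    also have "2 powr - (real k * (a + \<eta>)) * 2 powr (real k * a) = (2 powr - \<eta>) ^ k"
    proof -
      have "- (real k * (a + \<eta>)) + real k * a = - \<eta> * real k" by (simp add: algebra_simps)
      then have "2 powr - (real k * (a + \<eta>)) * 2 powr (real k * a) = 2 powr (- \<eta> * real k)"
        by (simp only: powr_add[symmetric])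
      then show ?thesis by (simp add: powr_power mult.commute)
    qed
    finally show ?thesis .
  qed
  have q: "2 powr - \<eta> < 1" using \<eta> powr_less_mono[of "- \<eta>" 0 2] by simp
  have "(\<integral>\<^sup>+ \<omega>. G \<omega> \<partial>M) = (\<Sum>k. \<integral>\<^sup>+ \<omega>. ennreal (2 powr - (real k * (a + \<eta>))) * l k \<omega> \<partial>M)"
    unfolding G_def by (intro nn_integral_suminf) measurable
  also have "\<dots> \<le> (\<Sum>k. ennreal (C * (2 powr - \<eta>) ^ k))" by (intro suminf_le lk) auto
  also have "\<dots> = ennreal (\<Sum>k. C * (2 powr - \<eta>) ^ k)"
    using C q by (intro suminf_ennreal2 summable_mult summable_geometric) auto
  finally have "(\<integral>\<^sup>+ \<omega>. G \<omega> \<partial>M) \<noteq> \<infinity>" by (auto simp: top_unique)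
  then have "AE \<omega> in M. G \<omega> \<noteq> \<infinity>"
    unfolding G_def[abs_def] by (intro nn_integral_PInf_AE) measurable
  then show ?thesis
  proof eventually_elim
    case (elim \<omega>)
    then obtain g where g: "G \<omega> = ennreal g" "0 \<le> g" by (cases "G \<omega>") auto
    have "\<exists>\<^sub>F m in sequentially. N k m \<omega> < g * 2 powr (real k * (a + \<eta>)) + 1" for k
    proof (rule ccontr)
      \<comment> \<open>The extra 1 makes the comparison strict: otherwise the \<open>k\<close>-th
        summand alone would exceed \<open>g\<close>.\<close>
      let ?v = "g * 2 powr (real k * (a + \<eta>)) + 1"
      assume "\<not> (\<exists>\<^sub>F m in sequentially. N k m \<omega> < ?v)"
      then have "\<forall>\<^sub>F m in sequentially. ennreal ?v \<le> ennreal (N k m \<omega>)"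
        unfolding not_frequently by (auto elim!: eventually_mono intro!: ennreal_leI)
      then have lv: "ennreal ?v \<le> l k \<omega>" unfolding l_def by (rule Liminf_bounded)
      have "ennreal (2 powr - (real k * (a + \<eta>))) * l k \<omega> \<le> G \<omega>"
        unfolding G_def using sum_le_suminf[OF summableI, of "{k}" "\<lambda>k. ennreal (2 powr - (real k * (a + \<eta>))) * l k \<omega>"] by simp
      moreover have "ennreal (2 powr - (real k * (a + \<eta>))) * ennreal ?v \<le> ennreal (2 powr - (real k * (a + \<eta>))) * l k \<omega>"
        using lv by (rule mult_left_mono) simp
      ultimately have "ennreal (2 powr - (real k * (a + \<eta>))) * ennreal ?v \<le> ennreal g"
        unfolding g(1) by (rule order_trans[rotated])
      then have "ennreal (2 powr - (real k * (a + \<eta>)) * ?v) \<le> ennreal g"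
        using g(2) by (subst ennreal_mult) (auto simp del: ennreal_plus)
      then have "2 powr - (real k * (a + \<eta>)) * ?v \<le> g"
        using g(2) by (subst (asm) ennreal_le_iff)
      moreover define P where "P = 2 powr (real k * (a + \<eta>))"
      ultimately have "1 / P * (g * P + 1) \<le> g" by (simp only: powr_minus_divide)
      moreover have "0 < P" by (simp add: P_def)
      ultimately show False by (simp add: field_simps)
    qed
    then show ?case using g(2) by blast
  qed
qed

context stable_motion
begin

lemma AE_osc_growth_fixed:
  assumes \<eta>: "0 < \<eta>"
  shows "AE \<omega> in M. \<exists>C. \<forall>k::nat. \<exists>n. osc_index (\<lambda>t. Y t \<omega>) (real T) (2 powr - real k) n \<and> real n \<le> C * 2 powr (real k * (\<alpha> + \<eta>))"
proof -
  obtain C where C: "0 \<le> C" "\<And>\<epsilon>. 0 < \<epsilon> \<Longrightarrow> \<epsilon> \<le> 1 \<Longrightarrow>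
    \<forall>\<^sub>F m in sequentially. (\<integral>\<^sup>+ \<omega>. ennreal (real (hits T \<epsilon> m \<omega>)) \<partial>M) \<le> ennreal (C * \<epsilon> powr - \<alpha>)"
    by (rule expected_hits_bound) blast
  have "AE \<omega> in M. \<exists>g\<ge>0. \<forall>k. \<exists>\<^sub>F m in sequentially. real (hits T (2 powr - real k) m \<omega>) < g * 2 powr (real k * (\<alpha> + \<eta>)) + 1"
  proof (rule AE_liminf_bound[OF measurable_hits _ C(1) \<eta>])
    fix k
    have "(2 powr - real k) powr - \<alpha> = 2 powr (real k * \<alpha>)" by (simp add: powr_powr)
    then show "\<forall>\<^sub>F m in sequentially. (\<integral>\<^sup>+ \<omega>. ennreal (real (hits T (2 powr - real k) m \<omega>)) \<partial>M) \<le> ennreal (C * 2 powr (real k * \<alpha>))"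
      using C(2)[of "2 powr - real k"] powr_mono[of "- real k" 0 2] by simp
  qed
  then show ?thesis
    using AE_cadlag
  proof eventually_elim
    case (elim \<omega>)
    then obtain g where g: "0 \<le> g" "\<And>k. \<exists>\<^sub>F m in sequentially. real (hits T (2 powr - real k) m \<omega>) < g * 2 powr (real k * (\<alpha> + \<eta>)) + 1"
      by blast
    \<comment> \<open>The oscillation index at scale \<open>k\<close> comes from resets at half that
      size, \<open>2 powr - real (Suc k)\<close>; the shift by one scale contributes
      \<open>2 powr (\<alpha> + \<eta>)\<close>.\<close>
    define C' where "C' = g * 2 powr (\<alpha> + \<eta>) + 1"
    have "\<exists>n. osc_index (\<lambda>t. Y t \<omega>) (real T) (2 powr - real k) n \<and> real n \<le> C' * 2 powr (real k * (\<alpha> + \<eta>))" for k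
    proof -
      let ?v = "g * 2 powr (real (Suc k) * (\<alpha> + \<eta>)) + 1"
      let ?\<epsilon> = "2 powr - real (Suc k)"
      define n where "n = nat \<lfloor>?v\<rfloor>"
      have v: "0 \<le> ?v" using g(1) by simp
      have "osc_index (\<lambda>t. Y t \<omega>) (real T) (2 * ?\<epsilon>) n"
      proof (rule osc_index_of_frequently_few_hits)
        show "continuous (at_right x) (\<lambda>t. Y t \<omega>)" if "0 \<le> x" for x
          using elim(2) that by (simp add: cadlag_def)
        have "\<exists>\<^sub>F m in sequentially. hits T ?\<epsilon> m \<omega> \<le> n"
          using g(2)[of "Suc k"]
        proof (rule frequently_elim1)
          fix m assume "real (hits T ?\<epsilon> m \<omega>) < ?v"
          then show "hits T ?\<epsilon> m \<omega> \<le> n" unfolding n_def by linarith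
        qed
        then show "\<exists>\<^sub>F m in sequentially. card {j. j < T * 2 ^ m \<and>
            hit ?\<epsilon> (\<lambda>j. Y (real (Suc j) / 2 ^ m) \<omega> - Y (real j / 2 ^ m) \<omega>) j} \<le> n"
          by (simp only: hits_def step_def)
      qed simp
      moreover have "2 * ?\<epsilon> = 2 powr - real k" by (simp add: powr_diff powr_minus divide_simps)
      moreover have "real n \<le> C' * 2 powr (real k * (\<alpha> + \<eta>))"
      proof -
        have "real n \<le> ?v" using v unfolding n_def by linarith
        also have "real (Suc k) * (\<alpha> + \<eta>) = (\<alpha> + \<eta>) + real k * (\<alpha> + \<eta>)" by (simp add: algebra_simps)
        also have "g * 2 powr ((\<alpha> + \<eta>) + real k * (\<alpha> + \<eta>)) + 1 \<le> C' * 2 powr (real k * (\<alpha> + \<eta>))"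
        proof -
          have "1 \<le> 2 powr (real k * (\<alpha> + \<eta>))" using index_pos \<eta> by (intro ge_one_powr_ge_zero) auto
          then show ?thesis unfolding C'_def powr_add[of 2 "\<alpha> + \<eta>"] by (simp add: distrib_right mult.assoc)
        qed
        finally show ?thesis .
      qed
      ultimately show ?thesis by auto
    qed
    then show ?case by blast
  qed
qed

theorem AE_osc_growth: "AE \<omega> in M. osc_growth (\<lambda>t. Y t \<omega>) \<alpha>"
proof -
  have "AE \<omega> in M. \<forall>T i. \<exists>C. \<forall>k::nat. \<exists>n. osc_index (\<lambda>t. Y t \<omega>) (real T) (2 powr - real k) n \<and>
    real n \<le> C * 2 powr (real k * (\<alpha> + 1 / real (Suc i)))"
    unfolding AE_all_countable by (intro allI AE_osc_growth_fixed) simp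
  then show ?thesis
  proof eventually_elim
    case (elim \<omega>)
    show ?case
      unfolding osc_growth_def
    proof (intro allI impI)
      fix T :: nat and \<eta> :: real assume "0 < \<eta>"
      then obtain i where i: "1 / real (Suc i) < \<eta>" using nat_approx_posE by blast
      obtain C where C: "\<And>k. \<exists>n. osc_index (\<lambda>t. Y t \<omega>) (real T) (2 powr - real k) n \<and>
        real n \<le> C * 2 powr (real k * (\<alpha> + 1 / real (Suc i)))" using elim by blast
      have C0: "0 \<le> C" using C[of 0] by (auto intro: order_trans[OF of_nat_0_le_iff])
      have "C * 2 powr (real k * (\<alpha> + 1 / real (Suc i))) \<le> C * 2 powr (real k * (\<alpha> + \<eta>))" for k
        using i C0 by (intro mult_left_mono powr_mono) auto
      then show "\<exists>C. \<forall>k. \<exists>n. osc_index (\<lambda>t. Y t \<omega>) (real T) (2 powr - real k) n \<and> real n \<le> C * 2 powr (real k * (\<alpha> + \<eta>))"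
        using C by (meson order_trans)
    qed
  qed
qed

end

section \<open>Finite energy\<close>

text \<open>
  The integral of \<open>\<Sum>n. 2 powr (n * \<gamma>) * \<mu> {t. dist (f s) (f t) \<le> 2 powr - n}\<close> over \<open>s\<close> is a
  discrete form of the \<open>\<gamma>\<close>-energy of the occupation measure. If it is finite, then the sum is bounded
  on a set of positive measure, where the mass distribution principle applies.
\<close>

lemma (in prob_space) AE_hausdorff_measure_ne_0:
  fixes \<mu> :: "'s measure" and f :: "'s \<Rightarrow> 'a \<Rightarrow> 'b::euclidean_space"
  assumes \<mu>: "finite_measure \<mu>" "emeasure \<mu> (space \<mu>) \<noteq> 0"
    and meas [measurable]: "(\<lambda>(\<omega>, s). f s \<omega>) \<in> borel_measurable (M \<Otimes>\<^sub>M \<mu>)"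
    and energy: "\<And>n::nat. (\<integral>\<^sup>+ s. \<integral>\<^sup>+ t. emeasure M {\<omega>\<in>space M. dist (f s \<omega>) (f t \<omega>) \<le> 2 powr - real n} \<partial>\<mu> \<partial>\<mu>)
      \<le> ennreal (C * 2 powr (- real n * g))"
    and \<gamma>: "0 < \<gamma>" "\<gamma> < g" and C: "0 \<le> C"
  shows "AE \<omega> in M. hausdorff_measure \<gamma> ((\<lambda>s. f s \<omega>) ` space \<mu>) \<noteq> 0"
proof -
  interpret \<mu>: finite_measure \<mu> by fact
  interpret P: pair_sigma_finite M \<mu> ..
  define c where "c n = (2::real) powr (real n * \<gamma>)" for n
  define r where "r n = (2::real) powr - real n" for n
  have m1 [measurable]: "f s \<in> borel_measurable M" if "s \<in> space \<mu>" for s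
    using measurable_compose[OF measurable_Pair2'[OF that] meas] by simp
  have m2 [measurable]: "(\<lambda>s. f s \<omega>) \<in> borel_measurable \<mu>" if "\<omega> \<in> space M" for \<omega>
    using measurable_compose[OF measurable_Pair1'[OF that] meas] by simp
  define I where "I n \<omega> s t = (indicator {p. dist (fst p) (snd p) \<le> r n} (f s \<omega>, f t \<omega>) :: ennreal)" for n \<omega> s t
  have I_meas [measurable]: "(\<lambda>x. I n (fst (fst x)) (snd (fst x)) (snd x)) \<in> borel_measurable ((M \<Otimes>\<^sub>M \<mu>) \<Otimes>\<^sub>M \<mu>)" for n
  proof -
    have S: "{p::'b \<times> 'b. dist (fst p) (snd p) \<le> r n} \<in> sets borel"
      by (intro borel_closed closed_Collect_le continuous_intros)
    have [measurable]: "(\<lambda>x. f (snd (fst x)) (fst (fst x))) \<in> borel_measurable ((M \<Otimes>\<^sub>M \<mu>) \<Otimes>\<^sub>M \<mu>)"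
      "(\<lambda>x. f (snd x) (fst (fst x))) \<in> borel_measurable ((M \<Otimes>\<^sub>M \<mu>) \<Otimes>\<^sub>M \<mu>)"
      using measurable_compose[OF _ meas, of "\<lambda>x. fst x" "(M \<Otimes>\<^sub>M \<mu>) \<Otimes>\<^sub>M \<mu>"]
        measurable_compose[OF _ meas, of "\<lambda>x. (fst (fst x), snd x)" "(M \<Otimes>\<^sub>M \<mu>) \<Otimes>\<^sub>M \<mu>"]
      by (auto simp: case_prod_beta)
    have "(\<lambda>x. (f (snd (fst x)) (fst (fst x)), f (snd x) (fst (fst x)))) \<in> borel_measurable ((M \<Otimes>\<^sub>M \<mu>) \<Otimes>\<^sub>M \<mu>)"
      unfolding borel_prod[symmetric] by measurable
    from measurable_compose[OF this borel_measurable_indicator[OF S]] show ?thesis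
      unfolding I_def .
  qed
  define l where "l n \<omega> s = (\<integral>\<^sup>+ t. I n \<omega> s t \<partial>\<mu>)" for n \<omega> s
  have l_meas [measurable]: "(\<lambda>x. l n (fst x) (snd x)) \<in> borel_measurable (M \<Otimes>\<^sub>M \<mu>)" for n
    unfolding l_def by measurable
  have l_eq: "l n \<omega> s = emeasure \<mu> {t\<in>space \<mu>. dist (f s \<omega>) (f t \<omega>) \<le> r n}" if "\<omega> \<in> space M" for n \<omega> s
  proof -
    have [measurable]: "(\<lambda>t. f t \<omega>) \<in> borel_measurable \<mu>" using m2 that .
    have "l n \<omega> s = (\<integral>\<^sup>+ t. indicator {t\<in>space \<mu>. dist (f s \<omega>) (f t \<omega>) \<le> r n} t \<partial>\<mu>)"
      unfolding l_def I_def by (intro nn_integral_cong) (auto simp: indicator_def)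
    also have "\<dots> = emeasure \<mu> {t\<in>space \<mu>. dist (f s \<omega>) (f t \<omega>) \<le> r n}"
      by (rule nn_integral_indicator) measurable
    finally show ?thesis .
  qed
  have l_int: "(\<integral>\<^sup>+ \<omega>. \<integral>\<^sup>+ s. l n \<omega> s \<partial>\<mu> \<partial>M) \<le> ennreal (C * 2 powr (- real n * g))" for n
  proof -
    have "(\<integral>\<^sup>+ \<omega>. \<integral>\<^sup>+ s. l n \<omega> s \<partial>\<mu> \<partial>M) = (\<integral>\<^sup>+ s. \<integral>\<^sup>+ \<omega>. l n \<omega> s \<partial>M \<partial>\<mu>)"
      by (rule P.Fubini'[symmetric]) measurable
    also have "\<dots> = (\<integral>\<^sup>+ s. \<integral>\<^sup>+ t. \<integral>\<^sup>+ \<omega>. I n \<omega> s t \<partial>M \<partial>\<mu> \<partial>\<mu>)"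
    proof (rule nn_integral_cong)
      fix s assume s: "s \<in> space \<mu>"
      have "(\<lambda>(\<omega>, t). I n \<omega> s t) \<in> borel_measurable (M \<Otimes>\<^sub>M \<mu>)"
        using measurable_compose[OF _ I_meas, of "\<lambda>x. ((fst x, s), snd x)" "M \<Otimes>\<^sub>M \<mu>"] s
        by (simp add: case_prod_beta)
      then show "(\<integral>\<^sup>+ \<omega>. l n \<omega> s \<partial>M) = (\<integral>\<^sup>+ t. \<integral>\<^sup>+ \<omega>. I n \<omega> s t \<partial>M \<partial>\<mu>)"
        unfolding l_def by (intro P.Fubini'[symmetric])
    qed
    also have "\<dots> = (\<integral>\<^sup>+ s. \<integral>\<^sup>+ t. emeasure M {\<omega>\<in>space M. dist (f s \<omega>) (f t \<omega>) \<le> 2 powr - real n} \<partial>\<mu> \<partial>\<mu>)"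
    proof (intro nn_integral_cong)
      fix s t assume s: "s \<in> space \<mu>" "t \<in> space \<mu>"
      have [measurable]: "f s \<in> borel_measurable M" "f t \<in> borel_measurable M" using m1 s by auto
      have "(\<integral>\<^sup>+ \<omega>. I n \<omega> s t \<partial>M) = (\<integral>\<^sup>+ \<omega>. indicator {\<omega>\<in>space M. dist (f s \<omega>) (f t \<omega>) \<le> r n} \<omega> \<partial>M)"
        unfolding I_def by (intro nn_integral_cong) (auto simp: indicator_def)
      also have "\<dots> = emeasure M {\<omega>\<in>space M. dist (f s \<omega>) (f t \<omega>) \<le> r n}"
        by (rule nn_integral_indicator) measurable
      finally show "(\<integral>\<^sup>+ \<omega>. I n \<omega> s t \<partial>M) = emeasure M {\<omega>\<in>space M. dist (f s \<omega>) (f t \<omega>) \<le> 2 powr - real n}"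
        by (simp only: r_def)
    qed
    also have "\<dots> \<le> ennreal (C * 2 powr (- real n * g))" by (rule energy)
    finally show ?thesis .
  qed
  define \<phi> where "\<phi> \<omega> s = (\<Sum>n. ennreal (c n) * l n \<omega> s)" for \<omega> s
  have \<phi>_meas [measurable]: "(\<lambda>x. \<phi> (fst x) (snd x)) \<in> borel_measurable (M \<Otimes>\<^sub>M \<mu>)"
    unfolding \<phi>_def by measurable
  have c_int: "(\<integral>\<^sup>+ \<omega>. \<integral>\<^sup>+ s. \<phi> \<omega> s \<partial>\<mu> \<partial>M) \<le> (\<Sum>n. ennreal (C * (2 powr (\<gamma> - g)) ^ n))"
  proof -
    have "(\<integral>\<^sup>+ s. \<phi> \<omega> s \<partial>\<mu>) = (\<Sum>n. ennreal (c n) * (\<integral>\<^sup>+ s. l n \<omega> s \<partial>\<mu>))" if "\<omega> \<in> space M" for \<omega>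
    proof -
      have ls: "(\<lambda>s. l n \<omega> s) \<in> borel_measurable \<mu>" for n
        using measurable_compose[OF measurable_Pair1'[OF that] l_meas] by simp
      have "(\<integral>\<^sup>+ s. \<phi> \<omega> s \<partial>\<mu>) = (\<Sum>n. \<integral>\<^sup>+ s. ennreal (c n) * l n \<omega> s \<partial>\<mu>)"
        unfolding \<phi>_def using ls by (intro nn_integral_suminf) measurable
      also have "\<dots> = (\<Sum>n. ennreal (c n) * (\<integral>\<^sup>+ s. l n \<omega> s \<partial>\<mu>))"
        using ls by (intro suminf_cong nn_integral_cmult)
      finally show ?thesis .
    qed
    then have "(\<integral>\<^sup>+ \<omega>. \<integral>\<^sup>+ s. \<phi> \<omega> s \<partial>\<mu> \<partial>M) = (\<integral>\<^sup>+ \<omega>. (\<Sum>n. ennreal (c n) * (\<integral>\<^sup>+ s. l n \<omega> s \<partial>\<mu>)) \<partial>M)"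
      by (intro nn_integral_cong)
    also have "\<dots> = (\<Sum>n. \<integral>\<^sup>+ \<omega>. ennreal (c n) * (\<integral>\<^sup>+ s. l n \<omega> s \<partial>\<mu>) \<partial>M)"
      by (intro nn_integral_suminf) measurable
    also have "\<dots> = (\<Sum>n. ennreal (c n) * (\<integral>\<^sup>+ \<omega>. \<integral>\<^sup>+ s. l n \<omega> s \<partial>\<mu> \<partial>M))"
      by (intro suminf_cong nn_integral_cmult) measurable
    also have "\<dots> \<le> (\<Sum>n. ennreal (c n) * ennreal (C * 2 powr (- real n * g)))"
      by (intro suminf_le mult_left_mono l_int) auto
    also have "\<dots> = (\<Sum>n. ennreal (C * (2 powr (\<gamma> - g)) ^ n))"
    proof (rule suminf_cong)
      fix n
      have "real n * \<gamma> + - real n * g = (\<gamma> - g) * real n" by (simp add: algebra_simps)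
      then have "c n * 2 powr (- real n * g) = (2 powr (\<gamma> - g)) ^ n"
        unfolding c_def powr_add[symmetric] by (simp add: powr_power mult.commute)
      then have "c n * (C * 2 powr (- real n * g)) = C * (2 powr (\<gamma> - g)) ^ n" by (simp add: mult_ac)
      then show "ennreal (c n) * ennreal (C * 2 powr (- real n * g)) = ennreal (C * (2 powr (\<gamma> - g)) ^ n)"
        using C by (subst ennreal_mult[symmetric]) (auto simp: c_def)
    qed
    finally show ?thesis .
  qed
  also have "\<dots> = ennreal (\<Sum>n. C * (2 powr (\<gamma> - g)) ^ n)"
  proof -
    have "2 powr (\<gamma> - g) < 1" using \<gamma> powr_less_mono[of "\<gamma> - g" 0 2] by simp
    then show ?thesis using C by (intro suminf_ennreal2 summable_mult summable_geometric) auto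
  qed
  finally have "(\<integral>\<^sup>+ \<omega>. \<integral>\<^sup>+ s. \<phi> \<omega> s \<partial>\<mu> \<partial>M) \<noteq> \<infinity>" by (auto simp: top_unique)
  then have "AE \<omega> in M. (\<integral>\<^sup>+ s. \<phi> \<omega> s \<partial>\<mu>) \<noteq> \<infinity>"
    by (intro nn_integral_PInf_AE) measurable
  then show ?thesis
    using AE_space
  proof eventually_elim
    case (elim \<omega>)
    have f\<omega> [measurable]: "(\<lambda>s. f s \<omega>) \<in> borel_measurable \<mu>" using m2 elim(2) .
    have \<phi>\<omega> [measurable]: "(\<lambda>s. \<phi> \<omega> s) \<in> borel_measurable \<mu>"
      using measurable_compose[OF measurable_Pair1'[OF elim(2)] \<phi>_meas] by simp
    have fin: "AE s in \<mu>. \<phi> \<omega> s \<noteq> \<infinity>" by (rule nn_integral_PInf_AE[OF \<phi>\<omega> elim(1)])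
    \<comment> \<open>\<open>\<phi> \<omega>\<close> is finite almost everywhere, so some sublevel
      set has positive measure; on it every term of the series is at most \<open>k\<close>.\<close>
    define G where "G k = {s\<in>space \<mu>. \<phi> \<omega> s \<le> ennreal (real k)}" for k :: nat
    have G_sets: "G k \<in> sets \<mu>" for k unfolding G_def by measurable
    have "\<exists>k. emeasure \<mu> (G k) \<noteq> 0"
    proof (rule ccontr)
      assume "\<not> ?thesis"
      then have "(\<Union>k. G k) \<in> null_sets \<mu>" using G_sets by (intro null_sets_UN) auto
      then have "AE s in \<mu>. s \<notin> (\<Union>k. G k)" by (rule AE_not_in)
      with fin have "AE s in \<mu>. False"
        using AE_space
      proof eventually_elim
        case (elim s)
        then obtain v where v: "\<phi> \<omega> s = ennreal v" "0 \<le> v" by (cases "\<phi> \<omega> s") auto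
        obtain k :: nat where "v \<le> real k" using real_arch_simple by blast
        then have "s \<in> G k" using v elim by (simp add: G_def ennreal_leI)
        then show ?case using elim by blast
      qed
      then have "emeasure \<mu> (space \<mu>) = 0" by (simp add: AE_iff_measurable[OF _ refl])
      then show False using \<mu>(2) by simp
    qed
    then obtain k where k: "emeasure \<mu> (G k) \<noteq> 0" by blast
    \<comment> \<open>A single term of the series bounds the mass of a ball of dyadic radius;
      rounding a radius up to the next dyadic one costs \<open>2 powr \<gamma>\<close>.\<close>
    show ?case
    proof (rule hausdorff_measure_mass_distribution[OF G_sets k, where K = "real k * 2 powr \<gamma>" and \<delta> = 1])
      show "(\<lambda>s. f s \<omega>) ` G k \<subseteq> (\<lambda>s. f s \<omega>) ` space \<mu>" by (auto simp: G_def)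
      show "(\<lambda>t. dist (f s \<omega>) (f t \<omega>)) \<in> borel_measurable \<mu>" for s by measurable
      show "emeasure \<mu> {t\<in>space \<mu>. dist (f s \<omega>) (f t \<omega>) \<le> \<rho>'} \<le> ennreal (real k * 2 powr \<gamma> * \<rho>' powr \<gamma>)"
        if s: "s \<in> G k" and \<rho>: "0 < \<rho>'" "\<rho>' \<le> 1" for s \<rho>'
      proof -
        have "\<rho>' \<le> 2 powr - real 0" using \<rho> by simp
        then obtain n where n: "2 powr - real (Suc n) < \<rho>'" "\<rho>' \<le> 2 powr - real n"
          using exists_dyadic_scale[OF \<rho>(1), of 0] by blast
        have "emeasure \<mu> {t\<in>space \<mu>. dist (f s \<omega>) (f t \<omega>) \<le> \<rho>'} \<le> emeasure \<mu> {t\<in>space \<mu>. dist (f s \<omega>) (f t \<omega>) \<le> r n}"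
          using n(2) by (intro emeasure_mono) (auto simp: r_def)
        also have "\<dots> = l n \<omega> s" by (rule l_eq[OF elim(2), symmetric])
        also have "l n \<omega> s = ennreal (2 powr (- real n * \<gamma>)) * (ennreal (c n) * l n \<omega> s)"
        proof -
          have "2 powr (- real n * \<gamma>) * c n = 1" unfolding c_def powr_add[symmetric] by simp
          moreover have "ennreal (2 powr (- real n * \<gamma>)) * ennreal (c n) = ennreal (2 powr (- real n * \<gamma>) * c n)"
            by (rule ennreal_mult[symmetric]) (auto simp: c_def)
          ultimately have "ennreal (2 powr (- real n * \<gamma>)) * ennreal (c n) = 1" by (simp only: ennreal_1)
          then show ?thesis by (simp add: mult.assoc[symmetric])
        qed
        also have "\<dots> \<le> ennreal (2 powr (- real n * \<gamma>)) * ennreal (real k)"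
        proof (rule mult_left_mono)
          have "ennreal (c n) * l n \<omega> s \<le> \<phi> \<omega> s"
            unfolding \<phi>_def using sum_le_suminf[OF summableI, of "{n}" "\<lambda>n. ennreal (c n) * l n \<omega> s"] by simp
          also have "\<dots> \<le> ennreal (real k)" using s by (simp add: G_def)
          finally show "ennreal (c n) * l n \<omega> s \<le> ennreal (real k)" .
        qed simp
        also have "\<dots> = ennreal (2 powr (- real n * \<gamma>) * real k)" by (simp add: ennreal_mult)
        also have "\<dots> \<le> ennreal (real k * 2 powr \<gamma> * \<rho>' powr \<gamma>)"
        proof (rule ennreal_leI)
          have "2 powr (- real n * \<gamma>) = 2 powr \<gamma> * (2 powr - real (Suc n)) powr \<gamma>"
            unfolding powr_powr powr_add[symmetric] by (simp add: algebra_simps)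
          also have "\<dots> \<le> 2 powr \<gamma> * \<rho>' powr \<gamma>"
            using n(1) \<gamma> by (intro mult_left_mono powr_mono2) auto
          finally have "2 powr (- real n * \<gamma>) * real k \<le> 2 powr \<gamma> * \<rho>' powr \<gamma> * real k"
            by (rule mult_right_mono) simp
          then show "2 powr (- real n * \<gamma>) * real k \<le> real k * 2 powr \<gamma> * \<rho>' powr \<gamma>" by (simp add: mult_ac)
        qed
        finally show ?thesis .
      qed
    qed (use \<gamma> in auto)
  qed
qed

text \<open>Countably many exponents tending to \<open>d\<close> suffice, so that almost sure
  statements can be intersected; \<open>n + 2\<close> keeps all of them positive.\<close>

lemma hausdorff_dim_geI_seq:
  fixes A :: "'a::metric_space set"
  assumes "0 < d" "\<And>n::nat. hausdorff_measure (d * (1 - 1 / real (n + 2))) A \<noteq> 0"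
  shows "ereal d \<le> hausdorff_dim A"
proof (rule hausdorff_dim_geI)
  fix s assume s: "0 < s" "s < d"
  then obtain n where n: "1 / real (Suc n) < (d - s) / d" using nat_approx_posE[of "(d - s) / d"] by auto
  have "1 / real (n + 2) \<le> 1 / real (Suc n)" by (simp add: divide_simps)
  then have "d * (1 / real (n + 2)) \<le> d * ((d - s) / d)" using n assms(1) by (intro mult_left_mono) auto
  also have "\<dots> = d - s" using assms(1) by simp
  finally have "s \<le> d * (1 - 1 / real (n + 2))" by (simp add: right_diff_distrib)
  then show "hausdorff_measure s A \<noteq> 0" using hausdorff_measure_eq_0_mono_exponent assms(2) by blast
qed

lemma nn_integral_abs_powr_finite:
  fixes T \<kappa> :: real
  assumes "\<kappa> < 1"
  obtains J where "0 \<le> J" "\<And>s. s \<in> {0..T} \<Longrightarrow>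
    (\<integral>\<^sup>+ t. ennreal (\<bar>t - s\<bar> powr - \<kappa>) * indicator {0..T} t \<partial>lborel) \<le> ennreal J"
proof (cases "0 \<le> T")
  case True
  define h where "h u = ennreal (u powr - \<kappa>) * indicator {0..T} u" for u :: real
  have [measurable]: "h \<in> borel_measurable borel" unfolding h_def by measurable
  have "((\<lambda>u. u powr - \<kappa>) has_integral (T powr (1 - \<kappa>) / (1 - \<kappa>))) {0..T}"
    using has_integral_powr_from_0[of "- \<kappa>" T] assms True by simp
  then have "((\<lambda>u. if u \<in> {0..T} then u powr - \<kappa> else 0) has_integral (T powr (1 - \<kappa>) / (1 - \<kappa>))) UNIV"
    by (simp only: has_integral_restrict_UNIV)
  moreover have "(\<lambda>u. if u \<in> {0..T} then u powr - \<kappa> else 0) = (\<lambda>u. u powr - \<kappa> * indicator {0..T} u)"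
    by (auto simp: fun_eq_iff indicator_def)
  ultimately have hi: "((\<lambda>u. u powr - \<kappa> * indicator {0..T} u) has_integral (T powr (1 - \<kappa>) / (1 - \<kappa>))) UNIV"
    by (simp only:)
  define I where "I = T powr (1 - \<kappa>) / (1 - \<kappa>)"
  have I0: "0 \<le> I" using assms by (simp add: I_def)
  have "(\<integral>\<^sup>+ u. ennreal (u powr - \<kappa> * indicator {0..T} u) \<partial>lborel) = ennreal I"
    unfolding I_def by (rule nn_integral_has_integral_lborel[OF _ _ hi]) auto
  moreover have "ennreal (u powr - \<kappa> * indicator {0..T} u) = h u" for u
    by (simp add: h_def indicator_def)
  ultimately have hI: "(\<integral>\<^sup>+ u. h u \<partial>lborel) = ennreal I" by simp
  have "(\<integral>\<^sup>+ t. ennreal (\<bar>t - s\<bar> powr - \<kappa>) * indicator {0..T} t \<partial>lborel) \<le> ennreal (2 * I)" if s: "s \<in> {0..T}" for s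
  proof -
    \<comment> \<open>The parts on both sides of the singularity at \<open>s\<close> are translated,
      and the left one is reflected, into the same integral over \<open>{0..T}\<close>.\<close>
    have "(\<integral>\<^sup>+ t. ennreal (\<bar>t - s\<bar> powr - \<kappa>) * indicator {0..T} t \<partial>lborel) \<le> (\<integral>\<^sup>+ t. h (- s + 1 * t) + h (s + (-1) * t) \<partial>lborel)"
      using s by (intro nn_integral_mono) (auto simp: h_def indicator_def abs_if)
    also have "\<dots> = (\<integral>\<^sup>+ t. h (- s + 1 * t) \<partial>lborel) + (\<integral>\<^sup>+ t. h (s + (-1) * t) \<partial>lborel)"
      by (rule nn_integral_add) measurable
    also have "(\<integral>\<^sup>+ t. h (- s + 1 * t) \<partial>lborel) = ennreal I"
      using nn_integral_real_affine[of h 1 "- s"] hI by simp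
    also have "(\<integral>\<^sup>+ t. h (s + (-1) * t) \<partial>lborel) = ennreal I"
      using nn_integral_real_affine[of h "-1" s] hI by simp
    also have "ennreal I + ennreal I = ennreal (2 * I)" using I0 by (simp flip: ennreal_plus)
    finally show ?thesis .
  qed
  then show ?thesis using I0 by (intro that[of "2 * I"]) auto
qed (use that[of 0] in auto)

text \<open>The two powers have different tasks: \<open>r powr g\<close> is the decay of the energy
  in the scale, \<open>h powr - \<kappa>\<close> a singularity in time that is integrable as
  \<open>\<kappa> < 1\<close>. The version \<open>f'\<close> supplies the joint measurability for
  exchanging integrals.\<close>

lemma (in prob_space) AE_hausdorff_measure_path_ne_0:
  fixes f f' :: "real \<Rightarrow> 'a \<Rightarrow> 'b::euclidean_space"
  assumes T: "0 < T"
    and meas: "(\<lambda>(\<omega>, x). f' x \<omega>) \<in> borel_measurable (M \<Otimes>\<^sub>M lborel)"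
    and version: "AE \<omega> in M. \<forall>x\<ge>0. f' x \<omega> = f x \<omega>"
    and f_meas: "\<And>x. 0 \<le> x \<Longrightarrow> f x \<in> borel_measurable M"
    and small: "\<And>s h r. 0 \<le> s \<Longrightarrow> 0 < h \<Longrightarrow> 0 < r \<Longrightarrow> r \<le> 1 \<Longrightarrow>
      prob {\<omega>\<in>space M. dist (f s \<omega>) (f (s + h) \<omega>) \<le> r} \<le> C * r powr g * h powr - \<kappa>"
    and C: "0 \<le> C" and \<kappa>: "\<kappa> < 1" and \<gamma>: "0 < \<gamma>" "\<gamma> < g"
  shows "AE \<omega> in M. hausdorff_measure \<gamma> ((\<lambda>x. f x \<omega>) ` {0..T}) \<noteq> 0"
proof -
  let ?\<mu> = "restrict_space lborel {0..T}"
  have sp: "space ?\<mu> = {0..T}" by (simp add: space_restrict_space)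
  have fin: "finite_measure ?\<mu>"
    using T by (intro finite_measureI) (simp add: sp emeasure_restrict_space)
  obtain J where J: "0 \<le> J" "\<And>s. s \<in> {0..T} \<Longrightarrow>
    (\<integral>\<^sup>+ t. ennreal (\<bar>t - s\<bar> powr - \<kappa>) * indicator {0..T} t \<partial>lborel) \<le> ennreal J"
    using nn_integral_abs_powr_finite[OF \<kappa>] by blast
  have id: "(\<lambda>x. x) \<in> measurable ?\<mu> lborel" by (intro measurable_restrict_space1) simp
  have "(\<lambda>p. (fst p, snd p)) \<in> measurable (M \<Otimes>\<^sub>M ?\<mu>) (M \<Otimes>\<^sub>M lborel)"
    by (intro measurable_Pair measurable_fst measurable_compose[OF measurable_snd id])
  from measurable_compose[OF this meas] have meas': "(\<lambda>(\<omega>, x). f' x \<omega>) \<in> borel_measurable (M \<Otimes>\<^sub>M ?\<mu>)"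
    by (simp add: case_prod_beta)
  have f'_meas: "f' x \<in> borel_measurable M" for x
    using measurable_compose[OF measurable_Pair2'[of x lborel] meas] by simp
  have pair: "emeasure M {\<omega>\<in>space M. dist (f' s \<omega>) (f' t \<omega>) \<le> r} \<le> ennreal (C * r powr g) * ennreal (\<bar>t - s\<bar> powr - \<kappa>)"
    if st: "0 \<le> s" "0 \<le> t" "s \<noteq> t" and r: "0 < r" "r \<le> 1" for s t r
  proof -
    have [measurable]: "f s \<in> borel_measurable M" "f t \<in> borel_measurable M"
      "f' s \<in> borel_measurable M" "f' t \<in> borel_measurable M" using f_meas f'_meas st by auto
    have "prob {\<omega>\<in>space M. dist (f' s \<omega>) (f' t \<omega>) \<le> r} = prob {\<omega>\<in>space M. dist (f s \<omega>) (f t \<omega>) \<le> r}"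
      using version st by (intro finite_measure_eq_AE) (auto elim!: eventually_mono)
    also have "\<dots> \<le> C * r powr g * \<bar>t - s\<bar> powr - \<kappa>"
    proof (cases "s < t")
      case True
      then show ?thesis using small[of s "t - s" r] st r by simp
    next
      case False
      then show ?thesis using small[of t "s - t" r] st r by (simp add: dist_commute)
    qed
    finally show ?thesis using C by (simp add: emeasure_eq_measure ennreal_mult[symmetric] ennreal_leI)
  qed
  have "AE \<omega> in M. hausdorff_measure \<gamma> ((\<lambda>s. f' s \<omega>) ` space ?\<mu>) \<noteq> 0"
  proof (rule AE_hausdorff_measure_ne_0[OF fin _ meas' _ \<gamma>])
    show "emeasure ?\<mu> (space ?\<mu>) \<noteq> 0" using T by (simp add: sp emeasure_restrict_space)
    show "0 \<le> C * J * T" using C J T by simp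
    fix n :: nat
    let ?r = "2 powr - real n"
    have r: "0 < ?r" "?r \<le> 1" using powr_mono[of "- real n" 0 2] by auto
    have inner: "(\<integral>\<^sup>+ t. emeasure M {\<omega>\<in>space M. dist (f' s \<omega>) (f' t \<omega>) \<le> ?r} \<partial>?\<mu>) \<le> ennreal (C * ?r powr g) * ennreal J"
      if s: "s \<in> space ?\<mu>" for s
    proof -
      have "(\<integral>\<^sup>+ t. emeasure M {\<omega>\<in>space M. dist (f' s \<omega>) (f' t \<omega>) \<le> ?r} \<partial>?\<mu>)
        = (\<integral>\<^sup>+ t. emeasure M {\<omega>\<in>space M. dist (f' s \<omega>) (f' t \<omega>) \<le> ?r} * indicator {0..T} t \<partial>lborel)"
        by (rule nn_integral_restrict_space) simp
      also have "\<dots> \<le> (\<integral>\<^sup>+ t. ennreal (C * ?r powr g) * (ennreal (\<bar>t - s\<bar> powr - \<kappa>) * indicator {0..T} t) \<partial>lborel)"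
      proof (rule nn_integral_mono_AE)
        show "AE t in lborel. emeasure M {\<omega>\<in>space M. dist (f' s \<omega>) (f' t \<omega>) \<le> ?r} * indicator {0..T} t
          \<le> ennreal (C * ?r powr g) * (ennreal (\<bar>t - s\<bar> powr - \<kappa>) * indicator {0..T} t)"
          using AE_lborel_singleton[of s]
        proof eventually_elim
          case (elim t)
          then show ?case
            using pair[of s t ?r] s r by (auto simp: sp indicator_def)
        qed
      qed
      also have "\<dots> = ennreal (C * ?r powr g) * (\<integral>\<^sup>+ t. ennreal (\<bar>t - s\<bar> powr - \<kappa>) * indicator {0..T} t \<partial>lborel)"
        by (rule nn_integral_cmult) measurable
      also have "\<dots> \<le> ennreal (C * ?r powr g) * ennreal J"
        using J(2) s by (intro mult_left_mono) (auto simp: sp)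
      finally show ?thesis .
    qed
    have "(\<integral>\<^sup>+ s. \<integral>\<^sup>+ t. emeasure M {\<omega>\<in>space M. dist (f' s \<omega>) (f' t \<omega>) \<le> ?r} \<partial>?\<mu> \<partial>?\<mu>)
      \<le> (\<integral>\<^sup>+ s. ennreal (C * ?r powr g) * ennreal J \<partial>?\<mu>)"
      by (intro nn_integral_mono inner)
    also have "\<dots> = ennreal (C * ?r powr g) * ennreal J * ennreal T"
      using T by (simp add: sp emeasure_restrict_space)
    also have "\<dots> = ennreal (C * J * T * 2 powr (- real n * g))"
      using C J T by (simp add: ennreal_mult[symmetric] powr_powr mult_ac)
    finally show "(\<integral>\<^sup>+ s. \<integral>\<^sup>+ t. emeasure M {\<omega>\<in>space M. dist (f' s \<omega>) (f' t \<omega>) \<le> ?r} \<partial>?\<mu> \<partial>?\<mu>)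
      \<le> ennreal (C * J * T * 2 powr (- real n * g))" .
  qed
  then show ?thesis
    using version
  proof eventually_elim
    case (elim \<omega>)
    have "(\<lambda>s. f' s \<omega>) ` space ?\<mu> = (\<lambda>x. f x \<omega>) ` {0..T}"
      unfolding sp using elim(2) by (intro image_cong) auto
    then show ?case using elim(1) by simp
  qed
qed

section \<open>Lower bound for the range of a stable motion\<close>

context stable_motion
begin

text \<open>A right-continuous path is the limit of its values at times rounded up to dyadic grids,
  and these are jointly measurable. Paths in the measurable null set \<open>N\<close>, which
  contains the non-cadlag ones, are set to 0.\<close>

lemma jointly_measurable_version:
  obtains Y' where "(\<lambda>(\<omega>, x). Y' x \<omega>) \<in> borel_measurable (M \<Otimes>\<^sub>M lborel)" "AE \<omega> in M. \<forall>x\<ge>0. Y' x \<omega> = Y x \<omega>"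
proof -
  obtain N where N: "{\<omega>\<in>space M. \<not> cadlag (\<lambda>t. Y t \<omega>)} \<subseteq> N" "emeasure M N = 0" "N \<in> sets M"
    using AE_cadlag by (rule AE_E)
  define Y' where "Y' x \<omega> = (if \<omega> \<in> N \<or> x < 0 then 0 else Y x \<omega>)" for x \<omega>
  define Z where "Z n p = (if fst p \<in> N \<or> snd p < 0 then 0 else Y (real (nat \<lceil>snd p * 2 ^ n\<rceil>) / 2 ^ n) (fst p))" for n and p :: "'w \<times> real"
  have Z: "Z n \<in> borel_measurable (M \<Otimes>\<^sub>M lborel)" for n
  proof -
    have [measurable]: "N \<in> sets M" by (rule N(3))
    have "(\<lambda>p. Y (real (nat \<lceil>snd p * (2::real) ^ n\<rceil>) / 2 ^ n) (fst p)) \<in> borel_measurable (M \<Otimes>\<^sub>M lborel)"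
    proof (rule measurable_compose_countable[where f = "\<lambda>i p. Y (real i / 2 ^ n) (fst p)" and g = "\<lambda>p. nat \<lceil>snd p * (2::real) ^ n\<rceil>"])
      show "(\<lambda>p. Y (real i / 2 ^ n) (fst p)) \<in> borel_measurable (M \<Otimes>\<^sub>M lborel)" for i
        by (rule measurable_compose[OF measurable_fst]) (simp add: measurable_Y)
      show "(\<lambda>p. nat \<lceil>snd p * (2::real) ^ n\<rceil>) \<in> measurable (M \<Otimes>\<^sub>M lborel) (count_space UNIV)" by measurable
    qed
    then show ?thesis unfolding Z_def[abs_def] by measurable
  qed
  have "(\<lambda>p. Y' (snd p) (fst p)) \<in> borel_measurable (M \<Otimes>\<^sub>M lborel)"
  proof (rule borel_measurable_LIMSEQ_metric[OF Z])
    fix p :: "'w \<times> real" assume p: "p \<in> space (M \<Otimes>\<^sub>M lborel)"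
    show "(\<lambda>n. Z n p) \<longlonglongrightarrow> Y' (snd p) (fst p)"
    proof (cases "fst p \<in> N \<or> snd p < 0")
      case False
      then have "cadlag (\<lambda>t. Y t (fst p))" using N(1) p by (auto simp: space_pair_measure)
      then have "(\<lambda>n. Y (real (nat \<lceil>snd p * 2 ^ n\<rceil>) / 2 ^ n) (fst p)) \<longlonglongrightarrow> Y (snd p) (fst p)"
        using False by (intro grid_tendsto_at_right) (auto simp: cadlag_def)
      then show ?thesis using False by (simp add: Z_def Y'_def)
    qed (simp add: Z_def Y'_def)
  qed
  moreover have "AE \<omega> in M. \<forall>x\<ge>0. Y' x \<omega> = Y x \<omega>"
    by (rule AE_I'[of N]) (use N in \<open>auto simp: Y'_def null_sets_def\<close>)
  ultimately show ?thesis by (intro that[of Y']) (simp_all add: case_prod_beta)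
qed

lemma small_increment:
  assumes nc: "not_confined M \<alpha> Y" and \<gamma>: "0 \<le> \<gamma>" "\<gamma> \<le> min (real DIM('a)) \<alpha>"
  obtains C where "0 \<le> C" "\<And>s h r. 0 \<le> s \<Longrightarrow> 0 < h \<Longrightarrow> 0 < r \<Longrightarrow>
    prob {\<omega>\<in>space M. norm (Y (s + h) \<omega> - Y s \<omega>) \<le> r} \<le> C * r powr \<gamma> * h powr - (\<gamma> / \<alpha>)"
proof -
  obtain C where C: "0 \<le> C" "\<And>\<rho>. 0 < \<rho> \<Longrightarrow> prob {\<omega>\<in>space M. norm (Y 1 \<omega>) \<le> \<rho>} \<le> C * \<rho> powr \<gamma>"
    using small_ball[OF assms] by blast
  show ?thesis
  proof (rule that[OF C(1)])
    fix s h r :: real assume a: "0 \<le> s" "0 < h" "0 < r"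
    have "prob {\<omega>\<in>space M. norm (Y (s + h) \<omega> - Y s \<omega>) \<le> r} \<le> C * (r * h powr - (1 / \<alpha>)) powr \<gamma>"
      unfolding prob_norm_increment_le[OF a(1,2)] by (rule C(2)) (use a in simp)
    also have "\<dots> = C * r powr \<gamma> * h powr - (\<gamma> / \<alpha>)"
      using a by (simp add: powr_mult powr_powr)
    finally show "prob {\<omega>\<in>space M. norm (Y (s + h) \<omega> - Y s \<omega>) \<le> r} \<le> C * r powr \<gamma> * h powr - (\<gamma> / \<alpha>)" .
  qed
qed

lemma AE_hausdorff_dim_range_ge:
  assumes nc: "not_confined M \<alpha> Y" and T: "0 < T"
  shows "AE \<omega> in M. ereal (min (real DIM('a)) \<alpha>) \<le> hausdorff_dim ((\<lambda>x. Y x \<omega>) ` {0..T})"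
proof -
  let ?d = "min (real DIM('a)) \<alpha>"
  have d: "0 < ?d" using index_pos by simp
  obtain Y' where Y': "(\<lambda>(\<omega>, x). Y' x \<omega>) \<in> borel_measurable (M \<Otimes>\<^sub>M lborel)" "AE \<omega> in M. \<forall>x\<ge>0. Y' x \<omega> = Y x \<omega>"
    by (rule jointly_measurable_version)
  have main: "AE \<omega> in M. hausdorff_measure \<gamma> ((\<lambda>x. Y x \<omega>) ` {0..T}) \<noteq> 0" if \<gamma>: "0 < \<gamma>" "\<gamma> < ?d" for \<gamma>
  proof -
    \<comment> \<open>Strictly in between: \<open>\<gamma> < g\<close> makes the energy series
      converge, \<open>g < \<alpha>\<close> makes the singularity
      \<open>h powr - (g / \<alpha>)\<close> integrable.\<close>
    define g where "g = (\<gamma> + ?d) / 2"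
    have g: "\<gamma> < g" "g < ?d" "0 \<le> g" using \<gamma> by (auto simp: g_def)
    obtain C where C: "0 \<le> C" "\<And>s h r. 0 \<le> s \<Longrightarrow> 0 < h \<Longrightarrow> 0 < r \<Longrightarrow>
      prob {\<omega>\<in>space M. norm (Y (s + h) \<omega> - Y s \<omega>) \<le> r} \<le> C * r powr g * h powr - (g / \<alpha>)"
      using small_increment[OF nc, of g] g by auto
    show ?thesis
    proof (rule AE_hausdorff_measure_path_ne_0[OF T Y' measurable_Y _ C(1) _ \<gamma>(1) g(1), where \<kappa> = "g / \<alpha>"])
      show "prob {\<omega>\<in>space M. dist (Y s \<omega>) (Y (s + h) \<omega>) \<le> r} \<le> C * r powr g * h powr - (g / \<alpha>)"
        if "0 \<le> s" "0 < h" "0 < r" for s h r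
        using C(2)[OF that] by (simp add: dist_norm norm_minus_commute)
      show "g / \<alpha> < 1" using g index_pos by simp
    qed
  qed
  have "AE \<omega> in M. \<forall>n::nat. hausdorff_measure (?d * (1 - 1 / real (n + 2))) ((\<lambda>x. Y x \<omega>) ` {0..T}) \<noteq> 0"
    unfolding AE_all_countable
  proof
    fix n :: nat
    have "0 < 1 - 1 / real (n + 2)" "1 - 1 / real (n + 2) < 1" by simp_all
    then show "AE \<omega> in M. hausdorff_measure (?d * (1 - 1 / real (n + 2))) ((\<lambda>x. Y x \<omega>) ` {0..T}) \<noteq> 0"
      using d by (intro main mult_pos_pos) (auto simp: mult_less_cancel_left_pos[of ?d _ 1, simplified])
  qed
  then show ?thesis
  proof eventually_elim
    case (elim \<omega>)
    show ?case by (rule hausdorff_dim_geI_seq[OF d]) (use elim in blast)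
  qed
qed

end

section \<open>Range and graph of the time-changed process\<close>

lemma packing_dim_mono: "A \<subseteq> B \<Longrightarrow> packing_dim A \<le> packing_dim B"
proof -
  assume AB: "A \<subseteq> B"
  have "packing_measure s A \<le> packing_measure s B" for s
    unfolding packing_measure_def using AB by (intro INF_superset_mono) auto
  then have "packing_measure s B = 0 \<Longrightarrow> packing_measure s A = 0" for s
    by (metis le_zero_eq)
  then show ?thesis
    unfolding packing_dim_def by (intro Inf_superset_mono image_mono) auto
qed

lemma hausdorff_dim_unit_interval_ge: "ereal 1 \<le> hausdorff_dim {0..1::real}"
proof (rule hausdorff_dim_geI)
  have "hausdorff_measure 1 {0..1::real} \<noteq> 0"
  proof (rule hausdorff_measure_mass_distribution[where \<mu> = lborel and f = "\<lambda>x. x" and G = "{0..1}" and K = 2 and \<delta> = 1])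
    show "emeasure lborel {t\<in>space lborel. dist s t \<le> r} \<le> ennreal (2 * r powr 1)" if "0 < r" for s r :: real
    proof -
      have "{t\<in>space lborel. dist s t \<le> r} = {s - r..s + r}" by (auto simp: dist_real_def abs_if)
      then show ?thesis using that by simp
    qed
  qed auto
  then show "hausdorff_measure s {0..1::real} \<noteq> 0" if "s < 1" for s
    using hausdorff_measure_eq_0_mono_exponent[of s 1] that by auto
qed

section \<open>The inverse of a strictly increasing path\<close>

locale increasing_path =
  fixes d :: "real \<Rightarrow> real"
  assumes strict: "\<And>x y. 0 \<le> x \<Longrightarrow> x < y \<Longrightarrow> d x < d y"
    and start: "d 0 = 0" and unbounded: "\<And>t. \<exists>x\<ge>0. t < d x"
begin

definition inv_path :: "real \<Rightarrow> real" where
  "inv_path t = Inf {x. 0 \<le> x \<and> d x > t}"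

lemma path_mono: "0 \<le> x \<Longrightarrow> x \<le> y \<Longrightarrow> d x \<le> d y"
  using strict[of x y] by (cases "x = y") auto

lemma bdd: "bdd_below {x. 0 \<le> x \<and> d x > t}"
  by (rule bdd_belowI[of _ 0]) auto

lemma inv_path_le: "0 \<le> x \<Longrightarrow> t < d x \<Longrightarrow> inv_path t \<le> x"
  unfolding inv_path_def using bdd by (intro cInf_lower) auto

lemma inv_path_ge: "(\<And>x. 0 \<le> x \<Longrightarrow> t < d x \<Longrightarrow> y \<le> x) \<Longrightarrow> y \<le> inv_path t"
  unfolding inv_path_def using unbounded[of t] by (intro cInf_greatest) auto

lemma inv_path_nonneg: "0 \<le> inv_path t"
  by (rule inv_path_ge)

lemma inv_path_mono: "s \<le> t \<Longrightarrow> inv_path s \<le> inv_path t"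
  by (rule inv_path_ge) (auto intro: inv_path_le)

text \<open>Strict increase makes \<open>x\<close> the infimum even where \<open>d\<close> jumps.
  This is what puts \<open>(D x, Y x)\<close> on the graph of \<open>X\<close>.\<close>

lemma inv_path_inverse: "0 \<le> x \<Longrightarrow> inv_path (d x) = x"
proof (rule antisym)
  assume x: "0 \<le> x"
  show "inv_path (d x) \<le> x"
  proof (rule dense_ge)
    fix z assume "x < z"
    then show "inv_path (d x) \<le> z" using strict[OF x] x by (intro inv_path_le) auto
  qed
  show "x \<le> inv_path (d x)"
  proof (rule inv_path_ge)
    fix y assume "0 \<le> y" "d x < d y"
    then show "x \<le> y" using path_mono[of y x] by (cases "x \<le> y") auto
  qed
qed

text \<open>Take \<open>z\<close> midway between the two inverse values: below
  \<open>inv_path t\<close> it satisfies \<open>d z \<le> t\<close>, above \<open>inv_path s\<close>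
  it satisfies \<open>s \<le> d z\<close>. This supplies the assumption \<open>inv\<close> of
  \<open>packing_dim_graph_le\<close>.\<close>

lemma inv_path_between:
  assumes "inv_path s < inv_path t"
  shows "\<exists>z. 0 \<le> z \<and> z \<le> inv_path t \<and> s \<le> d z \<and> d z \<le> t"
proof -
  define z where "z = (inv_path s + inv_path t) / 2"
  have z: "inv_path s < z" "z < inv_path t" using assms by (auto simp: z_def)
  have z0: "0 \<le> z" using inv_path_nonneg[of s] z by linarith
  have "d z \<le> t" using inv_path_le[OF z0, of t] z by (cases "d z \<le> t") auto
  moreover have "s \<le> d z"
  proof (rule ccontr)
    assume "\<not> s \<le> d z"
    have "z \<le> inv_path s"
    proof (rule inv_path_ge)
      fix x assume "0 \<le> x" "s < d x"
      then show "z \<le> x" using path_mono[of x z] \<open>\<not> s \<le> d z\<close> by (cases "z \<le> x") auto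
    qed
    then show False using z by simp
  qed
  ultimately show ?thesis using z0 z by (intro exI[of _ z]) auto
qed

end

text \<open>The path properties come from the small ball bound with exponent \<open>\<beta>\<close>.
  An increment vanishes with probability 0, so the path increases strictly between rationals; and
  \<open>D n\<close> stays below a fixed level with probability of order \<open>1 / n\<close>, so
  the path is unbounded. If \<open>D 1\<close> vanished almost surely, scaling and monotonicity
  would make \<open>D\<close> the zero process.\<close>

lemma (in prob_space) stable_subordinator_facts:
  assumes D: "stable_subordinator M \<beta> D" and \<beta>: "0 < \<beta>" "\<beta> < 1"
  shows "not_confined M \<beta> D" "AE \<omega> in M. increasing_path (\<lambda>x. D x \<omega>)"
proof -
  interpret D: stable_motion M D \<beta>
    using D \<beta> by unfold_locales (auto simp: stable_subordinator_def)
  have mono: "AE \<omega> in M. mono_on {0..} (\<lambda>x. D x \<omega>)" using D by (simp add: stable_subordinator_def)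
  have m1: "D 1 \<in> borel_measurable M" using D.measurable_Y by simp
  note [measurable] = m1
  have nonzero: "\<not> (AE \<omega> in M. D 1 \<omega> = 0)"
  proof
    assume "AE \<omega> in M. D 1 \<omega> = 0"
    have "AE \<omega> in M. D (real (Suc n)) \<omega> = 0" for n
    proof -
      have mn: "D (real (Suc n)) \<in> borel_measurable M" using D.measurable_Y by simp
      have "AE x in distr M borel (\<lambda>\<omega>. real (Suc n) powr (1 / \<beta>) *\<^sub>R D 1 \<omega>). x = 0"
        using \<open>AE \<omega> in M. D 1 \<omega> = 0\<close> by (subst AE_distr_iff) (auto elim!: eventually_mono)
      moreover have "distr M borel (D (real (Suc n) * 1)) = distr M borel (\<lambda>\<omega>. real (Suc n) powr (1 / \<beta>) *\<^sub>R D 1 \<omega>)"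
        by (rule D.distr_scale) auto
      ultimately have "AE x in distr M borel (D (real (Suc n))). x = 0"
        by (simp only: mult_1_right)
      then show ?thesis using mn by (subst (asm) AE_distr_iff) auto
    qed
    then have "AE \<omega> in M. \<forall>n. D (real (Suc n)) \<omega> = 0" unfolding AE_all_countable by blast
    with mono D.AE_Y_0 have "AE \<omega> in M. \<forall>x\<ge>0. D x \<omega> = 0"
    proof eventually_elim
      case (elim \<omega>)
      show ?case
      proof (intro allI impI)
        fix x :: real assume x: "0 \<le> x"
        obtain n :: nat where n: "x \<le> real n" using real_arch_simple by blast
        have "D 0 \<omega> \<le> D x \<omega>" "D x \<omega> \<le> D (real (Suc n)) \<omega>"
          using elim(1) x n by (auto simp: mono_on_def)
        moreover have "D (real (Suc n)) \<omega> = 0" using elim(3) by blast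
        ultimately show "D x \<omega> = 0" using elim(2) by simp
      qed
    qed
    then show False using D by (simp add: stable_subordinator_def)
  qed
  show nc: "not_confined M \<beta> D"
    unfolding not_confined_def
  proof (intro allI impI)
    fix V :: "real set" assume V: "subspace V \<and> (AE \<omega> in M. D 1 \<omega> \<in> V)"
    have "\<not> V \<subseteq> {0}"
    proof
      assume "V \<subseteq> {0}"
      then have "AE \<omega> in M. D 1 \<omega> = 0" using V by (auto elim!: eventually_mono)
      then show False using nonzero by simp
    qed
    then have "dim V \<noteq> 0" by simp
    then have "1 \<le> real (dim V)" by linarith
    then show "min (real DIM(real)) \<beta> \<le> real (dim V)" using \<beta> by (simp add: min_def)
  qed
  obtain C where C: "0 \<le> C" "\<And>s h r. 0 \<le> s \<Longrightarrow> 0 < h \<Longrightarrow> 0 < r \<Longrightarrow>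
    prob {\<omega>\<in>space M. norm (D (s + h) \<omega> - D s \<omega>) \<le> r} \<le> C * r powr \<beta> * h powr - (\<beta> / \<beta>)"
    using D.small_increment[OF nc, of \<beta>] \<beta> by auto
  have ne: "AE \<omega> in M. D (s + h) \<omega> \<noteq> D s \<omega>" if sh: "0 \<le> s" "0 < h" for s h
  proof -
    have [measurable]: "D (s + h) \<in> borel_measurable M" "D s \<in> borel_measurable M"
      using D.measurable_Y sh by auto
    have "prob {\<omega>\<in>space M. D (s + h) \<omega> = D s \<omega>} \<le> 0 + e" if e: "0 < e" for e
    proof -
      define r where "r = (e / (C * h powr - 1 + 1)) powr (1 / \<beta>)"
      have K: "0 < C * h powr - 1 + 1" using C(1) by (intro add_nonneg_pos mult_nonneg_nonneg) auto
      then have r: "0 < r" using e by (simp add: r_def)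
      have "prob {\<omega>\<in>space M. D (s + h) \<omega> = D s \<omega>} \<le> prob {\<omega>\<in>space M. norm (D (s + h) \<omega> - D s \<omega>) \<le> r}"
        using r by (intro finite_measure_mono) auto
      also have "\<dots> \<le> (C * h powr - 1) * r powr \<beta>" using C(2)[OF sh r] \<beta> by (simp add: mult_ac)
      also have "\<dots> \<le> (C * h powr - 1 + 1) * r powr \<beta>" by (intro mult_right_mono) auto
      also have "\<dots> = e" using K e \<beta> by (simp add: r_def powr_powr)
      finally show ?thesis by simp
    qed
    then have "prob {\<omega>\<in>space M. D (s + h) \<omega> = D s \<omega>} \<le> 0" by (rule field_le_epsilon)
    then have "prob {\<omega>\<in>space M. D (s + h) \<omega> = D s \<omega>} = 0" by (simp add: measure_le_0_iff)
    then show ?thesis by (subst (asm) prob_eq_0) auto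
  qed
  have "AE \<omega> in M. \<forall>p\<in>\<rat>. \<forall>q\<in>\<rat>. 0 \<le> p \<longrightarrow> p < q \<longrightarrow> D q \<omega> \<noteq> D p \<omega>"
  proof (intro AE_ball_countable' countable_rat)
    fix p q :: real
    show "AE \<omega> in M. 0 \<le> p \<longrightarrow> p < q \<longrightarrow> D q \<omega> \<noteq> D p \<omega>"
      using ne[of p "q - p"] by (cases "0 \<le> p \<and> p < q") auto
  qed
  moreover have "AE \<omega> in M. \<forall>k::nat. \<exists>n::nat. real k < D (real (Suc n)) \<omega>"
    unfolding AE_all_countable
  proof
    fix k :: nat
    let ?B = "\<lambda>n::nat. {\<omega>\<in>space M. norm (D (0 + real (Suc n)) \<omega> - D 0 \<omega>) \<le> real (Suc k)}"
    have B: "?B n \<in> events" for n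
    proof -
      have [measurable]: "D (0 + real (Suc n)) \<in> borel_measurable M" "D 0 \<in> borel_measurable M"
        using D.measurable_Y by auto
      show ?thesis by measurable
    qed
    have "prob (\<Inter>n. ?B n) \<le> C * real (Suc k) powr \<beta> * (1 / real (Suc n))" for n
    proof -
      have "prob (\<Inter>n. ?B n) \<le> prob (?B n)" using B by (intro finite_measure_mono) auto
      also have "\<dots> \<le> C * real (Suc k) powr \<beta> * real (Suc n) powr - (\<beta> / \<beta>)" using C(2)[of 0 "real (Suc n)" "real (Suc k)"] by simp
      also have "real (Suc n) powr - (\<beta> / \<beta>) = 1 / real (Suc n)" using \<beta> by (simp add: powr_minus inverse_eq_divide)
      finally show ?thesis .
    qed
    moreover have "(\<lambda>n. C * real (Suc k) powr \<beta> * (1 / real (Suc n))) \<longlonglongrightarrow> C * real (Suc k) powr \<beta> * 0"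
      using LIMSEQ_inverse_real_of_nat by (intro tendsto_mult tendsto_const) (simp add: inverse_eq_divide)
    ultimately have "prob (\<Inter>n. ?B n) \<le> C * real (Suc k) powr \<beta> * 0"
      by (intro LIMSEQ_le_const) auto
    then have "prob (\<Inter>n. ?B n) = 0" by (simp add: measure_le_0_iff)
    then have "AE \<omega> in M. \<omega> \<notin> (\<Inter>n. ?B n)" using B by (subst (asm) prob_eq_0) auto
    then show "AE \<omega> in M. \<exists>n::nat. real k < D (real (Suc n)) \<omega>"
      using D.AE_Y_0 mono AE_space
    proof eventually_elim
      case (elim \<omega>)
      then obtain n where n: "\<not> norm (D (0 + real (Suc n)) \<omega> - D 0 \<omega>) \<le> real (Suc k)" by blast
      have "D 0 \<omega> \<le> D (real (Suc n)) \<omega>" using elim(3) by (auto simp: mono_on_def)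
      then have "real k < D (real (Suc n)) \<omega>" using n elim(2) by simp
      then show ?case by blast
    qed
  qed
  ultimately show "AE \<omega> in M. increasing_path (\<lambda>x. D x \<omega>)"
    using mono D.AE_Y_0
  proof eventually_elim
    case (elim \<omega>)
    have mono\<omega>: "D x \<omega> \<le> D y \<omega>" if "0 \<le> x" "x \<le> y" for x y using elim(3) that by (auto simp: mono_on_def)
    show ?case
    proof
      show "D x \<omega> < D y \<omega>" if xy: "0 \<le> x" "x < y" for x y
      proof -
        obtain p where p: "p \<in> \<rat>" "x < p" "p < y" using Rats_dense_in_real[OF xy(2)] by blast
        obtain q where q: "q \<in> \<rat>" "p < q" "q < y" using Rats_dense_in_real[OF p(3)] by blast
        have "D x \<omega> \<le> D p \<omega>" "D p \<omega> \<le> D q \<omega>" "D q \<omega> \<le> D y \<omega>" using mono\<omega> xy p q by auto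
        moreover have "D q \<omega> \<noteq> D p \<omega>" using elim(1) p q xy by simp
        ultimately show ?thesis by linarith
      qed
      show "D 0 \<omega> = 0" by (rule elim(4))
      show "\<exists>x\<ge>0. t < D x \<omega>" for t
      proof -
        obtain k :: nat where k: "t \<le> real k" using real_arch_simple by blast
        obtain n :: nat where n: "real k < D (real (Suc n)) \<omega>" using elim(2) by blast
        then have "t < D (real (Suc n)) \<omega>" using k by linarith
        then show ?thesis by (intro exI[of _ "real (Suc n)"]) auto
      qed
    qed
  qed
qed

section \<open>Joint increments of the two processes and the lower bound for the graph\<close>

lemma path_space_increment_sets:
  assumes "0 \<le> s" "0 \<le> t"
  shows "{f\<in>space (path_space :: (real \<Rightarrow> 'a::euclidean_space) measure). norm (f t - f s) \<le> r} \<in> sets path_space"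
proof -
  have [measurable]: "(\<lambda>f. f t) \<in> borel_measurable (path_space :: (real \<Rightarrow> 'a) measure)"
    "(\<lambda>f. f s) \<in> borel_measurable (path_space :: (real \<Rightarrow> 'a) measure)"
    unfolding path_space_def using assms by (auto intro!: measurable_component_singleton)
  show ?thesis by measurable
qed

lemma process_path_increment:
  assumes "0 \<le> s" "0 \<le> t"
  shows "process_path Z -` {f\<in>space path_space. norm (f t - f s) \<le> r} \<inter> space M
    = {\<omega>\<in>space M. norm (Z t \<omega> - Z s \<omega>) \<le> r}"
  using assms by (auto simp: process_path_def path_space_def space_PiM)

lemma (in prob_space) prob_indep_increments:
  fixes Y :: "real \<Rightarrow> 'a \<Rightarrow> 'b::euclidean_space" and Z :: "real \<Rightarrow> 'a \<Rightarrow> 'c::euclidean_space"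
  assumes ind: "indep_processes M Y Z" and st: "0 \<le> s" "0 \<le> t"
  shows "prob {\<omega>\<in>space M. norm (Y t \<omega> - Y s \<omega>) \<le> r \<and> norm (Z t \<omega> - Z s \<omega>) \<le> q}
    = prob {\<omega>\<in>space M. norm (Y t \<omega> - Y s \<omega>) \<le> r} * prob {\<omega>\<in>space M. norm (Z t \<omega> - Z s \<omega>) \<le> q}"
proof -
  have "{\<omega>\<in>space M. norm (Y t \<omega> - Y s \<omega>) \<le> r} \<in> {process_path Y -` A \<inter> space M |A. A \<in> sets path_space}"
    using path_space_increment_sets[OF st] process_path_increment[OF st, of Y r M] by blast
  moreover have "{\<omega>\<in>space M. norm (Z t \<omega> - Z s \<omega>) \<le> q} \<in> {process_path Z -` A \<inter> space M |A. A \<in> sets path_space}"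
    using path_space_increment_sets[OF st] process_path_increment[OF st, of Z q M] by blast
  ultimately have "prob ({\<omega>\<in>space M. norm (Y t \<omega> - Y s \<omega>) \<le> r} \<inter> {\<omega>\<in>space M. norm (Z t \<omega> - Z s \<omega>) \<le> q})
    = prob {\<omega>\<in>space M. norm (Y t \<omega> - Y s \<omega>) \<le> r} * prob {\<omega>\<in>space M. norm (Z t \<omega> - Z s \<omega>) \<le> q}"
    using ind unfolding indep_processes_def indep_sets2_eq by blast
  then show ?thesis by (simp add: Int_def conj_ac Collect_conj_eq[symmetric])
qed

text \<open>Closeness of the pairs implies closeness in both coordinates, and independence
  multiplies the small ball bounds: exponent 1 for \<open>Y\<close> and
  \<open>b < \<beta> * (1 - 1 / \<alpha>)\<close> for \<open>D\<close>, so that the time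
  singularities together remain integrable.\<close>

lemma (in prob_space) AE_hausdorff_dim_pair_ge:
  fixes Y :: "real \<Rightarrow> 'a \<Rightarrow> 'b::euclidean_space" and D :: "real \<Rightarrow> 'a \<Rightarrow> real"
  assumes Y: "stable_motion M Y \<alpha>" "not_confined M \<alpha> Y" and D: "stable_motion M D \<beta>" "not_confined M \<beta> D"
    and ind: "indep_processes M Y D" and par: "1 < \<alpha>" "0 < \<beta>" "\<beta> < 1" and T: "0 < T"
  shows "AE \<omega> in M. ereal (1 + \<beta> * (1 - 1 / \<alpha>)) \<le> hausdorff_dim ((\<lambda>x. (D x \<omega>, Y x \<omega>)) ` {0..T})"
proof -
  interpret Y: stable_motion M Y \<alpha> by fact
  interpret D: stable_motion M D \<beta> by fact
  let ?d = "1 + \<beta> * (1 - 1 / \<alpha>)"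
  define \<theta> where "\<theta> = \<beta> * (1 - 1 / \<alpha>)"
  have \<theta>: "0 < \<theta>" "\<theta> < \<beta>"
  proof -
    have "0 < 1 - 1 / \<alpha>" "1 - 1 / \<alpha> < 1" using par by simp_all
    then show "0 < \<theta>" "\<theta> < \<beta>" using par mult_strict_left_mono[of "1 - 1 / \<alpha>" 1 \<beta>] by (auto simp: \<theta>_def)
  qed
  obtain Y' where Y': "(\<lambda>(\<omega>, x). Y' x \<omega>) \<in> borel_measurable (M \<Otimes>\<^sub>M lborel)" "AE \<omega> in M. \<forall>x\<ge>0. Y' x \<omega> = Y x \<omega>"
    by (rule Y.jointly_measurable_version)
  obtain D' where D': "(\<lambda>(\<omega>, x). D' x \<omega>) \<in> borel_measurable (M \<Otimes>\<^sub>M lborel)" "AE \<omega> in M. \<forall>x\<ge>0. D' x \<omega> = D x \<omega>"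
    by (rule D.jointly_measurable_version)
  have meas: "(\<lambda>(\<omega>, x). (D' x \<omega>, Y' x \<omega>)) \<in> borel_measurable (M \<Otimes>\<^sub>M lborel)"
    using measurable_Pair[OF D'(1) Y'(1)] by (simp add: borel_prod case_prod_beta)
  have version: "AE \<omega> in M. \<forall>x\<ge>0. (D' x \<omega>, Y' x \<omega>) = (D x \<omega>, Y x \<omega>)"
    using D'(2) Y'(2) by eventually_elim auto
  have f_meas: "(\<lambda>\<omega>. (D x \<omega>, Y x \<omega>)) \<in> borel_measurable M" if "0 \<le> x" for x
    unfolding borel_prod[symmetric] using D.measurable_Y[OF that] Y.measurable_Y[OF that] by (rule measurable_Pair)
  have main: "AE \<omega> in M. hausdorff_measure \<gamma> ((\<lambda>x. (D x \<omega>, Y x \<omega>)) ` {0..T}) \<noteq> 0" if \<gamma>: "0 < \<gamma>" "\<gamma> < ?d" for \<gamma>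
  proof -
    \<comment> \<open>The exponent \<open>b\<close> has to exceed \<open>\<gamma> - 1\<close>, be
      nonnegative and stay below \<open>\<theta>\<close>; the midpoint of \<open>m\<close> and
      \<open>\<theta>\<close> does all three.\<close>
    define m where "m = max (\<gamma> - 1) 0"
    have m: "m < \<theta>" "\<gamma> - 1 \<le> m" "0 \<le> m" using \<gamma> \<theta> by (auto simp: m_def \<theta>_def)
    define b where "b = (m + \<theta>) / 2"
    have b: "\<gamma> < 1 + b" "b < \<theta>" "0 \<le> b" using m \<theta>(1) by (auto simp: b_def field_simps)
    obtain C1 where C1: "0 \<le> C1" "\<And>s h r. 0 \<le> s \<Longrightarrow> 0 < h \<Longrightarrow> 0 < r \<Longrightarrow>
      prob {\<omega>\<in>space M. norm (Y (s + h) \<omega> - Y s \<omega>) \<le> r} \<le> C1 * r powr 1 * h powr - (1 / \<alpha>)"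
      using Y.small_increment[OF Y(2), of 1] par by auto
    obtain C2 where C2: "0 \<le> C2" "\<And>s h r. 0 \<le> s \<Longrightarrow> 0 < h \<Longrightarrow> 0 < r \<Longrightarrow>
      prob {\<omega>\<in>space M. norm (D (s + h) \<omega> - D s \<omega>) \<le> r} \<le> C2 * r powr b * h powr - (b / \<beta>)"
      using D.small_increment[OF D(2), of b] par b \<theta> by auto
    show ?thesis
    proof (rule AE_hausdorff_measure_path_ne_0[OF T meas version f_meas _ _ _ \<gamma>(1) b(1), where \<kappa> = "b / \<beta> + 1 / \<alpha>" and C = "C1 * C2"])
      have "b < \<beta> * (1 - 1 / \<alpha>)" using b(2) by (simp add: \<theta>_def)
      then have "b / \<beta> < 1 - 1 / \<alpha>" using par by (simp add: pos_divide_less_eq mult.commute)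
      then show "b / \<beta> + 1 / \<alpha> < 1" by simp
      show "0 \<le> C1 * C2" using C1 C2 by simp
      fix s h r :: real assume a: "0 \<le> s" "0 < h" "0 < r" "r \<le> 1"
      let ?A = "{\<omega>\<in>space M. norm (Y (s + h) \<omega> - Y s \<omega>) \<le> r \<and> norm (D (s + h) \<omega> - D s \<omega>) \<le> r}"
      have [measurable]: "Y (s + h) \<in> borel_measurable M" "Y s \<in> borel_measurable M"
        "D (s + h) \<in> borel_measurable M" "D s \<in> borel_measurable M" using Y.measurable_Y D.measurable_Y a by auto
      have "prob {\<omega>\<in>space M. dist (D s \<omega>, Y s \<omega>) (D (s + h) \<omega>, Y (s + h) \<omega>) \<le> r} \<le> prob ?A"
      proof (rule finite_measure_mono)
        show "{\<omega>\<in>space M. dist (D s \<omega>, Y s \<omega>) (D (s + h) \<omega>, Y (s + h) \<omega>) \<le> r} \<subseteq> ?A"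
        proof safe
          fix \<omega> assume d: "dist (D s \<omega>, Y s \<omega>) (D (s + h) \<omega>, Y (s + h) \<omega>) \<le> r"
          show "norm (Y (s + h) \<omega> - Y s \<omega>) \<le> r" "norm (D (s + h) \<omega> - D s \<omega>) \<le> r"
            using dist_fst_le[of "(D s \<omega>, Y s \<omega>)" "(D (s + h) \<omega>, Y (s + h) \<omega>)"]
              dist_snd_le[of "(D s \<omega>, Y s \<omega>)" "(D (s + h) \<omega>, Y (s + h) \<omega>)"] d
            by (simp_all add: dist_norm norm_minus_commute)
        qed
        show "?A \<in> events" by measurable
      qed
      also have "\<dots> = prob {\<omega>\<in>space M. norm (Y (s + h) \<omega> - Y s \<omega>) \<le> r} * prob {\<omega>\<in>space M. norm (D (s + h) \<omega> - D s \<omega>) \<le> r}"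
        using a by (intro prob_indep_increments[OF ind]) auto
      also have "\<dots> \<le> (C1 * r powr 1 * h powr - (1 / \<alpha>)) * (C2 * r powr b * h powr - (b / \<beta>))"
        using C1 C2 a by (intro mult_mono) auto
      also have "\<dots> = C1 * C2 * (r powr 1 * r powr b) * (h powr - (b / \<beta>) * h powr - (1 / \<alpha>))"
        by (simp only: mult_ac)
      also have "\<dots> = C1 * C2 * r powr (1 + b) * h powr - (b / \<beta> + 1 / \<alpha>)"
        unfolding powr_add[symmetric] by simp
      finally show "prob {\<omega>\<in>space M. dist (D s \<omega>, Y s \<omega>) (D (s + h) \<omega>, Y (s + h) \<omega>) \<le> r}
        \<le> C1 * C2 * r powr (1 + b) * h powr - (b / \<beta> + 1 / \<alpha>)" .
    qed
  qed
  have d: "0 < ?d" using \<theta> by (simp add: \<theta>_def)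
  have "AE \<omega> in M. \<forall>n::nat. hausdorff_measure (?d * (1 - 1 / real (n + 2))) ((\<lambda>x. (D x \<omega>, Y x \<omega>)) ` {0..T}) \<noteq> 0"
    unfolding AE_all_countable
  proof
    fix n :: nat
    have "0 < 1 - 1 / real (n + 2)" "1 - 1 / real (n + 2) < 1" by simp_all
    then show "AE \<omega> in M. hausdorff_measure (?d * (1 - 1 / real (n + 2))) ((\<lambda>x. (D x \<omega>, Y x \<omega>)) ` {0..T}) \<noteq> 0"
      using d mult_strict_left_mono[of "1 - 1 / real (n + 2)" 1 ?d] by (intro main mult_pos_pos) auto
  qed
  then show ?thesis
  proof eventually_elim
    case (elim \<omega>)
    show ?case by (rule hausdorff_dim_geI_seq[OF d]) (use elim in blast)
  qed
qed

lemma increasing_path_initial_interval: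
  assumes "increasing_path d" "continuous (at_right 0) d"
  obtains n :: nat where "\<And>x. x \<in> {0..1 / real (Suc n)} \<Longrightarrow> d x \<in> {0..1}"
proof -
  interpret increasing_path d by fact
  have "(d \<longlongrightarrow> 0) (at_right 0)" using assms(2) start by (simp add: continuous_within)
  then have "\<forall>\<^sub>F x in at_right 0. d x < 1" by (rule order_tendstoD) simp
  then obtain b where b: "0 < b" "\<And>x. 0 < x \<Longrightarrow> x < b \<Longrightarrow> d x < 1" unfolding eventually_at_right_field by auto
  obtain n where n: "1 / real (Suc n) < b" using b(1) nat_approx_posE by blast
  show ?thesis
  proof (rule that[of n])
    fix x assume x: "x \<in> {0..1 / real (Suc n)}"
    have "d x \<le> d (1 / real (Suc n))" using x by (intro path_mono) auto
    also have "\<dots> < 1" using n by (intro b) auto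
    finally show "d x \<in> {0..1}" using path_mono[of 0 x] start x by simp
  qed
qed

theorem proposition3p1:
  fixes M :: "'w measure"
    and Y :: "real \<Rightarrow> 'w \<Rightarrow> 'a::euclidean_space"
    and D :: "real \<Rightarrow> 'w \<Rightarrow> real"
    and X :: "real \<Rightarrow> 'w \<Rightarrow> 'a"
    and \<alpha> \<beta> :: real
  assumes "prob_space M"
    and "0 < \<alpha>" "\<alpha> \<le> 2"
    and "0 < \<beta>" "\<beta> < 1"
    and "stable_levy_motion M \<alpha> Y"
    and "not_confined M \<alpha> Y"
    and "stable_subordinator M \<beta> D"
    and "indep_processes M Y D"
    and X: "\<And>t \<omega>. 0 \<le> t \<Longrightarrow> \<omega> \<in> space M \<Longrightarrow> X t \<omega> = Y (inverse_process D t \<omega>) \<omega>"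
  shows "(AE \<omega> in M.
            hausdorff_dim ((\<lambda>t. X t \<omega>) ` {0..1}) = ereal (min (real DIM('a)) \<alpha>) \<and>
            packing_dim ((\<lambda>t. X t \<omega>) ` {0..1}) = ereal (min (real DIM('a)) \<alpha>))
       \<and> (\<alpha> \<le> real DIM('a) \<longrightarrow> (AE \<omega> in M.
            hausdorff_dim ((\<lambda>t. (t, X t \<omega>)) ` {0..1}) = ereal (max 1 \<alpha>) \<and>
            packing_dim ((\<lambda>t. (t, X t \<omega>)) ` {0..1}) = ereal (max 1 \<alpha>)))
       \<and> (\<alpha> > real DIM('a) \<and> DIM('a) = 1 \<longrightarrow> (AE \<omega> in M.
            hausdorff_dim ((\<lambda>t. (t, X t \<omega>)) ` {0..1}) = ereal (1 + \<beta> * (1 - 1 / \<alpha>)) \<and>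
            packing_dim ((\<lambda>t. (t, X t \<omega>)) ` {0..1}) = ereal (1 + \<beta> * (1 - 1 / \<alpha>))))"
proof -
  interpret prob_space M by fact
  interpret Y: stable_motion M Y \<alpha> by unfold_locales (use assms in auto)
  interpret D: stable_motion M D \<beta>
    by unfold_locales (use assms in \<open>auto simp: stable_subordinator_def\<close>)
  have D_nc: "not_confined M \<beta> D" and D_path: "AE \<omega> in M. increasing_path (\<lambda>x. D x \<omega>)"
    using stable_subordinator_facts assms by blast+
  have graph_sub: "(\<lambda>t. X t \<omega>) ` {0..1} = snd ` (\<lambda>t. (t, X t \<omega>)) ` {0..1}"
    "{0..1} = fst ` (\<lambda>t. (t, X t \<omega>)) ` {0..1}" for \<omega> by (auto simp: image_image)
  \<comment> \<open>Pathwise data: \<open>T\<close> bounds the inverse on \<open>{0..1}\<close>, and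
    up to time \<open>1 / real (Suc n)\<close> the subordinator stays within \<open>{0..1}\<close>.
    Both depend on \<open>\<omega>\<close>, so the lower bounds below are established for all
    \<open>n\<close> simultaneously.\<close>
  define good where "good \<omega> n T \<longleftrightarrow> (\<forall>t\<in>{0..1}. inverse_process D t \<omega> \<in> {0..real T})
    \<and> mono_on {0..1} (\<lambda>t. inverse_process D t \<omega>)
    \<and> (\<forall>s t. inverse_process D s \<omega> < inverse_process D t \<omega> \<longrightarrow>
         (\<exists>z. 0 \<le> z \<and> z \<le> inverse_process D t \<omega> \<and> s \<le> D z \<omega> \<and> D z \<omega> \<le> t))
    \<and> (\<forall>x\<in>{0..1 / real (Suc n)}. D x \<omega> \<in> {0..1} \<and> X (D x \<omega>) \<omega> = Y x \<omega>)
    \<and> (\<forall>t\<in>{0..1}. X t \<omega> = Y (inverse_process D t \<omega>) \<omega>)" for \<omega> n and T :: nat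
  have good: "AE \<omega> in M. \<exists>n T. good \<omega> n T"
    using D_path D.AE_cadlag AE_space
  proof eventually_elim
    case (elim \<omega>)
    interpret P: increasing_path "\<lambda>x. D x \<omega>" by (rule elim(1))
    have inv: "inverse_process D t \<omega> = P.inv_path t" for t
      by (simp add: inverse_process_def P.inv_path_def)
    have "continuous (at_right 0) (\<lambda>x. D x \<omega>)" using elim(2) by (simp add: cadlag_def)
    then obtain n where n: "\<And>x. x \<in> {0..1 / real (Suc n)} \<Longrightarrow> D x \<omega> \<in> {0..1}"
      using increasing_path_initial_interval[OF elim(1)] by blast
    obtain x1 where x1: "0 \<le> x1" "1 < D x1 \<omega>" using P.unbounded by blast
    obtain T :: nat where T: "x1 \<le> real T" using real_arch_simple by blast
    have "P.inv_path t \<in> {0..real T}" if "t \<in> {0..1}" for t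
      using P.inv_path_nonneg[of t] P.inv_path_le[OF x1(1), of t] x1(2) T that by auto
    moreover have "mono_on {0..1} (\<lambda>t. P.inv_path t)" by (auto simp: mono_on_def intro: P.inv_path_mono)
    moreover have "X (D x \<omega>) \<omega> = Y x \<omega>" if "x \<in> {0..1 / real (Suc n)}" for x
      using X[of "D x \<omega>" \<omega>] n[OF that] that elim(3) P.inv_path_inverse[of x] by (simp add: inv)
    ultimately have "good \<omega> n T"
      unfolding good_def inv using n P.inv_path_between X elim(3) inv by auto
    then show ?case by blast
  qed
  have lower: "AE \<omega> in M. \<forall>n::nat. ereal (min (real DIM('a)) \<alpha>) \<le> hausdorff_dim ((\<lambda>x. Y x \<omega>) ` {0..1 / real (Suc n)})"
    unfolding AE_all_countable by (intro allI Y.AE_hausdorff_dim_range_ge assms) simp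
  have range_image: "(\<lambda>t. X t \<omega>) ` {0..1} \<subseteq> (\<lambda>x. Y x \<omega>) ` {0..real T}"
    "(\<lambda>x. Y x \<omega>) ` {0..1 / real (Suc n)} \<subseteq> (\<lambda>t. X t \<omega>) ` {0..1}"
    "(\<lambda>x. (D x \<omega>, Y x \<omega>)) ` {0..1 / real (Suc n)} \<subseteq> (\<lambda>t. (t, X t \<omega>)) ` {0..1}"
    "(\<lambda>t. (t, X t \<omega>)) ` {0..1} = (\<lambda>t. (t, Y (inverse_process D t \<omega>) \<omega>)) ` {0..1}"
    if g: "good \<omega> n T" for \<omega> n T
  proof -
    have e: "inverse_process D t \<omega> \<in> {0..real T}" "X t \<omega> = Y (inverse_process D t \<omega>) \<omega>" if "t \<in> {0..1}" for t
      using g that by (auto simp: good_def)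
    have x: "D x \<omega> \<in> {0..1}" "X (D x \<omega>) \<omega> = Y x \<omega>" if "x \<in> {0..1 / real (Suc n)}" for x
      using g that unfolding good_def by blast+
    show "(\<lambda>t. X t \<omega>) ` {0..1} \<subseteq> (\<lambda>x. Y x \<omega>) ` {0..real T}"
      using e by (intro image_subsetI) (metis imageI)
    show "(\<lambda>x. Y x \<omega>) ` {0..1 / real (Suc n)} \<subseteq> (\<lambda>t. X t \<omega>) ` {0..1}"
      using x by (intro image_subsetI) (metis imageI)
    show "(\<lambda>x. (D x \<omega>, Y x \<omega>)) ` {0..1 / real (Suc n)} \<subseteq> (\<lambda>t. (t, X t \<omega>)) ` {0..1}"
    proof (rule image_subsetI)
      fix y assume "y \<in> {0..1 / real (Suc n)}"
      from x[OF this] show "(D y \<omega>, Y y \<omega>) \<in> (\<lambda>t. (t, X t \<omega>)) ` {0..1}"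
        by (intro image_eqI[of _ _ "D y \<omega>"]) auto
    qed
    show "(\<lambda>t. (t, X t \<omega>)) ` {0..1} = (\<lambda>t. (t, Y (inverse_process D t \<omega>) \<omega>)) ` {0..1}"
      using e(2) by (intro image_cong) auto
  qed
  have range_lower: "AE \<omega> in M. ereal (min (real DIM('a)) \<alpha>) \<le> hausdorff_dim ((\<lambda>t. X t \<omega>) ` {0..1})"
    using good lower
  proof eventually_elim
    case (elim \<omega>)
    then obtain n T where g: "good \<omega> n T" by blast
    have "ereal (min (real DIM('a)) \<alpha>) \<le> hausdorff_dim ((\<lambda>x. Y x \<omega>) ` {0..1 / real (Suc n)})" using elim(2) by blast
    also have "\<dots> \<le> hausdorff_dim ((\<lambda>t. X t \<omega>) ` {0..1})" by (rule hausdorff_dim_mono[OF range_image(2)[OF g]])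
    finally show ?case .
  qed
  have range_upper: "AE \<omega> in M. packing_dim ((\<lambda>t. X t \<omega>) ` {0..1}) \<le> ereal (min (real DIM('a)) \<alpha>)"
    using good Y.AE_osc_growth
  proof eventually_elim
    case (elim \<omega>)
    then obtain n T where g: "good \<omega> n T" by blast
    have "packing_dim ((\<lambda>t. X t \<omega>) ` {0..1}) \<le> packing_dim ((\<lambda>x. Y x \<omega>) ` {0..real T})"
      by (rule packing_dim_mono[OF range_image(1)[OF g]])
    moreover have "packing_dim ((\<lambda>x. Y x \<omega>) ` {0..real T}) \<le> ereal \<alpha>"
      using packing_dim_osc_growth_le[OF elim(2)] assms by simp
    moreover have "packing_dim ((\<lambda>x. Y x \<omega>) ` {0..real T}) \<le> ereal DIM('a)"
      by (rule packing_dim_le_DIM[OF osc_growth_bounded[OF elim(2)]])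
    ultimately show ?case by (auto simp: min_def intro: order_trans)
  qed
  have eqI: "hausdorff_dim A = c \<and> packing_dim A = c" if "c \<le> hausdorff_dim A" "packing_dim A \<le> c" for A :: "'z::metric_space set" and c
    using that hausdorff_dim_le_packing_dim[of A] by (auto intro: antisym order_trans)
  have part1: "AE \<omega> in M. hausdorff_dim ((\<lambda>t. X t \<omega>) ` {0..1}) = ereal (min (real DIM('a)) \<alpha>) \<and>
            packing_dim ((\<lambda>t. X t \<omega>) ` {0..1}) = ereal (min (real DIM('a)) \<alpha>)"
    using range_lower range_upper by eventually_elim (rule eqI)
  have part2: "AE \<omega> in M. hausdorff_dim ((\<lambda>t. (t, X t \<omega>)) ` {0..1}) = ereal (max 1 \<alpha>) \<and>
            packing_dim ((\<lambda>t. (t, X t \<omega>)) ` {0..1}) = ereal (max 1 \<alpha>)" if le: "\<alpha> \<le> real DIM('a)"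
    using good range_lower Y.AE_osc_growth
  proof eventually_elim
    case (elim \<omega>)
    then obtain n T where g: "good \<omega> n T" by blast
    let ?G = "(\<lambda>t. (t, X t \<omega>)) ` {0..1::real}"
    show ?case
    proof (rule eqI)
      have "ereal \<alpha> \<le> hausdorff_dim (snd ` ?G)" 
        using elim(2) unfolding graph_sub(1)[symmetric] min_absorb2[OF le] .
      also have "\<dots> \<le> hausdorff_dim ?G" by (rule hausdorff_dim_image_le) (rule dist_snd_le)
      finally have "ereal \<alpha> \<le> hausdorff_dim ?G" .
      moreover have "ereal 1 \<le> hausdorff_dim (fst ` ?G)"
        using hausdorff_dim_unit_interval_ge unfolding graph_sub(2)[of \<omega>, symmetric] .
      then have "ereal 1 \<le> hausdorff_dim ?G"
        using hausdorff_dim_image_le[of fst ?G, OF dist_fst_le] by (rule order_trans)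
      ultimately show "ereal (max 1 \<alpha>) \<le> hausdorff_dim ?G" by (simp add: max_def)
      show "packing_dim ?G \<le> ereal (max 1 \<alpha>)"
        unfolding range_image(4)[OF g]
        by (rule packing_dim_graph_le_max[OF elim(3), of "\<lambda>t. inverse_process D t \<omega>" T])
          (use g assms in \<open>auto simp: good_def\<close>)
    qed
  qed
  have part3: "AE \<omega> in M. hausdorff_dim ((\<lambda>t. (t, X t \<omega>)) ` {0..1}) = ereal (1 + \<beta> * (1 - 1 / \<alpha>)) \<and>
            packing_dim ((\<lambda>t. (t, X t \<omega>)) ` {0..1}) = ereal (1 + \<beta> * (1 - 1 / \<alpha>))" if gt: "\<alpha> > real DIM('a)" "DIM('a) = 1"
  proof -
    have \<alpha>1: "1 < \<alpha>" using gt by simp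
    have "AE \<omega> in M. \<forall>n::nat. ereal (1 + \<beta> * (1 - 1 / \<alpha>)) \<le> hausdorff_dim ((\<lambda>x. (D x \<omega>, Y x \<omega>)) ` {0..1 / real (Suc n)})"
      unfolding AE_all_countable
      by (intro allI AE_hausdorff_dim_pair_ge[OF Y.stable_motion_axioms _ D.stable_motion_axioms D_nc]) (use assms \<alpha>1 in auto)
    then show ?thesis
      using good Y.AE_osc_growth D.AE_osc_growth
    proof eventually_elim
      case (elim \<omega>)
      then obtain n T where g: "good \<omega> n T" by blast
      let ?G = "(\<lambda>t. (t, X t \<omega>)) ` {0..1::real}"
      show ?case
      proof (rule eqI)
        have "ereal (1 + \<beta> * (1 - 1 / \<alpha>)) \<le> hausdorff_dim ((\<lambda>x. (D x \<omega>, Y x \<omega>)) ` {0..1 / real (Suc n)})"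
          using elim(1) by blast
        also have "\<dots> \<le> hausdorff_dim ?G" by (rule hausdorff_dim_mono[OF range_image(3)[OF g]])
        finally show "ereal (1 + \<beta> * (1 - 1 / \<alpha>)) \<le> hausdorff_dim ?G" .
        show "packing_dim ?G \<le> ereal (1 + \<beta> * (1 - 1 / \<alpha>))"
          unfolding range_image(4)[OF g]
        proof (rule packing_dim_graph_le[OF gt(2) elim(3) \<alpha>1 elim(4) assms(4,5), of "\<lambda>t. inverse_process D t \<omega>" T])
          show "mono_on {0..1} (\<lambda>t. inverse_process D t \<omega>)" using g by (simp add: good_def)
          show "(\<lambda>t. inverse_process D t \<omega>) ` {0..1} \<subseteq> {0..real T}" using g by (auto simp: good_def)
          fix s t :: real assume st: "0 \<le> s" "s \<le> t" "t \<le> 1" "inverse_process D s \<omega> < inverse_process D t \<omega>"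
          then obtain z where z: "0 \<le> z" "z \<le> inverse_process D t \<omega>" "s \<le> D z \<omega>" "D z \<omega> \<le> t"
            using g unfolding good_def by blast
          moreover have "inverse_process D t \<omega> \<le> real T" using g st by (auto simp: good_def)
          ultimately show "\<exists>z\<in>{0..real T}. s \<le> D z \<omega> \<and> D z \<omega> \<le> t" by (intro bexI[of _ z]) auto
        qed
      qed
    qed
  qed
  show ?thesis using part1 part2 part3 by blast
qed

end
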